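(* Let $d_1,d_2\in\mathbb{N}$ with $d_1\ge 2d_2-1$, and let $V$ be a simple $\mathcal{G}_{d_1,d_2}$-module on which the central elements $M_0$ and $C$ act as scalars $\nu_0$ and $c$ respectively. Suppose there exists $t\in\mathbb{N}$ satisfying the following two conditions: (a) the action of $M_t$ on $V$ is injective; (b) $M_iV=Y_{j-\frac12}V=L_kV=0$ for all integers $i>t$, $j>t+d_2$ and $k>t+d_1$. Then: (1) $\mathrm{Ind}(V)=\mathcal{U}(\mathcal{G})\otimes_{\mathcal{U}(\mathcal{G}_{d_1,d_2})}V$ is a simple $\mathcal{G}$-module; (2) for all integers $i>t$, $j>t+d_2$ and $k>t+d_1$, the actions of $M_i$, $Y_{j-\frac12}$ and $L_k$ on $\mathrm{Ind}(V)$ are locally nilpotent.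
   Context: All vector spaces and Lie algebras are over $\mathbb{C}$; $\mathbb{N}$ denotes the nonnegative integers, and $\mathcal{U}(\cdot)$ denotes the universal enveloping algebra. The Schrödinger-Virasoro algebra $\mathcal{G}$ is the Lie algebra with basis $\{M_m,Y_{m+\frac12},L_m,C\mid m\in\mathbb{Z}\}$ and brackets, for all $m,n\in\mathbb{Z}$, $$[L_m,L_n]=(n-m)L_{m+n}+\delta_{m+n,0}\tfrac{m^3-m}{12}C,\quad [L_m,Y_{n+\frac12}]=\big(n+\tfrac{1-m}{2}\big)Y_{m+n+\frac12},$$ $$[Y_{m+\frac12},Y_{n+\frac12}]=(n-m)M_{m+n+1},\quad [L_m,M_n]=nM_{m+n},\quad [M_m,M_n]=[M_m,Y_{n+\frac12}]=[\mathcal{G},C]=0.$$ The center of $\mathcal{G}$ is spanned by $M_0$ and $C$. For $d_1,d_2\in\mathbb{N}$ with $d_1\ge 2d_2-1$, $\mathcal{G}_{d_1,d_2}$ is the subalgebra of $\mathcal{G}$ spanned by $C$, all $M_{i-d_1}$ and $L_i$ with $i\ge 0$, and all $Y_{i-d_2-\frac12}$ with $i\ge 1$. The action of an element $x$ of a Lie algebra on a module $V$ is locally nilpotent if for every $v\in V$ there is a positive integer $n$ with $x^nv=0$. *)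

theory Defs
  imports
    Complex_Main
    "HOL-Algebra.Algebra"
    "HOL-Algebra.Algebraic_Closure_Type"
    "HOL-Library.Poly_Mapping"
begin

section \<open>Lie algebras over the complex numbers and their modules\<close>

abbreviation complex_field :: "complex ring"
  where "complex_field \<equiv> ring_of_type_algebra"

text \<open>
  A complex vector space is a HOL-Algebra module over \<^const>\<open>complex_field\<close>. The record type of
  modules extends that of rings; its fields \<^const>\<open>monoid.mult\<close> and \<^const>\<open>monoid.one\<close> play no
  role for a module and are left \<^const>\<open>undefined\<close> in the concrete structures below.
\<close>

record 'g lie_algebra = "(complex, 'g) module" +
  lie_bracket :: "'g \<Rightarrow> 'g \<Rightarrow> 'g"

locale lie_algebra = module complex_field L for L :: "('g, 'm) lie_algebra_scheme" (structure) +
  assumes lie_bracket_closed: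
      "\<lbrakk>x \<in> carrier L; y \<in> carrier L\<rbrakk> \<Longrightarrow> lie_bracket L x y \<in> carrier L"
    and lie_bracket_add_left:
      "\<lbrakk>x \<in> carrier L; y \<in> carrier L; z \<in> carrier L\<rbrakk> \<Longrightarrow>
        lie_bracket L (x \<oplus> y) z = lie_bracket L x z \<oplus> lie_bracket L y z"
    and lie_bracket_add_right:
      "\<lbrakk>x \<in> carrier L; y \<in> carrier L; z \<in> carrier L\<rbrakk> \<Longrightarrow>
        lie_bracket L x (y \<oplus> z) = lie_bracket L x y \<oplus> lie_bracket L x z"
    and lie_bracket_smult_left:
      "\<lbrakk>x \<in> carrier L; y \<in> carrier L\<rbrakk> \<Longrightarrow>
        lie_bracket L (c \<odot> x) y = c \<odot> lie_bracket L x y"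
    and lie_bracket_smult_right:
      "\<lbrakk>x \<in> carrier L; y \<in> carrier L\<rbrakk> \<Longrightarrow>
        lie_bracket L x (c \<odot> y) = c \<odot> lie_bracket L x y"
    and lie_bracket_self:
      "x \<in> carrier L \<Longrightarrow> lie_bracket L x x = \<zero>"
    and lie_bracket_jacobi:
      "\<lbrakk>x \<in> carrier L; y \<in> carrier L; z \<in> carrier L\<rbrakk> \<Longrightarrow>
        lie_bracket L x (lie_bracket L y z) \<oplus> lie_bracket L y (lie_bracket L z x)
          \<oplus> lie_bracket L z (lie_bracket L x y) = \<zero>"

record ('g, 'v) lie_module = "(complex, 'v) module" +
  act :: "'g \<Rightarrow> 'v \<Rightarrow> 'v"

locale lie_module =
  L: lie_algebra L + V: module complex_field V
  for L :: "('g, 'm) lie_algebra_scheme" and V :: "('g, 'v, 'n) lie_module_scheme" +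
  assumes act_closed:
      "\<lbrakk>x \<in> carrier L; v \<in> carrier V\<rbrakk> \<Longrightarrow> act V x v \<in> carrier V"
    and act_add_left:
      "\<lbrakk>x \<in> carrier L; y \<in> carrier L; v \<in> carrier V\<rbrakk> \<Longrightarrow>
        act V (x \<oplus>\<^bsub>L\<^esub> y) v = act V x v \<oplus>\<^bsub>V\<^esub> act V y v"
    and act_smult_left:
      "\<lbrakk>x \<in> carrier L; v \<in> carrier V\<rbrakk> \<Longrightarrow>
        act V (c \<odot>\<^bsub>L\<^esub> x) v = c \<odot>\<^bsub>V\<^esub> act V x v"
    and act_add_right:
      "\<lbrakk>x \<in> carrier L; v \<in> carrier V; w \<in> carrier V\<rbrakk> \<Longrightarrow>
        act V x (v \<oplus>\<^bsub>V\<^esub> w) = act V x v \<oplus>\<^bsub>V\<^esub> act V x w"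
    and act_smult_right:
      "\<lbrakk>x \<in> carrier L; v \<in> carrier V\<rbrakk> \<Longrightarrow>
        act V x (c \<odot>\<^bsub>V\<^esub> v) = c \<odot>\<^bsub>V\<^esub> act V x v"
    and act_lie_bracket:
      "\<lbrakk>x \<in> carrier L; y \<in> carrier L; v \<in> carrier V\<rbrakk> \<Longrightarrow>
        act V (lie_bracket L x y) v = act V x (act V y v) \<ominus>\<^bsub>V\<^esub> act V y (act V x v)"

definition lie_submodule ::
    "('g, 'm) lie_algebra_scheme \<Rightarrow> ('g, 'v, 'n) lie_module_scheme \<Rightarrow> 'v set \<Rightarrow> bool"
  where "lie_submodule L V W \<longleftrightarrow>
    submodule W complex_field V \<and> (\<forall>x \<in> carrier L. \<forall>w \<in> W. act V x w \<in> W)"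

definition simple_lie_module ::
    "('g, 'm) lie_algebra_scheme \<Rightarrow> ('g, 'v, 'n) lie_module_scheme \<Rightarrow> bool"
  where "simple_lie_module L V \<longleftrightarrow>
    lie_module L V \<and> carrier V \<noteq> {\<zero>\<^bsub>V\<^esub>} \<and>
    (\<forall>W. lie_submodule L V W \<longrightarrow> W = {\<zero>\<^bsub>V\<^esub>} \<or> W = carrier V)"

definition locally_nilpotent :: "('g, 'v, 'n) lie_module_scheme \<Rightarrow> 'g \<Rightarrow> bool"
  where "locally_nilpotent V x \<longleftrightarrow> (\<forall>v \<in> carrier V. \<exists>n>0. (act V x ^^ n) v = \<zero>\<^bsub>V\<^esub>)"


section \<open>The universal enveloping algebra\<close>

text \<open>
  Lists form the free monoid, so that \<^typ>\<open>'a list \<Rightarrow>\<^sub>0 complex\<close> with its convolution product is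
  the free associative unital complex algebra on the letters \<^typ>\<open>'a\<close>.
\<close>

instantiation list :: (type) monoid_add
begin

definition zero_list_def: "0 = []"
definition plus_list_def: "xs + ys = xs @ ys"

instance
  by standard (simp_all add: zero_list_def plus_list_def)

end

definition free_algebra :: "'a set \<Rightarrow> ('a list \<Rightarrow>\<^sub>0 complex) ring"
  where "free_algebra A = ring_of_type_algebra \<lparr>carrier := {p. Poly_Mapping.keys p \<subseteq> lists A}\<rparr>"

text \<open>
  \<open>U(L)\<close> is the free algebra on the underlying set of \<open>L\<close> modulo the two-sided ideal which makes
  the insertion of letters linear and turns the bracket of \<open>L\<close> into the commutator. Dividing by
  the first two families of relators alone gives the tensor algebra of the vector space \<open>L\<close>.
\<close>

definition uea_relators :: "('g, 'm) lie_algebra_scheme \<Rightarrow> ('g list \<Rightarrow>\<^sub>0 complex) set"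
  where "uea_relators L =
      {Poly_Mapping.single [x \<oplus>\<^bsub>L\<^esub> y] 1 - Poly_Mapping.single [x] 1 - Poly_Mapping.single [y] 1
        | x y. x \<in> carrier L \<and> y \<in> carrier L}
    \<union> {Poly_Mapping.single [c \<odot>\<^bsub>L\<^esub> x] 1 - Poly_Mapping.single [x] c
        | c x. x \<in> carrier L}
    \<union> {Poly_Mapping.single [x, y] 1 - Poly_Mapping.single [y, x] 1
          - Poly_Mapping.single [lie_bracket L x y] 1
        | x y. x \<in> carrier L \<and> y \<in> carrier L}"

definition uea_ideal :: "('g, 'm) lie_algebra_scheme \<Rightarrow> ('g list \<Rightarrow>\<^sub>0 complex) set"
  where "uea_ideal L = Idl\<^bsub>free_algebra (carrier L)\<^esub> (uea_relators L)"

type_synonym 'g uea = "('g list \<Rightarrow>\<^sub>0 complex) set"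

definition uea :: "('g, 'm) lie_algebra_scheme \<Rightarrow> 'g uea ring"
  where "uea L = free_algebra (carrier L) Quot uea_ideal L"

definition uea_class :: "('g, 'm) lie_algebra_scheme \<Rightarrow> ('g list \<Rightarrow>\<^sub>0 complex) \<Rightarrow> 'g uea"
  where "uea_class L p = uea_ideal L +>\<^bsub>free_algebra (carrier L)\<^esub> p"

definition uea_gen :: "('g, 'm) lie_algebra_scheme \<Rightarrow> 'g \<Rightarrow> 'g uea"
  where "uea_gen L x = uea_class L (Poly_Mapping.single [x] 1)"

definition uea_scalar :: "('g, 'm) lie_algebra_scheme \<Rightarrow> complex \<Rightarrow> 'g uea"
  where "uea_scalar L c = uea_class L (Poly_Mapping.single [] c)"

text \<open>
  The homomorphism \<open>U(H) \<rightarrow> U(L)\<close> induced by the inclusion of a subalgebra \<open>H\<close> of \<open>L\<close>: the union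
  is over the representatives \<open>p\<close> of \<open>s\<close>, all of which have the same class in \<open>U(L)\<close>.
\<close>

definition uea_incl :: "('g, 'm) lie_algebra_scheme \<Rightarrow> 'g uea \<Rightarrow> 'g uea"
  where "uea_incl L s = (\<Union>p \<in> s. uea_class L p)"

text \<open>
  The action of \<open>U(L)\<close> on an \<open>L\<close>-module: the word \<open>x\<^sub>1\<dots>x\<^sub>n\<close> acts as \<open>x\<^sub>1(\<dots>(x\<^sub>n v))\<close>, and a class
  acts through any of its representatives.
\<close>

definition free_algebra_act ::
    "('g, 'v, 'n) lie_module_scheme \<Rightarrow> ('g list \<Rightarrow>\<^sub>0 complex) \<Rightarrow> 'v \<Rightarrow> 'v"
  where "free_algebra_act V p v =
    finsum V (\<lambda>w. Poly_Mapping.lookup p w \<odot>\<^bsub>V\<^esub> foldr (act V) w v) (Poly_Mapping.keys p)"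

definition uea_act :: "('g, 'v, 'n) lie_module_scheme \<Rightarrow> 'g uea \<Rightarrow> 'v \<Rightarrow> 'v"
  where "uea_act V s = free_algebra_act V (SOME p. p \<in> s)"


section \<open>Tensor products and induced modules\<close>

text \<open>
  \<open>A \<otimes>\<^sub>R V\<close> for a right module \<open>A\<close> and a left module \<open>V\<close> over a not necessarily commutative ring
  \<open>R\<close>, with actions \<open>ra\<close> and \<open>la\<close>: the free Abelian group on \<open>A \<times> V\<close> modulo the subgroup generated
  by the biadditivity relators and the balancing relators \<open>(a r, v) - (a, r v)\<close>. As in
  \<^const>\<open>free_Abelian_group\<close>, the group operation of the result is \<^const>\<open>monoid.mult\<close>.
\<close>

definition tensor_relators ::
    "('r, 'k) ring_scheme \<Rightarrow> ('a, 'm) ring_scheme \<Rightarrow> ('a \<Rightarrow> 'r \<Rightarrow> 'a) \<Rightarrow>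
     ('v, 'n) ring_scheme \<Rightarrow> ('r \<Rightarrow> 'v \<Rightarrow> 'v) \<Rightarrow> ('a \<times> 'v \<Rightarrow>\<^sub>0 int) set"
  where "tensor_relators R A ra V la =
      {frag_of (a \<oplus>\<^bsub>A\<^esub> b, v) - frag_of (a, v) - frag_of (b, v)
        | a b v. a \<in> carrier A \<and> b \<in> carrier A \<and> v \<in> carrier V}
    \<union> {frag_of (a, v \<oplus>\<^bsub>V\<^esub> w) - frag_of (a, v) - frag_of (a, w)
        | a v w. a \<in> carrier A \<and> v \<in> carrier V \<and> w \<in> carrier V}
    \<union> {frag_of (ra a r, v) - frag_of (a, la r v)
        | a r v. a \<in> carrier A \<and> r \<in> carrier R \<and> v \<in> carrier V}"

definition tensor_kernel ::
    "('r, 'k) ring_scheme \<Rightarrow> ('a, 'm) ring_scheme \<Rightarrow> ('a \<Rightarrow> 'r \<Rightarrow> 'a) \<Rightarrow>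
     ('v, 'n) ring_scheme \<Rightarrow> ('r \<Rightarrow> 'v \<Rightarrow> 'v) \<Rightarrow> ('a \<times> 'v \<Rightarrow>\<^sub>0 int) set"
  where "tensor_kernel R A ra V la =
    generate (free_Abelian_group (carrier A \<times> carrier V)) (tensor_relators R A ra V la)"

definition tensor_product ::
    "('r, 'k) ring_scheme \<Rightarrow> ('a, 'm) ring_scheme \<Rightarrow> ('a \<Rightarrow> 'r \<Rightarrow> 'a) \<Rightarrow>
     ('v, 'n) ring_scheme \<Rightarrow> ('r \<Rightarrow> 'v \<Rightarrow> 'v) \<Rightarrow> ('a \<times> 'v \<Rightarrow>\<^sub>0 int) set monoid"
  where "tensor_product R A ra V la =
    free_Abelian_group (carrier A \<times> carrier V) Mod tensor_kernel R A ra V la"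

text \<open>
  The map \<open>a \<otimes> v \<mapsto> f a \<otimes> v\<close> of the tensor product induced by an endomorphism \<open>f\<close> of the right
  module \<open>A\<close>. An element \<open>S\<close> is a coset; the union over its elements \<open>p\<close> is a single coset again.
\<close>

definition tensor_map_left ::
    "('r, 'k) ring_scheme \<Rightarrow> ('a, 'm) ring_scheme \<Rightarrow> ('a \<Rightarrow> 'r \<Rightarrow> 'a) \<Rightarrow>
     ('v, 'n) ring_scheme \<Rightarrow> ('r \<Rightarrow> 'v \<Rightarrow> 'v) \<Rightarrow> ('a \<Rightarrow> 'a) \<Rightarrow>
     ('a \<times> 'v \<Rightarrow>\<^sub>0 int) set \<Rightarrow> ('a \<times> 'v \<Rightarrow>\<^sub>0 int) set"
  where "tensor_map_left R A ra V la f S =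
    (\<Union>p \<in> S. tensor_kernel R A ra V la
       #>\<^bsub>free_Abelian_group (carrier A \<times> carrier V)\<^esub> frag_extend (\<lambda>(a, v). frag_of (f a, v)) p)"

text \<open>
  \<open>U(G) \<otimes>\<^bsub>U(H)\<^esub> V\<close> for a subalgebra \<open>H\<close> of \<open>G\<close> and an \<open>H\<close>-module \<open>V\<close>; scalars and elements of \<open>G\<close>
  act by left multiplication on the factor \<open>U(G)\<close>.
\<close>

definition induced_module ::
    "('g, 'm) lie_algebra_scheme \<Rightarrow> ('g, 'k) lie_algebra_scheme \<Rightarrow> ('g, 'v, 'n) lie_module_scheme \<Rightarrow>
     ('g, ('g uea \<times> 'v \<Rightarrow>\<^sub>0 int) set) lie_module"
  where "induced_module G H V =
    (let ra = (\<lambda>a s. a \<otimes>\<^bsub>uea G\<^esub> uea_incl G s);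
         T = tensor_product (uea H) (uea G) ra V (uea_act V);
         lmult = (\<lambda>u. tensor_map_left (uea H) (uea G) ra V (uea_act V) (\<lambda>a. u \<otimes>\<^bsub>uea G\<^esub> a))
     in \<lparr>carrier = carrier T, monoid.mult = undefined, one = undefined,
         ring.zero = \<one>\<^bsub>T\<^esub>, add = monoid.mult T,
         module.smult = (\<lambda>c. lmult (uea_scalar G c)),
         act = (\<lambda>x. lmult (uea_gen G x))\<rparr>)"


section \<open>The Schroedinger-Virasoro algebra\<close>

text \<open>\<open>IY m\<close> is the index of the basis element \<open>Y\<close> with half-integer subscript \<open>m + 1/2\<close>.\<close>

datatype sv_index = IM int | IY int | IL int | IC

type_synonym sv = "sv_index \<Rightarrow>\<^sub>0 complex"

definition sv_scale :: "complex \<Rightarrow> sv \<Rightarrow> sv"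
  where "sv_scale c x = Poly_Mapping.map ((*) c) x"

definition sv_M :: "int \<Rightarrow> sv" where "sv_M m = Poly_Mapping.single (IM m) 1"
definition sv_Y :: "int \<Rightarrow> sv" where "sv_Y m = Poly_Mapping.single (IY m) 1"
definition sv_L :: "int \<Rightarrow> sv" where "sv_L m = Poly_Mapping.single (IL m) 1"
definition sv_C :: sv where "sv_C = Poly_Mapping.single IC 1"

fun sv_basis_bracket :: "sv_index \<Rightarrow> sv_index \<Rightarrow> sv" where
  "sv_basis_bracket (IL m) (IL n) =
     sv_scale (of_int (n - m)) (sv_L (m + n))
     + (if m + n = 0 then sv_scale (of_int (m ^ 3 - m) / 12) sv_C else 0)"
| "sv_basis_bracket (IL m) (IY n) = sv_scale (of_int n + of_int (1 - m) / 2) (sv_Y (m + n))"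
| "sv_basis_bracket (IY n) (IL m) = - sv_scale (of_int n + of_int (1 - m) / 2) (sv_Y (m + n))"
| "sv_basis_bracket (IY m) (IY n) = sv_scale (of_int (n - m)) (sv_M (m + n + 1))"
| "sv_basis_bracket (IL m) (IM n) = sv_scale (of_int n) (sv_M (m + n))"
| "sv_basis_bracket (IM n) (IL m) = - sv_scale (of_int n) (sv_M (m + n))"
| "sv_basis_bracket (IM m) (IM n) = 0"
| "sv_basis_bracket (IM m) (IY n) = 0"
| "sv_basis_bracket (IY n) (IM m) = 0"
| "sv_basis_bracket IC _ = 0"
| "sv_basis_bracket _ IC = 0"

definition sv_bracket :: "sv \<Rightarrow> sv \<Rightarrow> sv"
  where "sv_bracket x y =
    (\<Sum>i \<in> Poly_Mapping.keys x. \<Sum>j \<in> Poly_Mapping.keys y.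
       sv_scale (Poly_Mapping.lookup x i * Poly_Mapping.lookup y j) (sv_basis_bracket i j))"

definition SV :: "sv lie_algebra"
  where "SV = \<lparr>carrier = UNIV, monoid.mult = undefined, one = undefined, ring.zero = 0, add = (+),
    module.smult = sv_scale, lie_bracket = sv_bracket\<rparr>"

text \<open>The generator \<open>Y\<close> with subscript \<open>i - d2 - 1/2\<close> is \<open>sv_Y (i - d2 - 1)\<close>.\<close>

definition SV_sub :: "nat \<Rightarrow> nat \<Rightarrow> sv lie_algebra"
  where "SV_sub d1 d2 = SV\<lparr>carrier := Modules.module.span sv_scale
      ({sv_C} \<union> {sv_M (i - int d1) | i. i \<ge> 0} \<union> {sv_L i | i. i \<ge> 0}
        \<union> {sv_Y (i - int d2 - 1) | i. i \<ge> 1})\<rparr>"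

subsection \<open>The axioms of a Lie algebra hold for the algebra and its subalgebras\<close>

lemma lookup_sv_scale [simp]:
  "Poly_Mapping.lookup (sv_scale c x) i = c * Poly_Mapping.lookup x i"
  by (simp add: sv_scale_def Poly_Mapping.map.rep_eq when_def)

lemma sv_scale_simps:
  "sv_scale c (x + y) = sv_scale c x + sv_scale c y"
  "sv_scale (a + b) x = sv_scale a x + sv_scale b x"
  "sv_scale a (sv_scale b x) = sv_scale (a * b) x"
  "sv_scale 1 x = x"
  "sv_scale c (- x) = - sv_scale c x"
  "sv_scale (- c) x = - sv_scale c x"
  "sv_scale c (x - y) = sv_scale c x - sv_scale c y"
  "sv_scale c 0 = 0" "sv_scale 0 x = 0"
  by (rule poly_mapping_eqI; simp add: lookup_add lookup_minus algebra_simps)+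

lemma sv_scale_module: "Modules.module sv_scale"
  by unfold_locales (simp_all add: sv_scale_simps)

lemma sv_scale_sum: "sv_scale c (sum f A) = (\<Sum>a\<in>A. sv_scale c (f a))"
  by (induction A rule: infinite_finite_induct) (simp_all add: sv_scale_simps)

lemma sv_bracket_superset:
  assumes "finite A" "Poly_Mapping.keys x \<subseteq> A" "finite B" "Poly_Mapping.keys y \<subseteq> B"
  shows "sv_bracket x y = (\<Sum>i\<in>A. \<Sum>j\<in>B.
    sv_scale (Poly_Mapping.lookup x i * Poly_Mapping.lookup y j) (sv_basis_bracket i j))"
proof -
  have "sv_bracket x y = (\<Sum>i\<in>Poly_Mapping.keys x. \<Sum>j\<in>B.
    sv_scale (Poly_Mapping.lookup x i * Poly_Mapping.lookup y j) (sv_basis_bracket i j))"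
    unfolding sv_bracket_def
    by (intro sum.cong refl sum.mono_neutral_left)
       (use assms in \<open>auto simp: in_keys_iff sv_scale_simps\<close>)
  also have "\<dots> = (\<Sum>i\<in>A. \<Sum>j\<in>B.
    sv_scale (Poly_Mapping.lookup x i * Poly_Mapping.lookup y j) (sv_basis_bracket i j))"
    by (intro sum.mono_neutral_left)
       (use assms in \<open>auto simp: in_keys_iff sv_scale_simps\<close>)
  finally show ?thesis .
qed

lemma sv_bracket_add_left: "sv_bracket (x + y) z = sv_bracket x z + sv_bracket y z"
proof -
  let ?A = "Poly_Mapping.keys x \<union> Poly_Mapping.keys y"
  have "Poly_Mapping.keys (x + y) \<subseteq> ?A" by (rule Poly_Mapping.keys_add)
  then show ?thesis
    by (subst (1 2 3) sv_bracket_superset[of ?A _ "Poly_Mapping.keys z"])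
       (auto simp: lookup_add sv_scale_simps ring_distribs sum.distrib)
qed

lemma sv_bracket_add_right: "sv_bracket z (x + y) = sv_bracket z x + sv_bracket z y"
proof -
  let ?A = "Poly_Mapping.keys x \<union> Poly_Mapping.keys y"
  have "Poly_Mapping.keys (x + y) \<subseteq> ?A" by (rule Poly_Mapping.keys_add)
  then show ?thesis
    by (subst (1 2 3) sv_bracket_superset[of "Poly_Mapping.keys z" _ ?A])
       (auto simp: lookup_add sv_scale_simps ring_distribs sum.distrib)
qed

lemma keys_sv_scale: "Poly_Mapping.keys (sv_scale c x) \<subseteq> Poly_Mapping.keys x"
  by (auto simp: in_keys_iff)

lemma sv_bracket_scale_left: "sv_bracket (sv_scale c x) z = sv_scale c (sv_bracket x z)"
  using keys_sv_scale[of c x]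
  by (subst (1 2) sv_bracket_superset[of "Poly_Mapping.keys x" _ "Poly_Mapping.keys z"])
     (auto simp: sv_scale_sum sv_scale_simps mult.assoc)

lemma sv_bracket_scale_right: "sv_bracket z (sv_scale c x) = sv_scale c (sv_bracket z x)"
  using keys_sv_scale[of c x]
  by (subst (1 2) sv_bracket_superset[of "Poly_Mapping.keys z" _ "Poly_Mapping.keys x"])
     (auto simp: sv_scale_sum sv_scale_simps mult_ac)

lemma sv_bracket_single:
  "sv_bracket (Poly_Mapping.single i 1) (Poly_Mapping.single j 1) = sv_basis_bracket i j"
  by (simp add: sv_bracket_def sv_scale_simps)

lemma sv_bracket_zero [simp]: "sv_bracket 0 x = 0" "sv_bracket x 0 = 0"
  by (simp_all add: sv_bracket_def)

lemma sv_bracket_minus: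
  "sv_bracket (- x) y = - sv_bracket x y" "sv_bracket x (- y) = - sv_bracket x y"
  using sv_bracket_scale_left[of "-1" x y] sv_bracket_scale_right[of x "-1" y]
  by (simp_all add: sv_scale_simps)

lemma sv_span_induct:
  assumes "Poly_Mapping.keys x \<subseteq> I"
    and "P 0" "\<And>i. i \<in> I \<Longrightarrow> P (Poly_Mapping.single i 1)"
    and "\<And>x y. P x \<Longrightarrow> P y \<Longrightarrow> P (x + y)" "\<And>c x. P x \<Longrightarrow> P (sv_scale c x)"
  shows "P x"
proof -
  have "x = (\<Sum>i\<in>Poly_Mapping.keys x. sv_scale (Poly_Mapping.lookup x i) (Poly_Mapping.single i 1))"
    by (rule poly_mapping_eqI)
       (simp add: lookup_sum lookup_single when_def if_distrib[of "(*) _"] in_keys_iff cong: if_cong)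
  moreover have "P (\<Sum>i\<in>A. sv_scale (Poly_Mapping.lookup x i) (Poly_Mapping.single i 1))"
    if "finite A" "A \<subseteq> I" for A
    using that by (induction A) (auto intro: assms)
  ultimately show ?thesis using assms(1) by (metis finite_keys)
qed

lemma sv_basis_bracket_antisym: "sv_basis_bracket i j = - sv_basis_bracket j i"
proof (cases i; cases j)
  fix m n assume ij: "i = IL m" "j = IL n"
  show ?thesis
  proof (cases "m + n = 0")
    case True
    then have "n = - m" by simp
    with ij show ?thesis
      by (auto intro!: poly_mapping_eqI simp: lookup_add field_simps)
  next
    case False
    with ij show ?thesis
      by (auto intro!: poly_mapping_eqI simp: lookup_add add.commute algebra_simps)
  qed
next
  fix m n assume "i = IY m" "j = IY n"
  then show ?thesis
    by (auto intro!: poly_mapping_eqI simp: lookup_add algebra_simps)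
qed auto

lemma sv_bracket_antisym: "sv_bracket x y = - sv_bracket y x"
  unfolding sv_bracket_def
  by (subst sum.swap, subst sv_basis_bracket_antisym)
     (simp add: sv_scale_simps sum_negf mult.commute)

lemma sv_bracket_self: "sv_bracket x x = 0"
proof (rule poly_mapping_eqI)
  fix i
  have "Poly_Mapping.lookup (sv_bracket x x) i = - Poly_Mapping.lookup (sv_bracket x x) i"
    using sv_bracket_antisym[of x x] by (metis lookup_uminus)
  then show "Poly_Mapping.lookup (sv_bracket x x) i = Poly_Mapping.lookup 0 i" by simp
qed

lemmas sv_bracket_linear =
  sv_bracket_add_left sv_bracket_add_right sv_bracket_scale_left sv_bracket_scale_right
  sv_bracket_minus

lemma sv_bracket_gens:
  "sv_bracket (sv_L m) (sv_L n) = sv_scale (of_int (n - m)) (sv_L (m + n))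
     + (if m + n = 0 then sv_scale (of_int (m ^ 3 - m) / 12) sv_C else 0)"
  "sv_bracket (sv_L m) (sv_Y n) = sv_scale (of_int n + of_int (1 - m) / 2) (sv_Y (m + n))"
  "sv_bracket (sv_Y n) (sv_L m) = - sv_scale (of_int n + of_int (1 - m) / 2) (sv_Y (m + n))"
  "sv_bracket (sv_Y m) (sv_Y n) = sv_scale (of_int (n - m)) (sv_M (m + n + 1))"
  "sv_bracket (sv_L m) (sv_M n) = sv_scale (of_int n) (sv_M (m + n))"
  "sv_bracket (sv_M n) (sv_L m) = - sv_scale (of_int n) (sv_M (m + n))"
  "sv_bracket (sv_M m) (sv_M n) = 0"
  "sv_bracket (sv_M m) (sv_Y n) = 0"
  "sv_bracket (sv_Y n) (sv_M m) = 0"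
  "sv_bracket sv_C x = 0" "sv_bracket x sv_C = 0"
proof -
  have C: "sv_bracket sv_C x = 0" for x
    by (simp add: sv_bracket_def sv_C_def sv_scale_simps)
  show "sv_bracket sv_C x = 0" "sv_bracket x sv_C = 0"
    using C[of x] sv_bracket_antisym[of x sv_C] by simp_all
qed (simp_all only: sv_L_def sv_M_def sv_Y_def sv_C_def sv_bracket_single sv_basis_bracket.simps)

lemma sv_single_cases:
  obtains m where "Poly_Mapping.single i 1 = sv_M m" | m where "Poly_Mapping.single i 1 = sv_Y m"
    | m where "Poly_Mapping.single i 1 = sv_L m" | "Poly_Mapping.single i 1 = sv_C"
  by (cases i) (auto simp: sv_L_def sv_M_def sv_Y_def sv_C_def)

definition sv_jac :: "sv \<Rightarrow> sv \<Rightarrow> sv \<Rightarrow> sv"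
  where "sv_jac x y z = sv_bracket x (sv_bracket y z) + sv_bracket y (sv_bracket z x)
    + sv_bracket z (sv_bracket x y)"

lemma sv_jac_rot: "sv_jac x y z = sv_jac y z x"
  by (simp add: sv_jac_def ac_simps)

lemma sv_jac_linear:
  "sv_jac 0 y z = 0"
  "sv_jac (x + x') y z = sv_jac x y z + sv_jac x' y z"
  "sv_jac (sv_scale c x) y z = sv_scale c (sv_jac x y z)"
  by (simp_all add: sv_jac_def sv_bracket_linear sv_scale_simps algebra_simps)

lemma sv_jac_C: "sv_jac sv_C y z = 0"
  by (simp add: sv_jac_def sv_bracket_gens)

lemma sv_jac_LLL: "sv_jac (sv_L m) (sv_L n) (sv_L k) = 0"
proof (cases "m + n + k = 0")
  case True
  then have k: "k = - m - n" by simp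
  show ?thesis
    unfolding k
    by (auto intro!: poly_mapping_eqI
          simp: sv_jac_def sv_bracket_linear sv_bracket_gens lookup_add field_simps power3_eq_cube)
next
  case False
  have nest: "sv_bracket (sv_L a) (sv_bracket (sv_L b) (sv_L d))
      = sv_scale (of_int ((d - b) * (b + d - a))) (sv_L (m + n + k))"
    if "a + (b + d) = m + n + k" for a b d
    using that False
    by (simp add: sv_bracket_linear sv_bracket_gens sv_scale_simps)
  have "sv_jac (sv_L m) (sv_L n) (sv_L k)
      = sv_scale (of_int ((k - n) * (n + k - m) + (m - k) * (k + m - n) + (n - m) * (m + n - k)))
          (sv_L (m + n + k))"
    unfolding sv_jac_def by (subst (1 2 3) nest) (simp_all flip: sv_scale_simps(2))
  also have "(k - n) * (n + k - m) + (m - k) * (k + m - n) + (n - m) * (m + n - k) = 0"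
    by (simp add: algebra_simps)
  finally show ?thesis by (simp add: sv_scale_simps)
qed

lemma sv_jac_rest:
  "sv_jac (sv_L m) (sv_L n) (sv_Y k) = 0" "sv_jac (sv_L m) (sv_L n) (sv_M k) = 0"
  "sv_jac (sv_L m) (sv_Y n) (sv_L k) = 0" "sv_jac (sv_L m) (sv_M n) (sv_L k) = 0"
  "sv_jac (sv_L m) (sv_Y n) (sv_Y k) = 0" "sv_jac (sv_L m) (sv_Y n) (sv_M k) = 0"
  "sv_jac (sv_L m) (sv_M n) (sv_Y k) = 0" "sv_jac (sv_L m) (sv_M n) (sv_M k) = 0"
  by (auto intro!: poly_mapping_eqI
      simp: sv_jac_def sv_bracket_linear sv_bracket_gens sv_scale_simps lookup_add field_simps)

lemma sv_jac_noL:
  "sv_jac (sv_Y m) (sv_Y n) (sv_Y k) = 0" "sv_jac (sv_Y m) (sv_Y n) (sv_M k) = 0"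
  "sv_jac (sv_Y m) (sv_M n) (sv_Y k) = 0" "sv_jac (sv_Y m) (sv_M n) (sv_M k) = 0"
  "sv_jac (sv_M m) (sv_Y n) (sv_Y k) = 0" "sv_jac (sv_M m) (sv_Y n) (sv_M k) = 0"
  "sv_jac (sv_M m) (sv_M n) (sv_Y k) = 0" "sv_jac (sv_M m) (sv_M n) (sv_M k) = 0"
  by (simp_all add: sv_jac_def sv_bracket_linear sv_bracket_gens sv_scale_simps)

lemma sv_jac_rotated:
  "sv_jac x sv_C y = 0" "sv_jac x y sv_C = 0"
  "sv_jac (sv_Y k) (sv_L m) (sv_L n) = 0" "sv_jac (sv_M k) (sv_L m) (sv_L n) = 0"
  "sv_jac (sv_Y n) (sv_Y k) (sv_L m) = 0" "sv_jac (sv_Y n) (sv_M k) (sv_L m) = 0"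
  "sv_jac (sv_M n) (sv_Y k) (sv_L m) = 0" "sv_jac (sv_M n) (sv_M k) (sv_L m) = 0"
  "sv_jac (sv_Y k) (sv_L m) (sv_Y n) = 0" "sv_jac (sv_M k) (sv_L m) (sv_Y n) = 0"
  "sv_jac (sv_Y k) (sv_L m) (sv_M n) = 0" "sv_jac (sv_M k) (sv_L m) (sv_M n) = 0"
  by (rule sv_jac_rot[THEN trans], (rule sv_jac_C sv_jac_rest
        | rule sv_jac_rot[THEN trans], rule sv_jac_C sv_jac_rest))+

lemma sv_jac_single:
  "sv_jac (Poly_Mapping.single i 1) (Poly_Mapping.single j 1) (Poly_Mapping.single k 1) = 0"
  by (rule sv_single_cases[of i]; rule sv_single_cases[of j]; rule sv_single_cases[of k];
      simp only: sv_jac_LLL sv_jac_rest sv_jac_noL sv_jac_C sv_jac_rotated)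

lemma sv_jac_extend:
  assumes "\<And>i. sv_jac (Poly_Mapping.single i 1) y z = 0"
  shows "sv_jac x y z = 0"
  by (rule sv_span_induct[of x UNIV]) (simp_all add: assms sv_jac_linear sv_scale_simps)

lemma sv_jacobi: "sv_jac x y z = 0"
proof -
  have 1: "sv_jac x (Poly_Mapping.single j 1) (Poly_Mapping.single k 1) = 0" for x j k
    by (rule sv_jac_extend) (rule sv_jac_single)
  have 2: "sv_jac y (Poly_Mapping.single k 1) x = 0" for x y k
    by (rule sv_jac_extend) (use 1 sv_jac_rot in metis)
  show ?thesis
    by (rule sv_jac_extend) (use 2 sv_jac_rot in metis)
qed

definition sv_sub_index :: "nat \<Rightarrow> nat \<Rightarrow> sv_index set"
  where "sv_sub_index d1 d2 = {IC} \<union> {IM m | m. m \<ge> - int d1} \<union> {IL m | m. m \<ge> 0}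
    \<union> {IY m | m. m \<ge> - int d2}"

lemma carrier_SV_sub: "carrier (SV_sub d1 d2) = {x. Poly_Mapping.keys x \<subseteq> sv_sub_index d1 d2}"
proof -
  interpret sv: Modules.module sv_scale by (rule sv_scale_module)
  let ?I = "sv_sub_index d1 d2"
  have "{sv_C} \<union> {sv_M (i - int d1) | i. i \<ge> 0} \<union> {sv_L i | i. i \<ge> 0}
      \<union> {sv_Y (i - int d2 - 1) | i. i \<ge> 1} = (\<lambda>i. Poly_Mapping.single i (1::complex)) ` ?I" (is "?S = ?T")
  proof (intro equalityI subsetI)
    fix x assume "x \<in> ?S"
    then show "x \<in> ?T"
      by (auto simp: sv_C_def sv_M_def sv_L_def sv_Y_def sv_sub_index_def)
  next
    fix x assume "x \<in> ?T"
    then obtain i where i: "i \<in> ?I" "x = Poly_Mapping.single i 1" by auto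
    show "x \<in> ?S"
    proof (cases i)
      case (IM m)
      with i have "x = sv_M ((m + int d1) - int d1)" "m + int d1 \<ge> 0"
        by (auto simp: sv_M_def sv_sub_index_def)
      then show ?thesis by blast
    next
      case (IY m)
      with i have "x = sv_Y ((m + int d2 + 1) - int d2 - 1)" "m + int d2 + 1 \<ge> 1"
        by (auto simp: sv_Y_def sv_sub_index_def)
      then show ?thesis by blast
    qed (use i in \<open>auto simp: sv_C_def sv_L_def sv_sub_index_def\<close>)
  qed
  moreover have "sv.span ?T = {x. Poly_Mapping.keys x \<subseteq> ?I}"
  proof (intro equalityI subsetI)
    fix x assume "x \<in> sv.span ?T"
    then show "x \<in> {x. Poly_Mapping.keys x \<subseteq> ?I}"
    proof (induction rule: sv.span_induct_alt)
      case (step c x y)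
      then have "Poly_Mapping.keys (sv_scale c x) \<subseteq> ?I"
        using keys_sv_scale[of c x] by auto
      with step show ?case using Poly_Mapping.keys_add[of "sv_scale c x" y] by auto
    qed auto
  next
    fix x :: sv assume "x \<in> {x. Poly_Mapping.keys x \<subseteq> ?I}"
    then have "Poly_Mapping.keys x \<subseteq> ?I" by simp
    then show "x \<in> sv.span ?T"
      by (rule sv_span_induct) (auto intro: sv.span_zero sv.span_base sv.span_add sv.span_scale)
  qed
  ultimately show ?thesis by (simp add: SV_sub_def SV_def)
qed

lemma sv_sub_basis_bracket:
  assumes "2 * int d2 - 1 \<le> int d1" "i \<in> sv_sub_index d1 d2" "j \<in> sv_sub_index d1 d2"
  shows "sv_basis_bracket i j \<in> carrier (SV_sub d1 d2)"
  using assms unfolding carrier_SV_sub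
  by (cases i; cases j)
     (auto simp: sv_C_def sv_M_def sv_L_def sv_Y_def sv_sub_index_def in_keys_iff lookup_add
        lookup_single when_def split: if_splits)

lemma sv_lie_algebra_on:
  assumes span: "S = {x. Poly_Mapping.keys x \<subseteq> I}"
    and closed: "\<And>i j. i \<in> I \<Longrightarrow> j \<in> I \<Longrightarrow> sv_basis_bracket i j \<in> S"
  shows "lie_algebra (SV\<lparr>carrier := S\<rparr>)"
proof -
  have add: "x + y \<in> S" if "x \<in> S" "y \<in> S" for x y
    using that Poly_Mapping.keys_add[of x y] unfolding span by blast
  have scale: "sv_scale c x \<in> S" if "x \<in> S" for c x
    using that keys_sv_scale[of c x] unfolding span by blast
  have zero: "0 \<in> S" unfolding span by simp
  have uminus: "- x \<in> S" if "x \<in> S" for x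
    using scale[OF that, of "-1"] by (simp add: sv_scale_simps)
  have sum: "sum f A \<in> S" if "\<And>a. a \<in> A \<Longrightarrow> f a \<in> S" for f :: "sv_index \<Rightarrow> sv" and A
    using that by (induction A rule: infinite_finite_induct) (auto intro: add zero)
  have bracket: "sv_bracket x y \<in> S" if "x \<in> S" "y \<in> S" for x y
    using that unfolding sv_bracket_def by (intro sum scale closed) (auto simp: span)
  have "cring complex_field" by (rule cring_from_type_algebra)
  moreover have "abelian_group (SV\<lparr>carrier := S\<rparr>)"
    by (rule abelian_groupI)
       (auto simp: SV_def add zero add_ac intro!: bexI[of _ "- _"] uminus)
  ultimately have "Module.module complex_field (SV\<lparr>carrier := S\<rparr>)"
    by (rule moduleI) (simp_all add: SV_def ring_of_type_algebra_def scale sv_scale_simps)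
  then show ?thesis
    by (rule lie_algebra.intro, unfold_locales)
       (use sv_jacobi in \<open>simp_all add: SV_def bracket sv_bracket_add_left sv_bracket_add_right
          sv_bracket_scale_left sv_bracket_scale_right sv_bracket_self sv_jac_def\<close>)
qed

lemma lie_algebra_SV: "lie_algebra SV"
  using sv_lie_algebra_on[of UNIV UNIV] by (simp add: SV_def)

lemma lie_algebra_SV_sub:
  assumes "2 * int d2 - 1 \<le> int d1"
  shows "lie_algebra (SV_sub d1 d2)"
proof -
  have "SV_sub d1 d2 = SV\<lparr>carrier := carrier (SV_sub d1 d2)\<rparr>"
    by (simp add: SV_sub_def)
  then show ?thesis
    using sv_lie_algebra_on[OF carrier_SV_sub sv_sub_basis_bracket[OF assms]] by simp
qed

end

theory Submission
  imports Defs "HOL-Library.List_Lexorder" "HOL-Library.Countable"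
begin

text \<open>
  Write \<open>H\<close> for the subalgebra \<open>SV_sub d1 d2\<close>. The induced module is spanned by the vectors obtained from
  \<open>1 \<otimes> V\<close> by applying generators outside \<open>H\<close>, and each such generator has a partner in \<open>H\<close> which kills
  \<open>V\<close> and whose bracket with it is a nonzero multiple of \<open>M\<^sub>t\<close>. Writing \<open>Y\<^sub>n\<close> for \<^term>\<open>sv_Y n\<close>, the pairs
  are, for \<open>k \<ge> 1\<close>,
  \<^item> \<open>M(-d1-k)\<close> and \<open>L(t+d1+k)\<close>, with bracket coefficient \<open>-(d1+k)\<close>,
  \<^item> \<open>Y(-d2-k)\<close> and \<open>Y(t+d2+k-1)\<close>, with coefficient \<open>-(t+2 d2+2k-1)\<close>,
  \<^item> \<open>L(-k)\<close> and \<open>M(t+k)\<close>, with coefficient \<open>-(t+k)\<close>.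

  \<^noindent> Applying to a nonzero vector the partners of the letters of a suitable leading monomial leaves a
  nonzero multiple of \<open>1 \<otimes> M\<^sub>t\<^sup>r v\<close>, where \<open>v \<noteq> 0\<close> is the leading coefficient; this does not vanish
  because \<open>M\<^sub>t\<close> is injective on \<open>V\<close>. So every nonzero submodule meets \<open>1 \<otimes> V\<close>, hence contains it by
  simplicity of \<open>V\<close>, hence is everything. The monomials are treated in the order \<open>L\<close>, \<open>Y\<close>, \<open>M\<close>.
  The letters \<open>Y\<close> and \<open>M\<close> can be adjoined to \<open>H\<close> one at a time, so that the leading term is that of a
  polynomial in one operator (\<open>weyl_pair_tower\<close>). The letters \<open>L(-k)\<close> cannot, and there the words are
  filtered by length and ordered lexicographically (\<open>Mword_Lword\<close>). Both steps are joined in \<open>descend\<close>.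

  This argument uses that monomials span, but not that they are independent. Independence enters only
  through the fact that \<open>1 \<otimes> V\<close> is not zero (\<open>embed_nonzero\<close>), without which simplicity would fail.
  It is the Poincare-Birkhoff-Witt theorem in Jacobson's form: a functional on words that respects the relations
  of the enveloping algebra can be prescribed freely on ordered words (\<open>straightening_exists\<close>). With
  the generators outside \<open>H\<close> ordered first, this yields a functional on \<open>U(G) \<otimes>\<^bsub>U(H)\<^esub> V\<close> which extends
  a given functional on \<open>V\<close>.

  Local nilpotency of an element \<open>x\<close> that kills \<open>V\<close> propagates from \<open>[x, z] w\<close> to \<open>z w\<close>
  (\<open>nil_orbit_bracket\<close>). For \<open>x = M\<^sub>i\<close> and \<open>x = Y\<^sub>i\<close> the operator \<open>ad x\<close> is nilpotent; for \<open>x = L\<^sub>k\<close> it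
  raises indices, and generators of large index kill any given vector.
\<close>

section \<open>Leading terms for pairs of operators\<close>

locale complex_space = vector_space scale
  for scale :: "complex \<Rightarrow> 'b \<Rightarrow> 'b :: ab_group_add"
begin

inductive_set opspan :: "('b \<Rightarrow> 'b) set \<Rightarrow> 'b set \<Rightarrow> 'b set" for F J where
  opspan_base: "v \<in> J \<Longrightarrow> v \<in> opspan F J"
| opspan_zero: "0 \<in> opspan F J"
| opspan_add: "v \<in> opspan F J \<Longrightarrow> w \<in> opspan F J \<Longrightarrow> v + w \<in> opspan F J"
| opspan_scale: "v \<in> opspan F J \<Longrightarrow> scale c v \<in> opspan F J"
| opspan_op: "f \<in> F \<Longrightarrow> v \<in> opspan F J \<Longrightarrow> f v \<in> opspan F J"

lemma opspan_subspace: "subspace (opspan F J)"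
  by (rule subspaceI) (auto intro: opspan.intros)

lemma opspan_least:
  assumes "J \<subseteq> U" "subspace U" "\<And>f u. f \<in> F \<Longrightarrow> u \<in> U \<Longrightarrow> f u \<in> U"
  shows "opspan F J \<subseteq> U"
proof
  fix v assume "v \<in> opspan F J"
  then show "v \<in> U"
    by induction (use assms in \<open>auto simp: subspace_def\<close>)
qed

lemma opspan_mono: "F \<subseteq> F' \<Longrightarrow> J \<subseteq> J' \<Longrightarrow> opspan F J \<subseteq> opspan F' J'"
  by (rule opspan_least) (auto intro: opspan.intros opspan_subspace)

lemma opspan_singleton_polynomial:
  assumes "Vector_Spaces.linear scale scale x" "subspace U" "w \<in> opspan {x} U"
  obtains N u where "\<And>n. u n \<in> U" "w = (\<Sum>n<N. (x ^^ n) (u n))"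
proof -
  interpret x: Vector_Spaces.linear scale scale x by fact
  have pow_add: "(x ^^ n) (v + w) = (x ^^ n) v + (x ^^ n) w" for n v w
    by (induction n) (simp_all add: x.add)
  have pow_scale: "(x ^^ n) (scale c v) = scale c ((x ^^ n) v)" for n v c
    by (induction n) (simp_all add: x.scale)
  have pow_zero: "(x ^^ n) 0 = 0" for n
    by (induction n) (simp_all add: x.zero)
  have "\<exists>u N. (\<forall>n. u n \<in> U) \<and> (\<forall>n\<ge>N. u n = 0) \<and> w = (\<Sum>n<N. (x ^^ n) (u n))"
    using assms(3)
  proof induction
    case (opspan_base v)
    then show ?case
      by (intro exI[of _ "\<lambda>n. if n = 0 then v else 0"] exI[of _ 1])
          (simp add: assms(2)[THEN subspace_0])
  next
    case opspan_zero
    show ?case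
      by (intro exI[of _ "\<lambda>n. 0"] exI[of _ 0]) (simp add: assms(2)[THEN subspace_0])
  next
    case (opspan_add v w)
    then obtain u N u' N' where
      u: "\<forall>n. u n \<in> U" "\<forall>n\<ge>N. u n = 0" "v = (\<Sum>n<N. (x ^^ n) (u n))" and
      u': "\<forall>n. u' n \<in> U" "\<forall>n\<ge>N'. u' n = 0" "w = (\<Sum>n<N'. (x ^^ n) (u' n))"
      by blast
    have "v = (\<Sum>n<max N N'. (x ^^ n) (u n))"
      unfolding u(3) by (rule sum.mono_neutral_left) (use u(2) pow_zero in auto)
    moreover have "w = (\<Sum>n<max N N'. (x ^^ n) (u' n))"
      unfolding u'(3) by (rule sum.mono_neutral_left) (use u'(2) pow_zero in auto)
    ultimately show ?case
      using u u' by (intro exI[of _ "\<lambda>n. u n + u' n"] exI[of _ "max N N'"])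
        (simp add: pow_add sum.distrib assms(2)[THEN subspace_add])
  next
    case (opspan_scale v c)
    then obtain u N where
      u: "\<forall>n. u n \<in> U" "\<forall>n\<ge>N. u n = 0" "v = (\<Sum>n<N. (x ^^ n) (u n))"
      by blast
    then show ?case
      by (intro exI[of _ "\<lambda>n. scale c (u n)"] exI[of _ N])
         (simp add: pow_scale scale_sum_right assms(2)[THEN subspace_scale])
  next
    case (opspan_op f v)
    then obtain u N where f: "f = x" and
      u: "\<forall>n. u n \<in> U" "\<forall>n\<ge>N. u n = 0" "v = (\<Sum>n<N. (x ^^ n) (u n))"
      by blast
    have "x v = (\<Sum>n<Suc N. (x ^^ n) (case n of 0 \<Rightarrow> 0 | Suc m \<Rightarrow> u m))"
      unfolding u(3) x.sum sum.lessThan_Suc_shift by simp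
    then show ?case
      unfolding f
      by (intro exI[of _ "\<lambda>n. case n of 0 \<Rightarrow> 0 | Suc m \<Rightarrow> u m"] exI[of _ "Suc N"])
         (use u in \<open>auto simp: assms(2)[THEN subspace_0] split: nat.split\<close>)
  qed
  then show ?thesis using that by blast
qed

text \<open>
  On vectors killed by \<open>y\<close>, the operator \<open>y\<close> acts on powers of \<open>x\<close> as \<open>c z\<close> times the derivative
      with
  respect to \<open>x\<close>, because \<open>z\<close> commutes with \<open>x\<close>.
\<close>
lemma weyl_pair_power:
  assumes "Vector_Spaces.linear scale scale x" "Vector_Spaces.linear scale scale y" 
    and "Vector_Spaces.linear scale scale z"
    and yx: "\<And>v. y (x v) = x (y v) + scale c (z v)"
    and zx: "\<And>v. z (x v) = x (z v)"
    and U: "\<And>u. u \<in> U \<Longrightarrow> y u = 0" "\<And>u. u \<in> U \<Longrightarrow> z u \<in> U"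
    and u: "u \<in> U"
  shows "m > n \<Longrightarrow> (y ^^ m) ((x ^^ n) u) = 0"
    and "(y ^^ n) ((x ^^ n) u) = scale (fact n * c ^ n) ((z ^^ n) u)"
proof -
  interpret x: Vector_Spaces.linear scale scale x by fact
  interpret y: Vector_Spaces.linear scale scale y by fact
  interpret z: Vector_Spaces.linear scale scale z by fact
  have zpow: "z ((x ^^ n) v) = (x ^^ n) (z v)" for n v
    by (induction n) (simp_all add: zx)
  have step: "y ((x ^^ n) v) = scale (of_nat n * c) ((x ^^ (n - 1)) (z v))" if "v \<in> U" for n v
  proof (induction n)
    case (Suc n)
    show ?case
    proof (cases n)
      case (Suc k)
      have "y ((x ^^ Suc n) v) = x (y ((x ^^ n) v)) + scale c ((x ^^ n) (z v))"
        by (simp add: yx zpow)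
      also have "x (y ((x ^^ n) v)) = scale (of_nat n * c) ((x ^^ n) (z v))"
        unfolding Suc.IH by (simp add: Suc x.scale)
      finally show ?thesis
        by (simp add: distrib_right scale_left_distrib add.commute)
    qed (use that in \<open>simp add: yx U(1) x.zero\<close>)
  qed (simp add: U that)
  have ypow_scale: "(y ^^ n) (scale c v) = scale c ((y ^^ n) v)" for n v c
    by (induction n) (simp_all add: y.scale)
  show "(y ^^ n) ((x ^^ n) u) = scale (fact n * c ^ n) ((z ^^ n) u)"
    using u
  proof (induction n arbitrary: u)
    case (Suc n)
    show ?case
      unfolding funpow_Suc_right[of n y] funpow_Suc_right[of n z] o_apply step[OF Suc.prems]
        diff_Suc_1 ypow_scale Suc.IH[OF U(2)[OF Suc.prems]]
      by (simp add: mult_ac distrib_left)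
  qed auto
  have pow0: "(y ^^ n) 0 = 0" for n by (induction n) (simp_all add: y.zero)
  show "m > n \<Longrightarrow> (y ^^ m) ((x ^^ n) u) = 0"
    using u
  proof (induction n arbitrary: u m)
    case 0
    then show ?case by (cases m) (simp_all add: funpow_Suc_right U pow0 del: funpow.simps(2))
  next
    case (Suc n)
    then obtain k where k: "m = Suc k" by (cases m) auto
    show ?case
      unfolding k funpow_Suc_right[of k y] o_apply step[OF Suc.prems(2)] diff_Suc_1 ypow_scale
      using Suc.IH[of k "z u"] U(2)[OF Suc.prems(2)] Suc.prems by (simp add: k)
  qed
qed

text \<open>
  Applied to a polynomial in \<open>x\<close> of degree \<open>N\<close> with coefficients in \<open>U\<close>, the power \<open>y\<^sup>N\<close> isolates
      the
  leading coefficient, up to the injective operator \<open>z\<^sup>N\<close>. Since \<open>z\<close> acts coefficientwise, the same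
  computation applied to \<open>z w\<close> shows that \<open>z\<close> stays injective on the larger space.
\<close>
lemma weyl_pair_leading_term:
  assumes lin: "Vector_Spaces.linear scale scale x" "Vector_Spaces.linear scale scale y" 
    "Vector_Spaces.linear scale scale z"
    and c: "c \<noteq> 0"
    and yx: "\<And>v. y (x v) = x (y v) + scale c (z v)"
    and zx: "\<And>v. z (x v) = x (z v)"
    and U: "subspace U" "\<And>u. u \<in> U \<Longrightarrow> y u = 0" "\<And>u. u \<in> U \<Longrightarrow> z u \<in> U"
      "\<And>u. u \<in> U \<Longrightarrow> z u = 0 \<Longrightarrow> u = 0"
    and w: "w \<in> opspan {x} U" "w \<noteq> 0"
  shows "\<exists>N. (y ^^ N) w \<in> U \<and> (y ^^ N) w \<noteq> 0" "z w \<noteq> 0"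
proof -
  interpret x: Vector_Spaces.linear scale scale x by fact
  interpret y: Vector_Spaces.linear scale scale y by fact
  interpret z: Vector_Spaces.linear scale scale z by fact
  obtain N0 u where u: "\<And>n. u n \<in> U" "w = (\<Sum>n<N0. (x ^^ n) (u n))"
    using opspan_singleton_polynomial[OF lin(1) U(1) w(1)] by blast
  have pow_zero: "(x ^^ n) 0 = 0" for n
    by (induction n) (simp_all add: x.zero)
  have ypow_zero: "(y ^^ n) 0 = 0" for n
    by (induction n) (simp_all add: y.zero)
  have ypow_sum: "(y ^^ m) (sum f A) = (\<Sum>a\<in>A. (y ^^ m) (f a))" for m and f :: "nat \<Rightarrow> 'b" and A
    by (induction m) (simp_all add: y.sum)
  have zpow: "(z ^^ n) v \<in> U" "(z ^^ n) v \<noteq> 0" if "v \<in> U" "v \<noteq> 0" for n v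
  proof -
    have "(z ^^ n) v \<in> U \<and> (z ^^ n) v \<noteq> 0"
      using that by (induction n) (auto intro: U)
    then show "(z ^^ n) v \<in> U" "(z ^^ n) v \<noteq> 0" by auto
  qed
  let ?S = "{n. n < N0 \<and> u n \<noteq> 0}"
  have "?S \<noteq> {}"
    using w(2) pow_zero unfolding u(2) by (auto intro!: sum.neutral)
  moreover have fin: "finite ?S" by simp
  ultimately have N: "Max ?S \<in> ?S" by (rule Max_in[rotated])
  define N where "N = Max ?S"
  have uN: "u N \<noteq> 0" "N < N0" using N by (auto simp: N_def)
  have above: "u n = 0" if "n > N" "n < N0" for n
  proof (rule ccontr)
    assume "u n \<noteq> 0"
    with that have "n \<in> ?S" by simp
    from Max_ge[OF fin this] show False using that by (simp add: N_def)
  qed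
  have lead: "(y ^^ N) (\<Sum>n<N0. (x ^^ n) (v n)) = scale (fact N * c ^ N) ((z ^^ N) (v N))"
    if v: "\<And>n. v n \<in> U" "\<And>n. n > N \<Longrightarrow> n < N0 \<Longrightarrow> v n = 0" for v
  proof -
    have "(y ^^ N) (\<Sum>n<N0. (x ^^ n) (v n)) = (\<Sum>n\<in>{N}. (y ^^ N) ((x ^^ n) (v n)))"
      unfolding ypow_sum
    proof (rule sum.mono_neutral_right)
      show "\<forall>i\<in>{..<N0} - {N}. (y ^^ N) ((x ^^ i) (v i)) = 0"
      proof
        fix n assume n: "n \<in> {..<N0} - {N}"
        show "(y ^^ N) ((x ^^ n) (v n)) = 0"
        proof (cases "n < N")
          case True
          then show ?thesis
            by (intro weyl_pair_power(1)[where x = x and y = y and z = z and c = c and U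
                = U] lin yx zx U v)
        next
          case False
          with n have "v n = 0" by (intro v(2)) auto
          then show ?thesis by (simp add: pow_zero ypow_zero)
        qed
      qed
    qed (use uN in auto)
    also have "\<dots> = scale (fact N * c ^ N) ((z ^^ N) (v N))"
      using weyl_pair_power(2)[where x = x and y = y and z = z and c = c and U
          = U, OF lin yx zx U(2,3) v(1)]
      by simp
    finally show ?thesis .
  qed
  have "(y ^^ N) w = scale (fact N * c ^ N) ((z ^^ N) (u N))"
    unfolding u(2) by (rule lead) (use u above in auto)
  then show "\<exists>N. (y ^^ N) w \<in> U \<and> (y ^^ N) w \<noteq> 0"
    using zpow[OF u(1) uN(1)] c U(1) by (auto intro!: exI[of _ N] simp: subspace_scale)
  show "z w \<noteq> 0"
  proof
    assume 0: "z w = 0"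
    have zx': "z ((x ^^ n) v) = (x ^^ n) (z v)" for n v
      by (induction n) (simp_all add: zx)
    have "0 = (y ^^ N) (z w)" by (simp add: 0 ypow_zero)
    also have "\<dots> = (y ^^ N) (\<Sum>n<N0. (x ^^ n) (z (u n)))"
      by (simp add: u(2) z.sum zx')
    also have "\<dots> = scale (fact N * c ^ N) ((z ^^ N) (z (u N)))"
      by (rule lead) (simp_all add: above U(3) u(1) z.zero)
    finally show False
      using zpow(2)[of "z (u N)" N] U(3,4)[OF u(1)] uN(1) c by auto
  qed
qed

text \<open>
  A vector of the \<open>k\<close>th level is lowered level
      by level. Injectivity of \<open>z\<close> is part of the induction:
  it is what keeps the leading coefficient alive at the next level.
\<close>
lemma weyl_pair_tower:
  assumes lin: "\<And>k::nat. Vector_Spaces.linear scale scale (x k)"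
      "\<And>k. Vector_Spaces.linear scale scale (y k)" "Vector_Spaces.linear scale scale z"
    and c: "\<And>k. c k \<noteq> 0"
    and yx: "\<And>k v. y k (x k v) = x k (y k v) + scale (c k) (z v)"
    and zx: "\<And>k v. z (x k v) = x k (z v)"
    and sub: "\<And>k. subspace (U k)"
    and step: "\<And>k. U (Suc k) \<subseteq> opspan {x k} (U k)"
    and yU: "\<And>k u. u \<in> U k \<Longrightarrow> y k u = 0"
    and zU: "\<And>k u. u \<in> U k \<Longrightarrow> z u \<in> U k"
    and inj: "\<And>u. u \<in> U 0 \<Longrightarrow> z u = 0 \<Longrightarrow> u = 0"
  shows "u \<in> U k \<Longrightarrow> z u = 0 \<Longrightarrow> u = 0"
    and "\<lbrakk>\<And>k w. w \<in> W \<Longrightarrow> y k w \<in> W; w \<in> W; w \<in> U k; w \<noteq> 0\<rbrakk> \<Longrightarrow> \<exists>w\<in>W. w \<in> U 0 \<and> w \<noteq> 0"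
proof -
  note leading = weyl_pair_leading_term[where x = "x k" and y = "y k" and z = z and c = "c k" for k]
  show inj': "u \<in> U k \<Longrightarrow> z u = 0 \<Longrightarrow> u = 0" for u k
  proof (induction k arbitrary: u)
    case (Suc k)
    show ?case
    proof (rule ccontr)
      assume "u \<noteq> 0"
      have "u \<in> opspan {x k} (U k)" using Suc.prems(1) step by blast
      then have "z u \<noteq> 0"
        by (rule leading(2)[where U = "U k", rotated -2])
           (rule lin c yx zx sub \<open>u \<noteq> 0\<close> | erule yU zU | erule (1) Suc.IH)+
      then show False using Suc.prems(2) by simp
    qed
  qed (rule inj)
  show "\<exists>w\<in>W. w \<in> U 0 \<and> w \<noteq> 0"
    if W: "\<And>k w. w \<in> W \<Longrightarrow> y k w \<in> W" and "w \<in> W" "w \<in> U k" "w \<noteq> 0"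
    using that(2-)
  proof (induction k arbitrary: w)
    case (Suc k)
    have "w \<in> opspan {x k} (U k)" using Suc.prems step by blast
    then have "\<exists>N. (y k ^^ N) w \<in> U k \<and> (y k ^^ N) w \<noteq> 0"
      by (rule leading(1)[where U = "U k", rotated -2])
         (rule lin c yx zx sub Suc.prems | erule yU zU | erule (1) inj')+
    then obtain N where N: "(y k ^^ N) w \<in> U k" "(y k ^^ N) w \<noteq> 0" by blast
    have "(y k ^^ n) w \<in> W" for n by (induction n) (simp_all add: W Suc.prems(1))
    from Suc.IH[OF this N] show ?case .
  qed auto
qed

end

section \<open>Stripping off the generators M and Y\<close>

text \<open>
  A given vector is reached with finitely many operators, which all lie in one member of the chain.
\<close>
lemma (in complex_space) opspan_directed:
  assumes "v \<in> opspan F J" "F \<subseteq> (\<Union>k::nat. G k)" "incseq G"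
  shows "\<exists>k. v \<in> opspan (G k) J"
  using assms(1)
proof induction
  case (opspan_add v w)
  then obtain k l where "v \<in> opspan (G k) J" "w \<in> opspan (G l) J" by blast
  moreover have "G k \<subseteq> G (max k l)" "G l \<subseteq> G (max k l)"
    using assms(3) by (auto simp: incseq_def)
  ultimately have "v \<in> opspan (G (max k l)) J" "w \<in> opspan (G (max k l)) J"
    using opspan_mono by blast+
  then show ?case by (blast intro: opspan.opspan_add)
next
  case (opspan_op f v)
  then obtain k l where "v \<in> opspan (G k) J" "f \<in> G l" using assms(2) by blast
  moreover have "G k \<subseteq> G (max k l)" "G l \<subseteq> G (max k l)"
    using assms(3) by (auto simp: incseq_def)
  ultimately have "v \<in> opspan (G (max k l)) J" "f \<in> G (max k l)"
    using opspan_mono by blast+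
  then show ?case by (blast intro: opspan.opspan_op)
qed (blast intro: opspan.intros)+

text \<open>
  Modules that fill a whole type. Without carriers the commutator computations are purely
      equational;
  the module of interest is brought into this form by choosing coordinates (locale \<open>coordinates\<close>).
\<close>
locale sv_rep = complex_space scale
  for scale :: "complex \<Rightarrow> 'b \<Rightarrow> 'b :: ab_group_add" (infixr "*s" 75) +
  fixes R :: "sv \<Rightarrow> 'b \<Rightarrow> 'b"
  assumes R_add_left: "R (x + y) v = R x v + R y v"
    and R_scale_left: "R (sv_scale c x) v = c *s R x v"
    and R_add: "R x (v + w) = R x v + R x w"
    and R_scale: "R x (c *s v) = c *s R x v"
    and R_bracket: "R (sv_bracket x y) v = R x (R y v) - R y (R x v)"
begin

abbreviation "M i \<equiv> R (sv_M i)"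
abbreviation "Y i \<equiv> R (sv_Y i)"
abbreviation "L i \<equiv> R (sv_L i)"
abbreviation "C \<equiv> R sv_C"

lemma R_linear: "Vector_Spaces.linear scale scale (R x)"
  by (intro Vector_Spaces.linear_iff[THEN iffD2] conjI allI vector_space_axioms R_add R_scale)

lemma R_zero [simp]: "R x 0 = 0" "R 0 v = 0"
  using R_scale[of x 0 0] R_scale_left[of 0 0 v] by (simp_all add: sv_scale_simps)

lemma R_minus: "R x (- v) = - R x v" "R (- x) v = - R x v"
  using R_scale[of x "-1" v] R_scale_left[of "-1" x v] by (simp_all add: sv_scale_simps)

lemma R_diff: "R x (v - w) = R x v - R x w"
  using R_add[of x v "- w"] by (simp add: R_minus)

lemma R_sum: "R x (sum f A) = (\<Sum>a\<in>A. R x (f a))"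
  by (induction A rule: infinite_finite_induct) (simp_all add: R_add)

lemma R_commute: "R x (R y v) = R y (R x v) + R (sv_bracket x y) v"
  by (simp add: R_bracket)

lemmas R_lin = R_add_left R_scale_left R_add R_scale R_minus R_diff sv_bracket_gens

lemma commute:
  "M i (M j v) = M j (M i v)"
  "M i (Y j v) = Y j (M i v)"
  "Y i (M j v) = M j (Y i v)"
  "Y i (Y j v) = Y j (Y i v) + of_int (j - i) *s M (i + j + 1) v"
  "L i (M j v) = M j (L i v) + of_int j *s M (i + j) v"
  "M j (L i v) = L i (M j v) - of_int j *s M (i + j) v"
  "L i (Y j v) = Y j (L i v) + (of_int j + of_int (1 - i) / 2) *s Y (i + j) v"
  "Y j (L i v) = L i (Y j v) - (of_int j + of_int (1 - i) / 2) *s Y (i + j) v"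
  "L i (L j v) = L j (L i v) + of_int (j - i) *s L (i + j) v
     + (if i + j = 0 then (of_int (i ^ 3 - i) / 12) *s C v else 0)"
  "C (R x v) = R x (C v)"
  by (subst R_commute, simp add: R_lin)+

lemma R_closed:
  assumes "subspace U" "\<And>i. M i v \<in> U" "\<And>i. Y i v \<in> U" "\<And>i. L i v \<in> U" "C v \<in> U"
  shows "R x v \<in> U"
proof (rule sv_span_induct[of x UNIV])
  show "R (Poly_Mapping.single i 1) v \<in> U" for i
    by (rule sv_single_cases[of i]) (simp_all add: assms)
qed (use assms(1) in \<open>simp_all add: R_lin subspace_0 subspace_add subspace_scale\<close>)

end

text \<open>
  \<open>J\<close> stands for the image of \<open>1 \<otimes> V\<close>, which is stable under the subalgebra but not under the
      whole algebra.
\<close>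
locale sv_lowering = sv_rep scale R
  for scale :: "complex \<Rightarrow> 'b \<Rightarrow> 'b :: ab_group_add" (infixr "*s" 75) and R :: "sv \<Rightarrow> 'b \<Rightarrow> 'b" +
  fixes J :: "'b set" and d1 d2 t :: nat
  assumes J: "subspace J"
    and J_M: "i \<ge> - int d1 \<Longrightarrow> v \<in> J \<Longrightarrow> M i v \<in> J"
    and J_Y: "i \<ge> - int d2 \<Longrightarrow> v \<in> J \<Longrightarrow> Y i v \<in> J"
    and J_L: "i \<ge> 0 \<Longrightarrow> v \<in> J \<Longrightarrow> L i v \<in> J"
    and J_C: "v \<in> J \<Longrightarrow> C v \<in> J"
    and kill_M: "i > int t \<Longrightarrow> v \<in> J \<Longrightarrow> M i v = 0"
    and kill_Y: "i \<ge> int t + int d2 \<Longrightarrow> v \<in> J \<Longrightarrow> Y i v = 0"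
    and kill_L: "i > int t + int d1 \<Longrightarrow> v \<in> J \<Longrightarrow> L i v = 0"
    and inj_J: "v \<in> J \<Longrightarrow> M (int t) v = 0 \<Longrightarrow> v = 0"
begin

text \<open>
  \<open>UM\<close> and \<open>UY\<close> are generated from \<open>J\<close> by all \<open>M\<close>, respectively
      by all \<open>M\<close> and \<open>Y\<close>. The level \<open>k\<close> of either
  tower adjoins the first \<open>k\<close> generators below the subalgebra, so that level \<open>0\<close> gives nothing new.
\<close>
definition "UM_upto k = opspan {M i | i. i \<ge> - int d1 - int k} J"
definition "UM = opspan (range (\<lambda>i. M i)) J"
definition "UY_upto k = opspan (range (\<lambda>i. M i) \<union> {Y i | i. i \<ge> - int d2 - int k}) J"
definition "UY = opspan (range (\<lambda>i. M i) \<union> range (\<lambda>i. Y i)) J"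

lemma UM_upto_subset: "UM_upto k \<subseteq> UM"
  unfolding UM_upto_def UM_def by (rule opspan_mono) auto

lemma UM_kill_M: "v \<in> UM \<Longrightarrow> i > int t \<Longrightarrow> M i v = 0"
  unfolding UM_def
proof (induction rule: opspan.induct)
  case (opspan_op f v)
  then show ?case by (auto simp: commute(1)[of i])
qed (simp_all add: kill_M R_lin)

text \<open>
  Moving \<open>L\<^sub>i\<close> to the right past \<open>M\<^sub>j\<close> with \<open>j \<ge> -d1-k\<close> produces a multiple of \<open>M\<^bsub>i+j\<^esub>\<close>,
      and \<open>i + j > t\<close>.
\<close>
lemma UM_upto_kill_L: "v \<in> UM_upto k \<Longrightarrow> i > int t + int d1 + int k \<Longrightarrow> L i v = 0"
  unfolding UM_upto_def
proof (induction rule: opspan.induct)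
  case (opspan_op f v)
  then obtain j where j: "f = M j" "j \<ge> - int d1 - int k" by auto
  have "v \<in> UM" using opspan_op UM_upto_subset unfolding UM_upto_def by blast
  then show ?case using opspan_op j by (simp add: commute(5) UM_kill_M)
qed (simp_all add: kill_L R_lin)

lemma UM_upto_M: "i \<ge> - int d1 - int k \<Longrightarrow> v \<in> UM_upto k \<Longrightarrow> M i v \<in> UM_upto k"
  unfolding UM_upto_def by (rule opspan_op) auto

lemma UM_M: "v \<in> UM \<Longrightarrow> M i v \<in> UM"
  unfolding UM_def by (rule opspan_op) auto

lemma UM_upto_step: "UM_upto (Suc k) \<subseteq> opspan {M (- int d1 - int k - 1)} (UM_upto k)" (is "_ \<subseteq> ?U")
  unfolding UM_upto_def[of "Suc k"]
proof (rule opspan_least)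
  show "J \<subseteq> ?U" unfolding UM_upto_def by (blast intro: opspan_base)
  show "subspace ?U" by (rule opspan_subspace)
  have X: "M (- int d1 - int k - 1) u \<in> ?U" if "u \<in> ?U" for u
    using that by (rule opspan_op[rotated]) simp
  fix f u assume f: "f \<in> {M i |i. - int d1 - int (Suc k) \<le> i}" and u: "u \<in> ?U"
  then obtain i where i: "f = M i" "i \<ge> - int d1 - int (Suc k)" by blast
  show "f u \<in> ?U"
  proof (cases "i = - int d1 - int k - 1")
    case True
    then show ?thesis using X u i by simp
  next
    case False
    then have M: "M i v \<in> UM_upto k" if "v \<in> UM_upto k" for v
      using that i by (intro UM_upto_M) auto
    show ?thesis
      using u unfolding i(1)
    proof (induction rule: opspan.induct)
      case (opspan_op g v)
      then show ?case using X by (auto simp: commute(1)[of i])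
    qed (auto simp: R_lin intro: opspan.opspan_base opspan.opspan_zero opspan.opspan_add
        opspan.opspan_scale M)
  qed
qed

lemma UM_upto_0: "UM_upto 0 \<subseteq> J"
  unfolding UM_upto_def by (rule opspan_least) (auto simp: J J_M)

lemma UM_upto_cover: "v \<in> UM \<Longrightarrow> \<exists>k. v \<in> UM_upto k"
  unfolding UM_def UM_upto_def
proof (rule opspan_directed)
  show "range (\<lambda>i. M i) \<subseteq> (\<Union>k. {M i |i. - int d1 - int k \<le> i})"
  proof safe
    fix i have "- int d1 - int (nat (- i)) \<le> i" by simp
    then show "M i \<in> (\<Union>k. {M i |i. - int d1 - int k \<le> i})" by blast
  qed
  show "incseq (\<lambda>k. {M i |i. - int d1 - int k \<le> i})"
    by (auto simp: incseq_def)
qed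

text \<open>
  The generator adjoined in step \<open>k\<close> is \<open>M(-d1-k-1)\<close>
      and its partner is \<open>L(t+d1+k+1)\<close>; all \<open>M\<close> commute.
\<close>
lemma M_tower:
  shows "u \<in> UM_upto k \<Longrightarrow> M (int t) u = 0 \<Longrightarrow> u = 0"
    and "\<lbrakk>\<And>x w. w \<in> W \<Longrightarrow> R x w \<in> W; w \<in> W; w \<in> UM_upto k; w \<noteq> 0\<rbrakk>
      \<Longrightarrow> \<exists>w\<in>W. w \<in> UM_upto 0 \<and> w \<noteq> 0"
proof -
  note tower = weyl_pair_tower[where x = "\<lambda>k. M (- int d1 - int k - 1)"
      and y = "\<lambda>k. L (int t + int d1 + int k + 1)" and z = "M (int t)"
      and c = "\<lambda>k. of_int (- int d1 - int k - 1)" and U = UM_upto]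
  have c: "complex_of_int (- int d1 - int k - 1) \<noteq> 0" for k
    unfolding of_int_eq_0_iff by simp
  have yx: "L (int t + int d1 + int k + 1) (M (- int d1 - int k - 1) v)
     = M (- int d1 - int k - 1) (L (int t + int d1 + int k + 1) v)
      + of_int (- int d1 - int k - 1) *s M (int t) v" for k v
    by (subst commute(5)) simp
  have zU: "M (int t) u \<in> UM_upto k" if "u \<in> UM_upto k" for u k
    using that by (intro UM_upto_M) auto
  have yU: "L (int t + int d1 + int k + 1) u = 0" if "u \<in> UM_upto k" for u k
    using that by (rule UM_upto_kill_L) simp
  have inj: "u = 0" if "u \<in> UM_upto 0" "M (int t) u = 0" for u
    using that UM_upto_0 inj_J by blast
  have sub: "subspace (UM_upto k)" for k
    unfolding UM_upto_def by (rule opspan_subspace)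
  show "u \<in> UM_upto k \<Longrightarrow> M (int t) u = 0 \<Longrightarrow> u = 0"
    by (rule tower(1)) (rule R_linear c yx commute(1) sub UM_upto_step | erule yU zU | erule (1)
        inj | assumption)+
  show "\<lbrakk>\<And>x w. w \<in> W \<Longrightarrow> R x w \<in> W; w \<in> W; w \<in> UM_upto k; w \<noteq> 0\<rbrakk>
      \<Longrightarrow> \<exists>w\<in>W. w \<in> UM_upto 0 \<and> w \<noteq> 0"
    by (rule tower(2)) (rule R_linear c yx commute(1) sub UM_upto_step | erule yU zU | erule (1)
        inj | assumption | blast)+
qed

lemma UM_Y: "v \<in> UM \<Longrightarrow> i \<ge> - int d2 \<Longrightarrow> Y i v \<in> UM"
proof -
  assume "v \<in> UM" "i \<ge> - int d2"
  then show ?thesis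
    unfolding UM_def
  proof (induction rule: opspan.induct)
    case (opspan_op f v)
    then show ?case using UM_M[unfolded UM_def] by (auto simp: commute(3))
  next
    case (opspan_base v)
    then show ?case using J_Y by (blast intro: opspan.opspan_base)
  qed (auto simp: R_lin intro: opspan.opspan_zero opspan.opspan_add opspan.opspan_scale)
qed

lemma UM_inj: "v \<in> UM \<Longrightarrow> M (int t) v = 0 \<Longrightarrow> v = 0"
  using UM_upto_cover M_tower(1) by blast

lemma UY_upto_subset: "UY_upto k \<subseteq> UY"
  unfolding UY_upto_def UY_def by (rule opspan_mono) auto

lemma UY_M: "v \<in> UY \<Longrightarrow> M i v \<in> UY"
  unfolding UY_def by (rule opspan_op) auto

lemma UY_Y: "v \<in> UY \<Longrightarrow> Y i v \<in> UY"
  unfolding UY_def by (rule opspan_op) auto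

lemma UY_subspace: "subspace UY"
  unfolding UY_def by (rule opspan_subspace)

lemma UY_kill_M: "v \<in> UY \<Longrightarrow> i > int t \<Longrightarrow> M i v = 0"
  unfolding UY_def
proof (induction rule: opspan.induct)
  case (opspan_op f v)
  then show ?case by (auto simp: commute(1,2)[of i])
qed (simp_all add: kill_M R_lin)

lemma UY_L: "v \<in> UY \<Longrightarrow> i \<ge> 0 \<Longrightarrow> L i v \<in> UY"
  unfolding UY_def
proof (induction rule: opspan.induct)
  case (opspan_op f v)
  have "M j w \<in> UY" "Y j w \<in> UY" if "w \<in> UY" for j w
    by (rule that UY_M UY_Y)+
  with opspan_op show ?case
    unfolding UY_def[symmetric]
    by (auto simp: commute(5,7) intro!: UY_subspace[THEN subspace_add]
        UY_subspace[THEN subspace_scale])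
next
  case (opspan_base v)
  then show ?case using J_L by (blast intro: opspan.opspan_base)
qed (auto simp: R_lin intro: opspan.opspan_zero opspan.opspan_add opspan.opspan_scale)

lemma UY_C: "v \<in> UY \<Longrightarrow> C v \<in> UY"
  unfolding UY_def
proof (induction rule: opspan.induct)
  case (opspan_op f v)
  then show ?case using UY_M[unfolded UY_def] UY_Y[unfolded UY_def] by (auto simp: commute(10))
next
  case (opspan_base v)
  then show ?case using J_C by (blast intro: opspan.opspan_base)
qed (auto simp: R_lin intro: opspan.opspan_zero opspan.opspan_add opspan.opspan_scale)

lemma UY_upto_kill_Y: "v \<in> UY_upto k \<Longrightarrow> i \<ge> int t + int d2 + int k \<Longrightarrow> Y i v = 0"
  unfolding UY_upto_def
proof (induction rule: opspan.induct)
  case (opspan_op f v)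
  have "v \<in> UY" using opspan_op UY_upto_subset unfolding UY_upto_def by blast
  then show ?case using opspan_op by (auto simp: commute(3) commute(4)[of i] UY_kill_M)
qed (simp_all add: kill_Y R_lin)

lemma UY_upto_M: "v \<in> UY_upto k \<Longrightarrow> M i v \<in> UY_upto k"
  unfolding UY_upto_def by (rule opspan_op) auto

lemma UY_upto_Y: "i \<ge> - int d2 - int k \<Longrightarrow> v \<in> UY_upto k \<Longrightarrow> Y i v \<in> UY_upto k"
  unfolding UY_upto_def by (rule opspan_op) auto

lemma UY_upto_step: "UY_upto (Suc k) \<subseteq> opspan {Y (- int d2 - int k - 1)} (UY_upto k)" (is "_ \<subseteq> ?U")
  unfolding UY_upto_def[of "Suc k"]
proof (rule opspan_least)
  show "J \<subseteq> ?U" unfolding UY_upto_def by (blast intro: opspan_base)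
  show "subspace ?U" by (rule opspan_subspace)
  have X: "Y (- int d2 - int k - 1) u \<in> ?U" if "u \<in> ?U" for u
    using that by (rule opspan_op[rotated]) simp
  have M: "M i u \<in> ?U" if "u \<in> ?U" for i u
    using that
  proof (induction rule: opspan.induct)
    case (opspan_op g v)
    then show ?case using X by (auto simp: commute(2))
  qed (auto simp: R_lin intro: opspan.opspan_base opspan.opspan_zero opspan.opspan_add
      opspan.opspan_scale UY_upto_M)
  fix f u assume f: "f \<in> range (\<lambda>i. M i) \<union> {Y i |i. - int d2 - int (Suc k) \<le> i}" and u: "u \<in> ?U"
  then consider i where "f = M i" | i where "f = Y i" "i \<ge> - int d2 - int (Suc k)" by blast
  then show "f u \<in> ?U"
  proof cases
    case 1
    then show ?thesis using M u by simp
  next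
    case i: 2
    show ?thesis
    proof (cases "i = - int d2 - int k - 1")
      case True
      then show ?thesis using X u i by simp
    next
      case False
      then have Y: "Y i v \<in> UY_upto k" if "v \<in> UY_upto k" for v
        using that i by (intro UY_upto_Y) auto
      show ?thesis
        using u unfolding i(1)
      proof (induction rule: opspan.induct)
        case (opspan_op g v)
        then show ?case using X by (auto simp: commute(4)[of i] intro!: opspan_add opspan_scale M)
      qed (auto simp: R_lin intro: opspan.opspan_base opspan.opspan_zero opspan.opspan_add
          opspan.opspan_scale Y)
    qed
  qed
qed

lemma UY_upto_0: "UY_upto 0 \<subseteq> UM"
  unfolding UY_upto_def
proof (rule opspan_least)
  show "f u \<in> UM" if "f \<in> range (\<lambda>i. M i) \<union> {Y i |i. - int d2 - int 0 \<le> i}" "u \<in> UM" for f u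
    using that UM_Y UM_M by auto
qed (auto simp: UM_def intro: opspan_base opspan_subspace)

lemma UY_upto_cover: "v \<in> UY \<Longrightarrow> \<exists>k. v \<in> UY_upto k"
  unfolding UY_def UY_upto_def
proof (rule opspan_directed)
  show "range (\<lambda>i. M i) \<union> range (\<lambda>i. Y i)
    \<subseteq> (\<Union>k. range (\<lambda>i. M i) \<union> {Y i |i. - int d2 - int k \<le> i})"
  proof (intro Un_least subsetI)
    fix f assume "f \<in> range (\<lambda>i. Y i)"
    then obtain i where i: "f = Y i" by blast
    have "- int d2 - int (nat (- i)) \<le> i" by simp
    then show "f \<in> (\<Union>k. range (\<lambda>i. M i) \<union> {Y i |i. - int d2 - int k \<le> i})" unfolding i by blast
  qed auto
  show "incseq (\<lambda>k. range (\<lambda>i. M i) \<union> {Y i |i. - int d2 - int k \<le> i})"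
    by (auto simp: incseq_def)
qed

text \<open>
  The generator adjoined in step \<open>k\<close> is \<open>Y(-d2-k-1)\<close>
      and its partner is \<open>Y(t+d2+k)\<close>. Brackets of two \<open>Y\<close>
  are multiples of some \<open>M\<close>, which all levels of this tower contain from the start.
\<close>
lemma Y_tower:
  shows "u \<in> UY_upto k \<Longrightarrow> M (int t) u = 0 \<Longrightarrow> u = 0"
    and "\<lbrakk>\<And>x w. w \<in> W \<Longrightarrow> R x w \<in> W; w \<in> W; w \<in> UY_upto k; w \<noteq> 0\<rbrakk>
      \<Longrightarrow> \<exists>w\<in>W. w \<in> UY_upto 0 \<and> w \<noteq> 0"
proof -
  note tower = weyl_pair_tower[where x = "\<lambda>k. Y (- int d2 - int k - 1)"
      and y = "\<lambda>k. Y (int t + int d2 + int k)" and z = "M (int t)"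
      and c = "\<lambda>k. of_int (- int t - 2 * int d2 - 2 * int k - 1)" and U = UY_upto]
  have c: "complex_of_int (- int t - 2 * int d2 - 2 * int k - 1) \<noteq> 0" for k
    unfolding of_int_eq_0_iff by simp
  have yx: "Y (int t + int d2 + int k) (Y (- int d2 - int k - 1) v)
     = Y (- int d2 - int k - 1) (Y (int t + int d2 + int k) v)
      + of_int (- int t - 2 * int d2 - 2 * int k - 1) *s M (int t) v" for k v
    by (subst commute(4)) (simp add: algebra_simps)
  have yU: "Y (int t + int d2 + int k) u = 0" if "u \<in> UY_upto k" for u k
    using that by (rule UY_upto_kill_Y) simp
  have inj: "u = 0" if "u \<in> UY_upto 0" "M (int t) u = 0" for u
    using that UY_upto_0 UM_inj by blast
  have sub: "subspace (UY_upto k)" for k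
    unfolding UY_upto_def by (rule opspan_subspace)
  show "u \<in> UY_upto k \<Longrightarrow> M (int t) u = 0 \<Longrightarrow> u = 0"
    by (rule tower(1)) (rule R_linear c yx commute(2) sub UY_upto_step | erule yU UY_upto_M |
        erule (1) inj | assumption)+
  show "\<lbrakk>\<And>x w. w \<in> W \<Longrightarrow> R x w \<in> W; w \<in> W; w \<in> UY_upto k; w \<noteq> 0\<rbrakk>
      \<Longrightarrow> \<exists>w\<in>W. w \<in> UY_upto 0 \<and> w \<noteq> 0"
    by (rule tower(2)) (rule R_linear c yx commute(2) sub UY_upto_step | erule yU UY_upto_M |
        erule (1) inj | assumption | blast)+
qed

lemma UY_inj: "v \<in> UY \<Longrightarrow> M (int t) v = 0 \<Longrightarrow> v = 0"
  using UY_upto_cover Y_tower(1) by blast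

lemma UY_descend:
  assumes W: "\<And>x w. w \<in> W \<Longrightarrow> R x w \<in> W" and w: "w \<in> W" "w \<in> UY" "w \<noteq> 0"
  shows "\<exists>w\<in>W. w \<in> J \<and> w \<noteq> 0"
proof -
  obtain k where "w \<in> UY_upto k" using UY_upto_cover w by blast
  from Y_tower(2)[OF W w(1) this w(3)] obtain w1 where w1: "w1 \<in> W" "w1 \<in> UM" "w1 \<noteq> 0"
    using UY_upto_0 by blast
  obtain k where "w1 \<in> UM_upto k" using UM_upto_cover w1 by blast
  from M_tower(2)[OF W w1(1) this w1(3)] show ?thesis using UM_upto_0 by blast
qed

section \<open>Stripping off the generators L\<close>

text \<open>
  \<open>lev r\<close> is the space of combinations of words \<open>L(-l\<^sub>1) ... L(-l\<^sub>s) u\<close> with \<open>s < r\<close>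
      and \<open>u \<in> UY\<close>. Since
  \<open>[L(-1), L(-2)]\<close> is a nonzero multiple of \<open>L(-3)\<close>, the \<open>L(-l)\<close> cannot be adjoined one at a time
      through
  subalgebras; the length of the word is the filtration that survives. With the strict inequality
  \<open>lev 0\<close> is the zero space, so words of length \<open>0\<close> need no separate treatment.
\<close>
inductive lev :: "nat \<Rightarrow> 'b \<Rightarrow> bool" where
  lev_zero: "lev r 0"
| lev_base: "u \<in> UY \<Longrightarrow> lev (Suc r) u"
| lev_op: "lev r v \<Longrightarrow> l > 0 \<Longrightarrow> lev (Suc r) (L (- int l) v)"
| lev_add: "lev r v \<Longrightarrow> lev r w \<Longrightarrow> lev r (v + w)"
| lev_scale: "lev r v \<Longrightarrow> lev r (c *s v)"

lemma lev_subspace: "subspace {v. lev r v}"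
  by (rule subspaceI) (auto intro: lev.intros)

lemma lev_diff: "lev r v \<Longrightarrow> lev r w \<Longrightarrow> lev r (v - w)"
  using subspace_diff[OF lev_subspace] by simp

lemma lev_Suc: "lev r v \<Longrightarrow> lev (Suc r) v"
  by (induction rule: lev.induct) (auto intro: lev.intros)

lemma lev_0: "lev 0 v \<Longrightarrow> v = 0"
  by (induction "0::nat" v rule: lev.induct) auto

lemma lev_op_pred: "lev (r - 1) v \<Longrightarrow> l > 0 \<Longrightarrow> lev r (L (- int l) v)"
  by (cases r) (auto dest!: lev_0 intro: lev.intros)

lemma lev_M: "lev r v \<Longrightarrow> lev r (M i v)"
proof (induction arbitrary: i rule: lev.induct)
  case (lev_op r v l)
  show ?case
    by (subst commute(6)) (intro lev_diff lev.lev_op[OF lev_op.IH lev_op.hyps(2)]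
        lev_Suc[OF lev_scale[OF lev_op.IH]])
qed (auto simp: R_lin intro: lev.intros UY_M)

text \<open>
  \<open>M\<^sub>i\<close> kills \<open>UY\<close>, so it contributes only through brackets with the letters \<open>L(-l)\<close>; each bracket
  consumes a letter and leaves some \<open>M\<close>, which preserves the filtration.
\<close>
lemma lev_lower: "lev r v \<Longrightarrow> i > int t \<Longrightarrow> lev (r - 1) (M i v)"
proof (induction rule: lev.induct)
  case (lev_op r v l)
  have "lev (Suc r - 1) (L (- int l) (M i v))"
    using lev_op_pred[OF lev_op.IH lev_op.hyps(2)] lev_op.prems by simp
  moreover have "lev (Suc r - 1) (of_int i *s M (i + - int l) v)"
    using lev_M[OF lev_op.hyps(1)] by (intro lev_scale) (simp add: add.commute)
  ultimately show ?case
    by (subst commute(6)) (simp add: lev_diff add.commute)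
qed (auto simp: R_lin UY_kill_M intro: lev.intros)

lemma lev_Y: "lev r v \<Longrightarrow> lev r (Y i v)"
proof (induction arbitrary: i rule: lev.induct)
  case (lev_op r v l)
  show ?case
    by (subst commute(8)) (intro lev_diff lev.lev_op[OF lev_op.IH lev_op.hyps(2)]
        lev_Suc[OF lev_scale[OF lev_op.IH]])
qed (auto simp: R_lin intro: lev.intros UY_Y)

lemma lev_C: "lev r v \<Longrightarrow> lev r (C v)"
proof (induction rule: lev.induct)
  case (lev_op r v l)
  then show ?case by (auto simp: commute(10)[of "sv_L i" for i] intro!: lev.lev_op)
qed (auto simp: R_lin intro: lev.intros UY_C)

lemma lev_L_nonneg: "lev r v \<Longrightarrow> i \<ge> 0 \<Longrightarrow> lev r (L i v)"
proof (induction arbitrary: i rule: lev.induct)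
  case (lev_op r v l)
  have "lev (Suc r) (L (i - int l) v)"
  proof (cases "i \<ge> int l")
    case True
    then show ?thesis using lev_op.IH[of "i - int l"] by (auto intro: lev_Suc)
  next
    case False
    then show ?thesis
      using lev.lev_op[OF lev_op.hyps(1), of "nat (int l - i)"] by simp
  qed
  then have "lev (Suc r) (of_int (- int l - i) *s L (i + - int l) v)"
    by (auto intro: lev_scale)
  moreover have "lev (Suc r) (L (- int l) (L i v))"
    using lev_op by (intro lev.lev_op) auto
  moreover have "lev (Suc r) (if i + - int l = 0 then (of_int (i ^ 3 - i) / 12) *s C v else 0)"
    using lev_op.hyps(1) by (auto intro: lev_scale lev_Suc lev_C lev_zero)
  ultimately show ?case
    by (subst commute(9)) (intro lev_add)
qed (auto simp: R_lin intro: lev.intros UY_L)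

lemma lev_L: "lev r v \<Longrightarrow> lev (Suc r) (L i v)"
  using lev_L_nonneg[of r v i] lev_op[of r v "nat (- i)"] by (cases "i \<ge> 0") (auto intro: lev_Suc)

lemma opspan_lev: "v \<in> opspan (range R) J \<Longrightarrow> \<exists>r. lev r v"
proof (induction rule: opspan.induct)
  case (opspan_base v)
  then show ?case by (auto simp: UY_def intro!: exI[of _ 1] lev_base opspan.opspan_base)
next
  case opspan_zero
  show ?case by (blast intro: lev_zero)
next
  case (opspan_add v w)
  have mono: "lev r u \<Longrightarrow> lev (r + k) u" for r k u
    by (induction k) (auto intro: lev_Suc)
  from opspan_add obtain r s where "lev r v" "lev s w" by blast
  then have "lev (r + s) v" "lev (r + s) w" using mono[of r v s] mono[of s w r]
      by (simp_all add: add.commute)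
  then show ?case by (blast intro: lev_add)
next
  case (opspan_scale v c)
  then show ?case by (blast intro: lev_scale)
next
  case (opspan_op f v)
  then obtain x r where "f = R x" "lev r v" by blast
  moreover have "R x v \<in> {v. lev (Suc r) v}"
    using \<open>lev r v\<close> by - (rule R_closed[OF lev_subspace], simp_all add: lev_L lev_Suc lev_M lev_Y
        lev_C)
  ultimately show ?case by auto
qed

definition Lword :: "nat list \<Rightarrow> 'b \<Rightarrow> 'b"
  where "Lword ls v = foldr (\<lambda>l. L (- int l)) ls v"

definition Mword :: "nat list \<Rightarrow> 'b \<Rightarrow> 'b"
  where "Mword ks v = fold (\<lambda>k. M (int t + int k)) ks v"

lemma Lword_simps [simp]: "Lword [] v = v" "Lword (l # ls) v = L (- int l) (Lword ls v)"
  by (simp_all add: Lword_def)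

lemma Mword_simps [simp]: "Mword [] v = v" "Mword (k # ks) v = Mword ks (M (int t + int k) v)"
  by (simp_all add: Mword_def)

lemma Lword_lin:
  "Lword ls 0 = 0" "Lword ls (v + w) = Lword ls v + Lword ls w" "Lword ls (c *s v)
      = c *s Lword ls v"
  by (induction ls) (simp_all add: R_lin)

lemma Mword_lin:
  "Mword ks 0 = 0" "Mword ks (v + w) = Mword ks v + Mword ks w" "Mword ks (c *s v)
      = c *s Mword ks v"
  by (induction ks arbitrary: v w) (simp_all add: R_lin)

lemma Mword_sum: "Mword ks (sum f A) = (\<Sum>a\<in>A. Mword ks (f a))"
  by (induction A rule: infinite_finite_induct) (simp_all add: Mword_lin)

text \<open>
  A word in the \<open>L(-l)\<close> is determined modulo shorter words
      by the multiset of its letters. Weakly decreasing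
  lists are the representatives for which the lexicographic order yields a triangular matrix.
\<close>
definition partitions :: "nat \<Rightarrow> nat list set"
  where "partitions r = {ls. length ls = r \<and> sorted_wrt (\<ge>) ls \<and> 0 \<notin> set ls}"

lemma lev_Lword: "u \<in> UY \<Longrightarrow> 0 \<notin> set ls \<Longrightarrow> lev (Suc (length ls)) (Lword ls u)"
  by (induction ls) (auto intro: lev.intros)

lemma M_Lword:
  assumes "u \<in> UY" "0 \<notin> set ls"
  shows "lev (length ls) (M i (Lword ls u) - Lword ls (M i u))"
  using assms
proof (induction ls)
  case (Cons l ls)
  let ?w = "Lword ls u"
  have "M i (Lword (l # ls) u) - Lword (l # ls) (M i u)
    = L (- int l) (M i ?w - Lword ls (M i u)) - of_int i *s M (i - int l) ?w"
    by (simp add: commute(6) R_lin)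
  moreover have "lev (Suc (length ls)) ?w" using lev_Lword Cons.prems by simp
  ultimately show ?case
    using Cons by (auto intro!: lev_diff lev_op lev_scale lev_M)
qed (auto intro: lev_zero)

text \<open>
  Modulo words with at least two letters fewer, \<open>M\<^bsub>t+k\<^esub>\<close> acts on a word as a derivation that turns
      the
  letter \<open>L(-l)\<close> into \<open>-(t+k) M\<^bsub>t+k-l\<^esub>\<close> acting on \<open>u\<close>. For \<open>l < k\<close> this kills \<open>u\<close>, and for \<open>l
      = k\<close> it is a
  multiple of \<open>M\<^sub>t u\<close>. If no letter exceeds \<open>k\<close>, the letters equal to \<open>k\<close> stand in front, whence
      the tail
  of the word.
\<close>
lemma M_Lword_top:
  assumes "u \<in> UY" "ls \<in> partitions r" "k > 0" "\<forall>l\<in>set ls. l \<le> k"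
  shows "lev (r - 1) (M (int t + int k) (Lword ls u)
    - (- of_nat (count_list ls k * (t + k))) *s Lword (tl ls) (M (int t) u))"
  using assms(2,4)
proof (induction ls arbitrary: r)
  case Nil
  then show ?case using UY_kill_M[OF assms(1), of "int t + int k"] assms(3)
    by (simp add: partitions_def lev_zero)
next
  case (Cons l ls)
  let ?w = "Lword ls u" and ?c = "\<lambda>n. - complex_of_nat (n * (t + k))"
  have l: "l > 0" "0 \<notin> set ls" "r = Suc (length ls)" "ls \<in> partitions (length ls)" "l \<le> k"
      "\<forall>j\<in>set ls. j \<le> l"
    using Cons.prems by (auto simp: partitions_def)
  have w: "lev (Suc (length ls)) ?w" using lev_Lword assms(1) l by simp
  have top: "M (int t + int k) (Lword (l # ls) u)
    = L (- int l) (M (int t + int k) ?w) - of_nat (t + k) *s M (int t + int k - int l) ?w"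
    by (simp add: commute(6))
  have IH: "lev (length ls - 1) (M (int t + int k) ?w - ?c (count_list ls k) *s Lword (tl ls) (M
      (int t) u))"
    using Cons.IH[OF l(4)] Cons.prems(2) by simp
  show ?case
  proof (cases "l = k")
    case False
    then have "count_list (l # ls) k = 0" "count_list ls k = 0"
      using l(5,6) by (auto simp: count_list_0_iff)
    moreover have "lev (length ls) (L (- int l) (M (int t + int k) ?w))"
      using IH l by (intro lev_op_pred) (simp_all add: calculation)
    moreover have "lev (length ls) (M (int t + int k - int l) ?w)"
      using lev_lower[OF w, of "int t + int k - int l"] False l(5) by simp
    ultimately show ?thesis
      unfolding top by (auto simp: l(3) intro!: lev_diff lev_scale)
  next
    case True
    have tl: "?c (count_list ls k) *s L (- int k) (Lword (tl ls) (M (int t) u))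
      = ?c (count_list ls k) *s Lword ls (M (int t) u)"
    proof (cases "k \<in> set ls")
      case True
      then obtain ls' where "ls = k # ls'"
        using l \<open>l = k\<close> Cons.prems(1) by (cases ls) (auto simp: partitions_def intro: antisym)
      then show ?thesis by simp
    qed (simp add: count_list_0_iff)
    have "lev (length ls) (L (- int l) (M (int t + int k) ?w - ?c (count_list ls k) *s Lword (tl
        ls) (M (int t) u)))"
      using IH l by (intro lev_op_pred)
    then have 1: "lev (length ls) (L (- int l) (M (int t + int k) ?w) - ?c (count_list ls k) *s
        Lword ls (M (int t) u))"
      by (simp only: R_lin tl True)
    have 2: "lev (length ls) (of_nat (t + k) *s (M (int t) ?w - Lword ls (M (int t) u)))"
      by (intro lev_scale M_Lword assms l)
    have "M (int t + int k) (Lword (l # ls) u) - ?c (count_list (l # ls) k) *s Lword (tl (l # ls))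
        (M (int t) u)
      = (L (- int l) (M (int t + int k) ?w) - ?c (count_list ls k) *s Lword ls (M (int t) u))
        - of_nat (t + k) *s (M (int t) ?w - Lword ls (M (int t) u))"
      unfolding top using True
      by (simp add: scale_right_diff_distrib scale_left_distrib scale_left_diff_distrib
          distrib_right)
    then show ?thesis using lev_diff[OF 1 2] by (simp add: l(3))
  qed
qed

lemma Mword_lev: "lev (length ks) v \<Longrightarrow> 0 \<notin> set ks \<Longrightarrow> Mword ks v = 0"
proof (induction ks arbitrary: v)
  case (Cons k ks)
  then show ?case using lev_lower[of "Suc (length ks)" v "int t + int k"] by simp
qed (simp add: lev_0)

text \<open>
  With respect to the lexicographic order, the matrix of the products \<open>M\<^bsub>t+k\<^sub>1\<^esub> ... M\<^bsub>t+k\<^sub>r\<^esub>\<close>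
      against the words
  \<open>L(-l\<^sub>1) ... L(-l\<^sub>r)\<close> is triangular with nonzero diagonal, up to \<open>M\<^sub>t\<^sup>r\<close>.
\<close>
lemma Mword_Lword:
  assumes "u \<in> UY" "ks \<in> partitions r" "ls \<in> partitions r" "ls \<le> ks"
  shows "\<exists>n. (n \<noteq> 0 \<longleftrightarrow> ls = ks) \<and> Mword ks (Lword ls u) = n *s ((M (int t) ^^ r) u)"
  using assms
proof (induction ks arbitrary: ls u r)
  case Nil
  then show ?case by (auto simp: partitions_def intro!: exI[of _ 1])
next
  case (Cons k ks)
  obtain l ls' s where ls: "ls = l # ls'" and r: "r = Suc s"
    using Cons.prems by (cases ls; cases r) (auto simp: partitions_def)
  have k: "k > 0" "ks \<in> partitions s" "0 \<notin> set ks" "length ks = s" "ls' \<in> partitions s" "l \<le> k"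
      "\<forall>j\<in>set ls. j \<le> k"
    using Cons.prems by (auto simp: partitions_def ls r)
  define c where "c = - complex_of_nat (count_list ls k * (t + k))"
  let ?e = "M (int t + int k) (Lword ls u) - c *s Lword ls' (M (int t) u)"
  have "lev (length ks) ?e"
    using M_Lword_top[OF Cons.prems(1,3) k(1,7)] by (simp add: r k(4) c_def ls)
  then have "Mword ks ?e = 0" using k(3) by (rule Mword_lev)
  then have eq: "Mword (k # ks) (Lword ls u) = c *s Mword ks (Lword ls' (M (int t) u))"
    using Mword_lin(2)[of ks ?e "c *s Lword ls' (M (int t) u)"] by (simp add: Mword_lin)
  show ?case
  proof (cases "l = k")
    case True
    then have "ls' \<le> ks" using Cons.prems(4) by (simp add: ls)
    from Cons.IH[OF UY_M[OF Cons.prems(1)] k(2,5) this]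
    obtain n where n: "n \<noteq> 0 \<longleftrightarrow> ls' = ks"
      "Mword ks (Lword ls' (M (int t) u)) = n *s ((M (int t) ^^ s) (M (int t) u))" by blast
    have "count_list ls k * (t + k) \<noteq> 0" using True k(1) by (simp add: ls)
    then have "c \<noteq> 0" by (simp add: c_def del: of_nat_mult of_nat_add)
    then show ?thesis
      unfolding eq n(2) r funpow_Suc_right using n(1) True
      by (intro exI[of _ "c * n"]) (simp add: ls)
  next
    case False
    then have "k \<notin> set ls" using k(6) Cons.prems(3) by (auto simp: ls partitions_def)
    then have "c = 0" by (simp add: c_def count_list_0_iff)
    then show ?thesis unfolding eq using False by (intro exI[of _ 0]) (simp add: ls)
  qed
qed

text \<open>
  Sorting a letter into place costs brackets \<open>[L(-l), L(-j)]\<close>, which replace two letters by one.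
\<close>
lemma partition_insert:
  assumes "ls \<in> partitions r" "l > 0"
  shows "\<exists>ls'\<in>partitions (Suc r). set ls' = insert l (set ls) \<and>
    (\<forall>u\<in>UY. lev (Suc r) (L (- int l) (Lword ls u) - Lword ls' u))"
  using assms(1)
proof (induction ls arbitrary: r)
  case Nil
  then show ?case using assms(2) by (intro bexI[of _ "[l]"]) (auto simp: partitions_def lev_zero)
next
  case (Cons j ls)
  then obtain s where r: "r = Suc s" "ls \<in> partitions s" "length ls = s" "0 \<notin> set ls" "j > 0"
    by (auto simp: partitions_def)
  show ?case
  proof (cases "l \<ge> j")
    case True
    then show ?thesis using Cons.prems assms(2)
      by (intro bexI[of _ "l # j # ls"]) (auto simp: partitions_def lev_zero)
  next
    case False
    from Cons.IH[OF r(2)] obtain ls' where ls': "ls' \<in> partitions (Suc s)" "set ls'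
        = insert l (set ls)"
      "\<And>u. u \<in> UY \<Longrightarrow> lev (Suc s) (L (- int l) (Lword ls u) - Lword ls' u)" by blast
    show ?thesis
    proof (intro bexI[of _ "j # ls'"] conjI ballI)
      show "j # ls' \<in> partitions (Suc r)"
        using ls'(1,2) False Cons.prems by (auto simp: partitions_def r)
      show "set (j # ls') = insert l (set (j # ls))" using ls'(2) by auto
      fix u assume u: "u \<in> UY"
      have "lev (Suc (Suc s)) (L (- int (l + j)) (Lword ls u))"
        using lev_Lword[OF u r(4)] assms(2) r(3) by (intro lev_op) auto
      moreover have "lev (Suc (Suc s)) (L (- int j) (L (- int l) (Lword ls u) - Lword ls' u))"
        using ls'(3)[OF u] r(5) by (rule lev_op)
      moreover have "L (- int l) (Lword (j # ls) u) - Lword (j # ls') u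
        = L (- int j) (L (- int l) (Lword ls u) - Lword ls' u) + of_int (int l - int j) *s L (-
            int (l + j)) (Lword ls u)"
        using commute(9)[of "- int l" "- int j" "Lword ls u"] r(5) by (simp add: R_lin)
      ultimately show "lev (Suc r) (L (- int l) (Lword (j # ls) u) - Lword (j # ls') u)"
        unfolding r(1) by (metis lev_add lev_scale)
    qed
  qed
qed

text \<open>
  Sorted words suffice here, since reordering the letters of a word only adds shorter words
  (\<open>partition_insert\<close>).
\<close>
definition leading :: "nat \<Rightarrow> 'b \<Rightarrow> bool"
  where "leading r w \<longleftrightarrow> (\<exists>A u w'. finite A \<and> A \<subseteq> partitions r \<and> (\<forall>ls. u ls \<in> UY) \<and> lev r w' \<and>
    w = (\<Sum>ls\<in>A. Lword ls (u ls)) + w')"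

lemma leading_lev: "lev r w \<Longrightarrow> leading r w"
  unfolding leading_def
  by (rule exI[of _ "{}"], rule exI[of _ "\<lambda>_. 0"], rule exI[of _ w])
      (simp add: UY_subspace[THEN subspace_0])

lemma leading_Lword: "ls \<in> partitions r \<Longrightarrow> u \<in> UY \<Longrightarrow> leading r (Lword ls u)"
  unfolding leading_def
  by (rule exI[of _ "{ls}"], rule exI[of _ "\<lambda>_. u"], rule exI[of _ 0]) (simp add: lev_zero)

lemma leading_add:
  assumes "leading r v" "leading r w"
  shows "leading r (v + w)"
proof -
  obtain A u v' where A: "finite A" "A \<subseteq> partitions r" "\<And>ls. u ls \<in> UY" "lev r v'"
    "v = (\<Sum>ls\<in>A. Lword ls (u ls)) + v'"
    using assms(1) unfolding leading_def by blast
  obtain B z w' where B: "finite B" "B \<subseteq> partitions r" "\<And>ls. z ls \<in> UY" "lev r w'"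
    "w = (\<Sum>ls\<in>B. Lword ls (z ls)) + w'"
    using assms(2) unfolding leading_def by blast
  let ?u = "\<lambda>ls. (if ls \<in> A then u ls else 0) + (if ls \<in> B then z ls else 0)"
  have "(\<Sum>ls\<in>A. Lword ls (u ls)) = (\<Sum>ls\<in>A \<union> B. Lword ls (if ls \<in> A then u ls else 0))"
    using A(1) B(1) by (intro sum.mono_neutral_cong_left) (auto simp: Lword_lin)
  moreover have "(\<Sum>ls\<in>B. Lword ls (z ls)) = (\<Sum>ls\<in>A \<union> B. Lword ls (if ls \<in> B then z ls else 0))"
    using A(1) B(1) by (intro sum.mono_neutral_cong_left) (auto simp: Lword_lin)
  ultimately have "v + w = (\<Sum>ls\<in>A \<union> B. Lword ls (?u ls)) + (v' + w')"
    unfolding A(5) B(5) Lword_lin sum.distrib by (simp add: algebra_simps)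
  moreover have "?u ls \<in> UY" for ls
    using A(3) B(3) UY_subspace by (auto simp: subspace_0 subspace_add)
  ultimately show ?thesis
    unfolding leading_def using A B
    by (intro exI[of _ "A \<union> B"] exI[of _ ?u] exI[of _ "v' + w'"]) (auto intro: lev_add)
qed

lemma leading_scale:
  assumes "leading r v"
  shows "leading r (c *s v)"
proof -
  obtain A u v' where A: "finite A" "A \<subseteq> partitions r" "\<And>ls. u ls \<in> UY" "lev r v'"
    "v = (\<Sum>ls\<in>A. Lword ls (u ls)) + v'"
    using assms(1) unfolding leading_def by blast
  have "c *s v = (\<Sum>ls\<in>A. Lword ls (c *s u ls)) + c *s v'"
    unfolding A(5) by (simp add: scale_right_distrib scale_sum_right Lword_lin)
  then show ?thesis
    unfolding leading_def using A
    by (intro exI[of _ A] exI[of _ "\<lambda>ls. c *s u ls"] exI[of _ "c *s v'"])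
       (auto intro: lev_scale UY_subspace[THEN subspace_scale])
qed

lemma leading_sum: "(\<And>a. a \<in> A \<Longrightarrow> leading r (f a)) \<Longrightarrow> leading r (sum f A)"
  by (induction A rule: infinite_finite_induct) (auto intro: leading_add leading_lev lev_zero)

lemma lev_leading: "lev (Suc r) w \<Longrightarrow> leading r w"
proof (induction "Suc r" w arbitrary: r rule: lev.induct)
  case (lev_base u r)
  show ?case
  proof (cases r)
    case 0
    then show ?thesis using leading_Lword[of "[]" 0 u] lev_base by (simp add: partitions_def)
  next
    case (Suc s)
    then show ?thesis using lev_base by (auto intro: leading_lev lev.lev_base)
  qed
next
  case (lev_op r v l)
  show ?case
  proof (cases r)
    case 0
    then have "v = 0" using lev_op(1) lev_0 by simp
    then show ?thesis by (simp add: leading_lev lev_zero)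
  next
    case (Suc s)
    then have "leading s v" using lev_op by blast
    then obtain A u v' where A: "finite A" "A \<subseteq> partitions s" "\<And>ls. u ls \<in> UY" "lev s v'"
      "v = (\<Sum>ls\<in>A. Lword ls (u ls)) + v'"
      unfolding leading_def by blast
    have "leading r (L (- int l) (Lword ls (u ls)))" if ls: "ls \<in> A" for ls
    proof -
      obtain ls' where ls': "ls' \<in> partitions r"
          "lev r (L (- int l) (Lword ls (u ls)) - Lword ls' (u ls))"
        using partition_insert[of ls s l] ls A(2,3) lev_op(3) unfolding Suc by blast
      show ?thesis
        using leading_add[OF leading_lev[OF ls'(2)] leading_Lword[OF ls'(1) A(3)[of ls]]] by simp
    qed
    moreover have "leading r (L (- int l) v')"
      using A(4) lev_op(3) unfolding Suc by (intro leading_lev lev.lev_op)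
    ultimately show ?thesis
      unfolding A(5) R_add R_sum by (intro leading_add leading_sum)
  qed
qed (auto intro: leading_lev lev_zero leading_add leading_scale)

text \<open>
  Among the words of top length that occur in \<open>w\<close>, the lexicographically largest one, \<open>ks\<close>,
      determines
  which \<open>M\<^bsub>t+k\<^esub>\<close> to apply: they kill all other words and all shorter ones
      and leave a nonzero multiple of
  \<open>M\<^sub>t\<^sup>r\<close> applied to the coefficient of \<open>ks\<close>. If no word of length \<open>r\<close> occurs, \<open>w\<close> lies one step
      lower in
  the filtration.
\<close>
theorem descend:
  assumes W: "\<And>x w. w \<in> W \<Longrightarrow> R x w \<in> W"
    and w: "w \<in> W" "w \<in> opspan (range R) J" "w \<noteq> 0"
  shows "\<exists>w\<in>W. w \<in> J \<and> w \<noteq> 0"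
proof -
  obtain r where "lev r w" using opspan_lev w(2) by blast
  then have "\<exists>w\<in>W. w \<in> UY \<and> w \<noteq> 0"
    using w(3)
  proof (induction r)
    case (Suc r)
    from lev_leading[OF Suc.prems(1)]
    obtain A u w' where A: "finite A" "A \<subseteq> partitions r" "\<And>ls. u ls \<in> UY" "lev r w'"
      "w = (\<Sum>ls\<in>A. Lword ls (u ls)) + w'"
      unfolding leading_def by blast
    define S where "S = {ls \<in> A. u ls \<noteq> 0}"
    have wS: "w = (\<Sum>ls\<in>S. Lword ls (u ls)) + w'"
      unfolding A(5) S_def by (simp, intro sum.mono_neutral_right)
          (use A(1) in \<open>auto simp: Lword_lin\<close>)
    show ?case
    proof (cases "S = {}")
      case True
      then show ?thesis using Suc A(4) wS by simp
    next
      case False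
      have fin: "finite S" using A(1) by (simp add: S_def)
      define ks where "ks = Max S"
      have ks: "ks \<in> S" using Max_in[OF fin False] by (simp add: ks_def)
      have le: "ls \<le> ks" if "ls \<in> S" for ls using Max_ge[OF fin that] by (simp add: ks_def)
      have part: "ls \<in> partitions r" if "ls \<in> S" for ls using that A(2) by (auto simp: S_def)
      have "Mword ks w' = 0"
        using Mword_lev[of ks w'] A(4) part[OF ks] by (auto simp: partitions_def)
      moreover have "Mword ks (\<Sum>ls\<in>S. Lword ls (u ls)) = Mword ks (Lword ks (u ks))"
        unfolding Mword_sum
      proof (subst sum.mono_neutral_right[of S "{ks}"])
        show "\<forall>i\<in>S - {ks}. Mword ks (Lword i (u i)) = 0"
        proof
          fix ls assume "ls \<in> S - {ks}"
          with Mword_Lword[OF A(3) part[OF ks] part[of ls] le[of ls], of ls]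
          show "Mword ks (Lword ls (u ls)) = 0" by auto
        qed
      qed (use fin ks in auto)
      ultimately have eq: "Mword ks w = Mword ks (Lword ks (u ks))"
        by (simp add: wS Mword_lin)
      obtain n where n: "n \<noteq> 0" "Mword ks w = n *s ((M (int t) ^^ r) (u ks))"
        using Mword_Lword[OF A(3) part[OF ks] part[OF ks] order_refl, of ks] eq by auto
      have "(M (int t) ^^ r) (u ks) \<in> UY \<and> (M (int t) ^^ r) (u ks) \<noteq> 0"
        using A(3) ks by (induction r) (auto simp: S_def intro: UY_M dest: UY_inj)
      then have "Mword ks w \<in> UY" "Mword ks w \<noteq> 0"
        using n UY_subspace by (auto simp: subspace_scale)
      moreover have "Mword ks w \<in> W"
        using w(1) by (induction ks arbitrary: w) (auto intro: W)
      ultimately show ?thesis by blast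
    qed
  qed (auto dest: lev_0)
  then show ?thesis using UY_descend[OF W] by blast
qed

end

section \<open>Local nilpotency\<close>

context sv_rep
begin

definition nil :: "sv \<Rightarrow> 'b set"
  where "nil x = {v. \<exists>n. (R x ^^ n) v = 0}"

lemma R_pow_zero: "(R x ^^ n) 0 = 0"
  by (induction n) simp_all

lemma R_pow_mono: "(R x ^^ n) v = 0 \<Longrightarrow> n \<le> m \<Longrightarrow> (R x ^^ m) v = 0"
  using funpow_add[of "m - n" n "R x"] by (simp add: R_pow_zero)

lemma nil_subspace: "subspace (nil x)"
proof (rule subspaceI)
  have add: "(R x ^^ n) (v + w) = (R x ^^ n) v + (R x ^^ n) w" for n v w
    by (induction n) (simp_all add: R_add)
  have scale: "(R x ^^ n) (c *s v) = c *s (R x ^^ n) v" for n v c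
    by (induction n) (simp_all add: R_scale)
  show "0 \<in> nil x" by (auto simp: nil_def R_pow_zero)
  show "v + w \<in> nil x" if vw: "v \<in> nil x" "w \<in> nil x" for v w
  proof -
    obtain n m where "(R x ^^ n) v = 0" "(R x ^^ m) w = 0" using vw unfolding nil_def by blast
    then have "(R x ^^ max n m) (v + w) = 0"
      using R_pow_mono[where m = "max n m"] by (simp add: add)
    then show ?thesis by (auto simp: nil_def)
  qed
  show "c *s v \<in> nil x" if "v \<in> nil x" for c v
    using that by (auto simp: nil_def scale intro: exI)
qed

lemma nil_R: "R x v \<in> nil x \<Longrightarrow> v \<in> nil x"
  by (auto simp: nil_def simp flip: funpow_Suc_right[THEN fun_cong, simplified o_apply]
      intro: exI[of _ "Suc _"])

text \<open>
  Demanding that \<open>z\<close> maps the whole orbit of \<open>w\<close> under \<open>x\<close> into the nilpotent vectors, rather than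
      only \<open>w\<close>
  itself, gives a condition that can be transferred from \<open>[x, z]\<close> to \<open>z\<close>.
\<close>
definition nil_orbit :: "sv \<Rightarrow> 'b \<Rightarrow> sv \<Rightarrow> bool"
  where "nil_orbit x w z \<longleftrightarrow> (\<forall>b. R z ((R x ^^ b) w) \<in> nil x)"

lemma nil_orbit_lin:
  "nil_orbit x w 0"
  "nil_orbit x w y \<Longrightarrow> nil_orbit x w z \<Longrightarrow> nil_orbit x w (y + z)"
  "nil_orbit x w y \<Longrightarrow> nil_orbit x w (sv_scale c y)"
  "nil_orbit x w y \<Longrightarrow> nil_orbit x w (- y)"
  using nil_subspace[of x]
  by (auto simp: nil_orbit_def R_lin subspace_0 subspace_add subspace_scale subspace_neg)

text \<open>
  From \<open>x (z x\<^sup>b w) = z x\<^bsup>b+1\<^esup> w + [x, z] x\<^sup>b w\<close>,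
      by downward induction on \<open>b\<close> starting where \<open>x\<^sup>b w = 0\<close>.
\<close>
lemma nil_orbit_bracket:
  assumes "w \<in> nil x" "nil_orbit x w (sv_bracket x z)"
  shows "nil_orbit x w z"
proof -
  obtain N where N: "(R x ^^ N) w = 0" using assms(1) by (auto simp: nil_def)
  have "R z ((R x ^^ b) w) \<in> nil x" for b
  proof (induction "N - b" arbitrary: b)
    case 0
    then have "(R x ^^ b) w = 0" using N R_pow_mono by auto
    then show ?case using nil_subspace by (simp add: subspace_0)
  next
    case (Suc k)
    have "k = N - Suc b" using Suc.hyps(2) by simp
    from Suc.hyps(1)[OF this] have "R z (R x ((R x ^^ b) w)) \<in> nil x" by simp
    moreover have "R (sv_bracket x z) ((R x ^^ b) w) \<in> nil x"
      using assms(2) by (simp add: nil_orbit_def)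
    ultimately have "R x (R z ((R x ^^ b) w)) \<in> nil x"
      unfolding R_commute[of x z] using nil_subspace by (simp add: subspace_add)
    then show ?case by (rule nil_R)
  qed
  then show ?thesis by (simp add: nil_orbit_def)
qed

lemma nil_orbit_generators:
  assumes "\<And>i. nil_orbit x w (sv_M i)" "\<And>i. nil_orbit x w (sv_Y i)"
    "\<And>i. nil_orbit x w (sv_L i)" "nil_orbit x w sv_C"
  shows "nil_orbit x w z"
proof (rule sv_span_induct[of z UNIV])
  show "nil_orbit x w (Poly_Mapping.single i 1)" for i
    by (rule sv_single_cases[of i]) (simp_all add: assms)
qed (simp_all add: nil_orbit_lin)

lemma opspan_nil:
  assumes "J \<subseteq> nil x" "\<And>w z. w \<in> opspan (range R) J \<Longrightarrow> w \<in> nil x \<Longrightarrow> nil_orbit x w z"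
  shows "opspan (range R) J \<subseteq> nil x"
proof
  fix v assume "v \<in> opspan (range R) J"
  then show "v \<in> nil x"
  proof induction
    case (opspan_op f v)
    then obtain z where "f = R z" by blast
    moreover have "R z ((R x ^^ 0) v) \<in> nil x"
      using assms(2)[OF opspan_op(2) opspan_op(3)] unfolding nil_orbit_def by blast
    ultimately show ?case by simp
  qed (use assms(1) nil_subspace in \<open>auto simp: subspace_0 subspace_add subspace_scale\<close>)
qed

text \<open>
  \<open>(ad M\<^sub>i)\<^sup>2 = 0\<close>, since \<open>[M\<^sub>i, z]\<close> is always a combination of the \<open>M\<close>.
\<close>
lemma nil_orbit_M:
  assumes "w \<in> nil (sv_M i)"
  shows "nil_orbit (sv_M i) w z"
proof -
  note step = nil_orbit_bracket[OF assms]
  have M: "nil_orbit (sv_M i) w (sv_M j)" for j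
    by (rule step) (simp add: sv_bracket_gens nil_orbit_lin)
  show ?thesis
    by (rule nil_orbit_generators; rule step) (simp_all add: sv_bracket_gens nil_orbit_lin M)
qed

text \<open>
  \<open>(ad Y\<^sub>i)\<^sup>3 = 0\<close>, since \<open>ad Y\<^sub>i\<close> maps the \<open>L\<close> to the \<open>Y\<close>, the \<open>Y\<close> to the \<open>M\<close> and the \<open>M\<close> to \<open>0\<close>.
\<close>
lemma nil_orbit_Y:
  assumes "w \<in> nil (sv_Y i)"
  shows "nil_orbit (sv_Y i) w z"
proof -
  note step = nil_orbit_bracket[OF assms]
  have M: "nil_orbit (sv_Y i) w (sv_M j)" for j
    by (rule step) (simp add: sv_bracket_gens nil_orbit_lin)
  have Y: "nil_orbit (sv_Y i) w (sv_Y j)" for j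
    by (rule step) (simp add: sv_bracket_gens nil_orbit_lin M)
  show ?thesis
    by (rule nil_orbit_generators; rule step) (simp_all add: sv_bracket_gens nil_orbit_lin M Y)
qed

definition restricted :: "'b \<Rightarrow> bool"
  where "restricted v \<longleftrightarrow> (\<exists>B::int. \<forall>j\<ge>B. M j v = 0 \<and> Y j v = 0 \<and> L j v = 0)"

lemma restricted_subspace: "subspace {v. restricted v}"
proof (rule subspaceI; clarsimp)
  show "restricted 0" by (simp add: restricted_def)
  show "restricted (c *s v)" if "restricted v" for c v
    using that by (auto simp: restricted_def R_lin)
  show "restricted (v + w)" if v: "restricted v" and w: "restricted w" for v w
  proof -
    obtain A B where "\<forall>j\<ge>A. M j v = 0 \<and> Y j v = 0 \<and> L j v = 0"
      "\<forall>j\<ge>B. M j w = 0 \<and> Y j w = 0 \<and> L j w = 0"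
      using v w unfolding restricted_def by blast
    then show ?thesis unfolding restricted_def by (intro exI[of _ "max A B"]) (simp add: R_lin)
  qed
qed

lemma restricted_R:
  assumes "restricted v"
  shows "restricted (R x v)"
proof -
  obtain B where B: "\<And>j. j \<ge> B \<Longrightarrow> M j v = 0" "\<And>j. j \<ge> B \<Longrightarrow> Y j v = 0" "\<And>j. j \<ge> B \<Longrightarrow> L j v = 0"
    using assms unfolding restricted_def by blast
  have Z: "M k v = 0" "Y k v = 0" "L k v = 0"
    if "k = j \<or> k = i + j \<or> k = j + i \<or> k = i + j + 1 \<or> k = j + i + 1" "j \<ge> \<bar>B\<bar> + \<bar>i\<bar> + 1" for i j k
    using that by (intro B; linarith)+
  have MYL: "M j (M i v) = 0 \<and> Y j (M i v) = 0 \<and> L j (M i v) = 0"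
    "M j (Y i v) = 0 \<and> Y j (Y i v) = 0 \<and> L j (Y i v) = 0"
    "M j (L i v) = 0 \<and> Y j (L i v) = 0 \<and> L j (L i v) = 0" if j: "j \<ge> \<bar>B\<bar> + \<bar>i\<bar> + 1" for i j
  proof -
    note Z = Z[OF _ j, simplified]
    have "j + i \<noteq> 0" using j by linarith
    then show "M j (M i v) = 0 \<and> Y j (M i v) = 0 \<and> L j (M i v) = 0"
      "M j (Y i v) = 0 \<and> Y j (Y i v) = 0 \<and> L j (Y i v) = 0"
      "M j (L i v) = 0 \<and> Y j (L i v) = 0 \<and> L j (L i v) = 0"
      by (simp_all add: Z commute(1)[of j i] commute(3)[of j i] commute(5)[of j i]
          commute(2)[of j i]
          commute(4)[of j i] commute(7)[of j i] commute(6)[of j i] commute(8)[of j i]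
              commute(9)[of j i])
  qed
  have "R x v \<in> {v. restricted v}"
  proof (rule R_closed[OF restricted_subspace])
    show "C v \<in> {v. restricted v}"
      using B unfolding restricted_def by (auto intro!: exI[of _ B] simp flip: commute(10))
  qed (use MYL in \<open>unfold restricted_def, blast+\<close>)
  then show ?thesis by simp
qed

text \<open>
  \<open>ad L\<^sub>k\<close> is not nilpotent on the generators, but it raises their index
      by \<open>k > 0\<close>. The orbit of \<open>w\<close> has only
  finitely many nonzero vectors, so one bound \<open>B\<close> serves
      for all of them; above \<open>B\<close> the generators act as
  zero on the orbit, and downward induction on the index covers the others.
\<close>
lemma nil_orbit_L:
  assumes w: "w \<in> nil (sv_L k)" and k: "k > 0" and restr: "restricted w"
  shows "nil_orbit (sv_L k) w z"
proof -
  note step = nil_orbit_bracket[OF w]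
  obtain N where N: "(L k ^^ N) w = 0" using w by (auto simp: nil_def)
  have res: "restricted ((L k ^^ b) w)" for b
    by (induction b) (auto intro: restr restricted_R)
  define A where "A b = (SOME B. \<forall>j\<ge>B. M j ((L k ^^ b) w) = 0 \<and> Y j ((L k ^^ b) w) = 0
      \<and> L j ((L k ^^ b) w) = 0)" for b
  have A: "\<forall>j\<ge>A b. M j ((L k ^^ b) w) = 0 \<and> Y j ((L k ^^ b) w) = 0 \<and> L j ((L k ^^ b) w) = 0" for b
    unfolding A_def by (rule someI_ex) (rule res[unfolded restricted_def])
  define B where "B = Max (insert 0 (A ` {..<N}))"
  have B: "M j ((L k ^^ b) w) = 0 \<and> Y j ((L k ^^ b) w) = 0 \<and> L j ((L k ^^ b) w) = 0"
      if "j \<ge> B" for j b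
  proof (cases "b < N")
    case True
    then have "A b \<le> B" by (auto simp: B_def intro!: Max_ge)
    with that A show ?thesis by auto
  next
    case False
    then have "(L k ^^ b) w = 0" using N R_pow_mono[where x = "sv_L k" and v = w] by auto
    then show ?thesis by simp
  qed
  have zero: "0 \<in> nil (sv_L k)" using nil_subspace by (rule subspace_0)
  have C: "nil_orbit (sv_L k) w sv_C"
    by (rule step) (simp add: sv_bracket_gens nil_orbit_lin)
  have descend: "nil_orbit (sv_L k) w (g j)"
    if high: "\<And>j b. j \<ge> B \<Longrightarrow> R (g j) ((L k ^^ b) w) = 0"
      and bracket: "\<And>j. nil_orbit (sv_L k) w (g (k + j))
          \<Longrightarrow> nil_orbit (sv_L k) w (sv_bracket (sv_L k) (g j))"
    for g :: "int \<Rightarrow> sv" and j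
  proof (induction "nat (B - j)" arbitrary: j rule: less_induct)
    case less
    show ?case
    proof (cases "j \<ge> B")
      case True
      then show ?thesis using high zero by (simp add: nil_orbit_def)
    next
      case False
      then have "nil_orbit (sv_L k) w (g (k + j))" using k by (intro less) simp
      then show ?thesis by (rule step[OF bracket])
    qed
  qed
  have M: "nil_orbit (sv_L k) w (sv_M j)" for j
    by (rule descend) (use B in \<open>simp_all add: sv_bracket_gens nil_orbit_lin\<close>)
  have Y: "nil_orbit (sv_L k) w (sv_Y j)" for j
    by (rule descend) (use B in \<open>simp_all add: sv_bracket_gens nil_orbit_lin\<close>)
  have L: "nil_orbit (sv_L k) w (sv_L j)" for j
    by (rule descend) (use B C in \<open>simp_all add: sv_bracket_gens nil_orbit_lin\<close>)
  show ?thesis by (rule nil_orbit_generators) (rule M Y L C)+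
qed

end

context sv_lowering
begin

theorem locally_nilpotent_lowering:
  assumes "v \<in> opspan (range R) J"
  shows "i > int t \<Longrightarrow> v \<in> nil (sv_M i)"
    and "i \<ge> int t + int d2 \<Longrightarrow> v \<in> nil (sv_Y i)"
    and "i > int t + int d1 \<Longrightarrow> v \<in> nil (sv_L i)"
proof -
  have kill: "J \<subseteq> nil x" if "\<And>v. v \<in> J \<Longrightarrow> R x v = 0" for x
    using that by (auto simp: nil_def intro!: exI[of _ 1])
  have "u \<in> {v. restricted v}" if "u \<in> J" for u
    using that kill_M kill_Y kill_L by (auto simp: restricted_def
        intro!: exI[of _ "int t + int d1 + int d2 + 1"])
  moreover have "f u \<in> {v. restricted v}" if "f \<in> range R" "u \<in> {v. restricted v}" for f u
    using that restricted_R by auto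
  ultimately have restr: "opspan (range R) J \<subseteq> {v. restricted v}"
    by (intro opspan_least restricted_subspace) auto
  show "v \<in> nil (sv_M i)" if "i > int t"
    using opspan_nil[of J "sv_M i"] kill[of "sv_M i"] kill_M[OF that] nil_orbit_M assms by blast
  show "v \<in> nil (sv_Y i)" if "i \<ge> int t + int d2"
    using opspan_nil[of J "sv_Y i"] kill[of "sv_Y i"] kill_Y[OF that] nil_orbit_Y assms by blast
  show "v \<in> nil (sv_L i)" if "i > int t + int d1"
  proof -
    have "nil_orbit (sv_L i) w z" if "w \<in> opspan (range R) J" "w \<in> nil (sv_L i)" for w z
      using that \<open>i > int t + int d1\<close> restr by (intro nil_orbit_L) auto
    then show ?thesis using opspan_nil[of J "sv_L i"] kill[of "sv_L i"] kill_L[OF that] assms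
        by blast
  qed
qed

end

section \<open>The universal enveloping algebra and its action on modules\<close>

lemma free_algebra_simps [simp]:
  "p \<in> carrier (free_algebra A) \<longleftrightarrow> Poly_Mapping.keys p \<subseteq> lists A"
  "\<zero>\<^bsub>free_algebra A\<^esub> = 0" "\<one>\<^bsub>free_algebra A\<^esub> = 1"
  "p \<oplus>\<^bsub>free_algebra A\<^esub> q = p + q" "p \<otimes>\<^bsub>free_algebra A\<^esub> q = p * q"
  by (simp_all add: free_algebra_def ring_of_type_algebra_def)

lemma keys_word_mult: "Poly_Mapping.keys p \<subseteq> lists A \<Longrightarrow> Poly_Mapping.keys q \<subseteq> lists A
  \<Longrightarrow> Poly_Mapping.keys (p * q) \<subseteq> lists A" for p q :: "'a list \<Rightarrow>\<^sub>0 complex"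
  using keys_mult[of p q] by (force simp: plus_list_def)

lemma keys_word_add: "Poly_Mapping.keys p \<subseteq> W \<Longrightarrow> Poly_Mapping.keys q \<subseteq> W
  \<Longrightarrow> Poly_Mapping.keys (p + q) \<subseteq> W" for p q :: "'w \<Rightarrow>\<^sub>0 complex"
  using Poly_Mapping.keys_add[of p q] by blast

lemma keys_word_diff: "Poly_Mapping.keys p \<subseteq> W \<Longrightarrow> Poly_Mapping.keys q \<subseteq> W
  \<Longrightarrow> Poly_Mapping.keys (p - q) \<subseteq> W" for p q :: "'w \<Rightarrow>\<^sub>0 complex"
  using keys_diff[of p q] by blast

lemma keys_single_word: "w \<in> W \<Longrightarrow> Poly_Mapping.keys (Poly_Mapping.single w c) \<subseteq> W" for c :: complex
  by simp

lemma single_word_mult: "Poly_Mapping.single u a * Poly_Mapping.single w b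
    = Poly_Mapping.single (u @ w) (a * b)"
  for a b :: complex
  by (simp add: mult_single plus_list_def)

lemma ring_free_algebra: "ring (free_algebra A)"
proof (rule ringI)
  show "abelian_group (free_algebra A)"
  proof (rule abelian_groupI)
    show "\<exists>y\<in>carrier (free_algebra A). y \<oplus>\<^bsub>free_algebra A\<^esub> x = \<zero>\<^bsub>free_algebra A\<^esub>"
      if "x \<in> carrier (free_algebra A)" for x
      using that by (intro bexI[of _ "- x"]) auto
  qed (simp_all add: keys_word_add add_ac)
  show "monoid (free_algebra A)"
    by (rule monoidI) (simp_all add: keys_word_mult zero_list_def mult.assoc)
qed (simp_all add: distrib_left distrib_right)

lemma combination_induct [consumes 1, case_names zero single add]:
  assumes "Poly_Mapping.keys p \<subseteq> W"
    and "P 0" "\<And>w c. w \<in> W \<Longrightarrow> P (Poly_Mapping.single w c)"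
    and "\<And>p q. Poly_Mapping.keys p \<subseteq> W \<Longrightarrow> Poly_Mapping.keys q \<subseteq> W \<Longrightarrow> P p \<Longrightarrow> P q \<Longrightarrow> P (p + q)"
  shows "P (p :: 'w \<Rightarrow>\<^sub>0 complex)"
proof -
  have "p = (\<Sum>w\<in>Poly_Mapping.keys p. Poly_Mapping.single w (Poly_Mapping.lookup p w))"
    by (rule poly_mapping_eqI) (simp add: lookup_sum lookup_single when_def in_keys_iff cong:
        if_cong)
  moreover have "Poly_Mapping.keys (\<Sum>w\<in>A. Poly_Mapping.single w (Poly_Mapping.lookup p w)) \<subseteq> W \<and>
      P (\<Sum>w\<in>A. Poly_Mapping.single w (Poly_Mapping.lookup p w))"
    if "finite A" "A \<subseteq> W" for A
    using that
  proof (induction A)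
    case (insert w A)
    have "Poly_Mapping.keys (Poly_Mapping.single w (Poly_Mapping.lookup p w)) \<subseteq> W"
      using insert.prems by (intro keys_single_word) simp
    with insert show ?case by (simp add: keys_word_add assms)
  qed (simp add: assms)
  ultimately show ?thesis using assms(1) by (metis finite_keys)
qed

context lie_algebra
begin

abbreviation "F \<equiv> free_algebra (carrier L)"
abbreviation "ncpoly p \<equiv> Poly_Mapping.keys p \<subseteq> lists (carrier L)"

lemma uea_relators_carrier: "uea_relators L \<subseteq> carrier F"
proof
  have smult: "c \<odot> x \<in> carrier L" if "x \<in> carrier L" for c x
    using smult_closed[of c x] that by (simp add: ring_of_type_algebra_def)
  fix r assume "r \<in> uea_relators L"
  then show "r \<in> carrier F"
    unfolding uea_relators_def
    by (elim UnE CollectE exE conjE) (simp_all add: keys_word_diff smult lie_bracket_closed)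
qed

lemma uea_ideal: "ideal (uea_ideal L) F"
  unfolding uea_ideal_def by (rule ring.genideal_ideal[OF ring_free_algebra uea_relators_carrier])

lemma uea_relators_ideal: "uea_relators L \<subseteq> uea_ideal L"
  unfolding uea_ideal_def by (rule ring.genideal_self[OF ring_free_algebra uea_relators_carrier])

lemma uea_ideal_minimal: "ideal I F \<Longrightarrow> uea_relators L \<subseteq> I \<Longrightarrow> uea_ideal L \<subseteq> I"
  unfolding uea_ideal_def by (rule ring.genideal_minimal[OF ring_free_algebra])

lemma uea_ideal_closed:
  "0 \<in> uea_ideal L" "p \<in> uea_ideal L \<Longrightarrow> q \<in> uea_ideal L \<Longrightarrow> p + q \<in> uea_ideal L"
  "p \<in> uea_ideal L \<Longrightarrow> - p \<in> uea_ideal L" "p \<in> uea_ideal L \<Longrightarrow> q \<in> uea_ideal L \<Longrightarrow> p - q \<in> uea_ideal L"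
  "p \<in> uea_ideal L \<Longrightarrow> ncpoly q \<Longrightarrow> p * q \<in> uea_ideal L"
  "p \<in> uea_ideal L \<Longrightarrow> ncpoly q \<Longrightarrow> q * p \<in> uea_ideal L"
  "p \<in> uea_ideal L \<Longrightarrow> ncpoly p"
proof -
  interpret I: ideal "uea_ideal L" F by (rule uea_ideal)
  have sub: "additive_subgroup (uea_ideal L) F" by (rule I.additive_subgroup_axioms)
  show zero: "0 \<in> uea_ideal L" using additive_subgroup.zero_closed[OF sub] by simp
  show add: "p \<in> uea_ideal L \<Longrightarrow> q \<in> uea_ideal L \<Longrightarrow> p + q \<in> uea_ideal L" for p q
    using additive_subgroup.a_closed[OF sub, of p q] by simp
  show keys: "p \<in> uea_ideal L \<Longrightarrow> ncpoly p" for p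
    using I.Icarr[of p] by simp
  show mult: "p \<in> uea_ideal L \<Longrightarrow> ncpoly q \<Longrightarrow> p * q \<in> uea_ideal L" for p q
    using I.I_r_closed[of p q] by simp
  show "p \<in> uea_ideal L \<Longrightarrow> ncpoly q \<Longrightarrow> q * p \<in> uea_ideal L" for p q
    using I.I_l_closed[of p q] by simp
  show neg: "p \<in> uea_ideal L \<Longrightarrow> - p \<in> uea_ideal L" for p
    using mult[of p "- 1"] by (simp add: zero_list_def)
  show "p \<in> uea_ideal L \<Longrightarrow> q \<in> uea_ideal L \<Longrightarrow> p - q \<in> uea_ideal L" for p q
    using add[of p "- q"] neg[of q] by simp
qed

lemma mem_uea_class: "q \<in> uea_class L p \<longleftrightarrow> q - p \<in> uea_ideal L"
  by (auto simp: uea_class_def a_r_coset_def' intro: bexI[of _ "q - p"])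

lemma uea_class_eq: "uea_class L p = uea_class L q \<longleftrightarrow> p - q \<in> uea_ideal L"
proof
  assume "uea_class L p = uea_class L q"
  then show "p - q \<in> uea_ideal L" using mem_uea_class[of p p] mem_uea_class[of p q]
      uea_ideal_closed(1) by simp
next
  assume pq: "p - q \<in> uea_ideal L"
  have "r - p \<in> uea_ideal L \<longleftrightarrow> r - q \<in> uea_ideal L" for r
    using uea_ideal_closed(2)[OF _ pq, of "r - p"] uea_ideal_closed(4)[OF _ pq, of "r - q"] by auto
  then show "uea_class L p = uea_class L q" by (auto simp: mem_uea_class)
qed

lemma carrier_uea: "a \<in> carrier (uea L) \<longleftrightarrow> (\<exists>p. ncpoly p \<and> a = uea_class L p)"
  by (auto simp: uea_def FactRing_def A_RCOSETS_def' uea_class_def) blast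

lemma uea_class_mult:
  assumes "ncpoly p" "ncpoly q"
  shows "uea_class L p \<otimes>\<^bsub>uea L\<^esub> uea_class L q = uea_class L (p * q)"
  using ideal.rcoset_mult_add[OF uea_ideal, of p q] assms
  by (simp add: uea_def FactRing_def uea_class_def)

lemma uea_class_add:
  assumes "ncpoly p" "ncpoly q"
  shows "uea_class L p \<oplus>\<^bsub>uea L\<^esub> uea_class L q = uea_class L (p + q)"
  using ideal.a_rcos_sum[OF uea_ideal, of p q] assms
  by (simp add: uea_def FactRing_def uea_class_def)

end

context lie_module
begin

lemma complex_carrier [simp]: "c \<in> carrier (complex_field)" 
  by (simp add: ring_of_type_algebra_def)

lemma complex_field_simps [simp]:
  "a \<oplus>\<^bsub>complex_field\<^esub> b = a + b" "a \<otimes>\<^bsub>complex_field\<^esub> b = a * b"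
  "\<zero>\<^bsub>complex_field\<^esub> = 0" "\<one>\<^bsub>complex_field\<^esub> = 1" for a b :: complex
  by (simp_all add: ring_of_type_algebra_def)

lemma smult_zero [simp]: "v \<in> carrier V \<Longrightarrow> 0 \<odot>\<^bsub>V\<^esub> v = \<zero>\<^bsub>V\<^esub>"
  using V.smult_l_null[of v] by simp

lemma smult_one: "v \<in> carrier V \<Longrightarrow> 1 \<odot>\<^bsub>V\<^esub> v = v"
  using V.smult_one[of v] by simp

lemma smult_mult: "v \<in> carrier V \<Longrightarrow> (a * b) \<odot>\<^bsub>V\<^esub> v = a \<odot>\<^bsub>V\<^esub> (b \<odot>\<^bsub>V\<^esub> v)"
  using V.smult_assoc1[of a b v] by simp

lemma act_zero_right: "x \<in> carrier L \<Longrightarrow> act V x \<zero>\<^bsub>V\<^esub> = \<zero>\<^bsub>V\<^esub>"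
  using act_smult_right[of x "\<zero>\<^bsub>V\<^esub>" 0] V.smult_l_null[of "\<zero>\<^bsub>V\<^esub>"] V.smult_l_null[of "act V x \<zero>\<^bsub>V\<^esub>"]
  by (simp add: act_closed)

lemma word_act_closed: "w \<in> lists (carrier L) \<Longrightarrow> v \<in> carrier V \<Longrightarrow> foldr (act V) w v \<in> carrier V"
  by (induction w) (auto intro: act_closed)

lemma word_act_add: "w \<in> lists (carrier L) \<Longrightarrow> u \<in> carrier V \<Longrightarrow> v \<in> carrier V \<Longrightarrow>
  foldr (act V) w (u \<oplus>\<^bsub>V\<^esub> v) = foldr (act V) w u \<oplus>\<^bsub>V\<^esub> foldr (act V) w v"
  by (induction w) (auto simp: act_add_right word_act_closed)

lemma word_act_smult: "w \<in> lists (carrier L) \<Longrightarrow> v \<in> carrier V \<Longrightarrow>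
  foldr (act V) w (c \<odot>\<^bsub>V\<^esub> v) = c \<odot>\<^bsub>V\<^esub> foldr (act V) w v"
  by (induction w) (auto simp: act_smult_right word_act_closed)

lemma free_algebra_act_superset:
  assumes "finite A" "A \<subseteq> lists (carrier L)" "Poly_Mapping.keys p \<subseteq> A" "v \<in> carrier V"
  shows "free_algebra_act V p v = finsum V (\<lambda>w. Poly_Mapping.lookup p w \<odot>\<^bsub>V\<^esub> foldr (act V) w v) A"
  unfolding free_algebra_act_def
proof (rule V.add.finprod_mono_neutral_cong_left)
  show "Poly_Mapping.lookup p w \<odot>\<^bsub>V\<^esub> foldr (act V) w v = \<zero>\<^bsub>V\<^esub>"
      if "w \<in> A - Poly_Mapping.keys p" for w
  proof -
    have "w \<in> lists (carrier L)" "Poly_Mapping.lookup p w = 0"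
      using that assms(2) by (auto simp only: in_keys_iff)
    then show ?thesis using V.smult_l_null[OF word_act_closed] assms(4) by simp
  qed
qed (use assms(1,3) word_act_closed[OF subsetD[OF assms(2)] assms(4)] in \<open>auto
    intro!: V.smult_closed\<close>)

lemma free_algebra_act_closed:
  "L.ncpoly p \<Longrightarrow> v \<in> carrier V \<Longrightarrow> free_algebra_act V p v \<in> carrier V"
  unfolding free_algebra_act_def by (intro V.finsum_closed)
      (auto intro!: V.smult_closed word_act_closed)

lemma free_algebra_act_plus:
  assumes "L.ncpoly p" "L.ncpoly q" "v \<in> carrier V"
  shows "free_algebra_act V (p + q) v = free_algebra_act V p v \<oplus>\<^bsub>V\<^esub> free_algebra_act V q v"
proof -
  let ?A = "Poly_Mapping.keys p \<union> Poly_Mapping.keys q"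
  have A: "finite ?A" "?A \<subseteq> lists (carrier L)" using assms by auto
  have W: "foldr (act V) w v \<in> carrier V" if "w \<in> ?A" for w using that A assms(3) word_act_closed
      by blast
  have "finsum V (\<lambda>w. Poly_Mapping.lookup (p + q) w \<odot>\<^bsub>V\<^esub> foldr (act V) w v) ?A
    = finsum V (\<lambda>w. Poly_Mapping.lookup p w \<odot>\<^bsub>V\<^esub> foldr (act V) w v
        \<oplus>\<^bsub>V\<^esub> Poly_Mapping.lookup q w \<odot>\<^bsub>V\<^esub> foldr (act V) w v) ?A"
    using V.smult_l_distr[OF complex_carrier complex_carrier W] W
    by (intro V.finsum_cong') (auto simp: lookup_add)
  also have "\<dots> = finsum V (\<lambda>w. Poly_Mapping.lookup p w \<odot>\<^bsub>V\<^esub> foldr (act V) w v) ?A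
     \<oplus>\<^bsub>V\<^esub> finsum V (\<lambda>w. Poly_Mapping.lookup q w \<odot>\<^bsub>V\<^esub> foldr (act V) w v) ?A"
    using W by (intro V.finsum_addf) auto
  finally show ?thesis
    using free_algebra_act_superset[OF A _ assms(3)] Poly_Mapping.keys_add[of p q] by simp
qed

lemma free_algebra_act_zero: "free_algebra_act V 0 v = \<zero>\<^bsub>V\<^esub>"
  by (simp add: free_algebra_act_def)

lemma free_algebra_act_single:
  assumes "w \<in> lists (carrier L)" "v \<in> carrier V"
  shows "free_algebra_act V (Poly_Mapping.single w c) v = c \<odot>\<^bsub>V\<^esub> foldr (act V) w v"
  using assms word_act_closed[OF assms]
  by (subst free_algebra_act_superset[of "{w}"]) (auto simp: V.smult_closed)

lemma free_algebra_act_right: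
  assumes "L.ncpoly p" 
  shows "u \<in> carrier V \<Longrightarrow> v \<in> carrier V \<Longrightarrow>
      free_algebra_act V p (u \<oplus>\<^bsub>V\<^esub> v) = free_algebra_act V p u \<oplus>\<^bsub>V\<^esub> free_algebra_act V p v" 
    and "v \<in> carrier V \<Longrightarrow> free_algebra_act V p (c \<odot>\<^bsub>V\<^esub> v) = c \<odot>\<^bsub>V\<^esub> free_algebra_act V p v"
  using assms
proof (induction rule: combination_induct)
  case zero
  { case 1 show ?case by (simp add: free_algebra_act_zero) }
  { case 2 show ?case by (simp add: free_algebra_act_zero) }
next
  case (single w a)
  { case 1 then show ?case using single
      by (simp add: free_algebra_act_single word_act_add word_act_closed V.smult_r_distr) }
  { case 2 then show ?case using single V.smult_assoc1[of a c "foldr (act V) w v"]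
      V.smult_assoc1[of c a "foldr (act V) w v"]
      by (simp add: free_algebra_act_single word_act_smult word_act_closed mult.commute) }
next
  case (add p q)
  { case 1 then show ?case using add by (simp add: free_algebra_act_plus free_algebra_act_closed
      V.add.m_ac) }
  { case 2 then show ?case using add by (simp add: free_algebra_act_plus free_algebra_act_closed
      V.smult_r_distr) }
qed

lemma free_algebra_act_zero_right:
  "L.ncpoly p \<Longrightarrow> free_algebra_act V p \<zero>\<^bsub>V\<^esub> = \<zero>\<^bsub>V\<^esub>"
  using free_algebra_act_right(2)[of p "\<zero>\<^bsub>V\<^esub>" 0] by (simp add: free_algebra_act_closed)

lemma free_algebra_act_mult:
  assumes "L.ncpoly p" "L.ncpoly q" "v \<in> carrier V"
  shows "free_algebra_act V (p * q) v = free_algebra_act V p (free_algebra_act V q v)"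
  using assms(1)
proof (induction rule: combination_induct)
  case (single u a)
  from assms(2) show ?case
  proof (induction rule: combination_induct)
    case zero
    show ?case using single by (simp add: free_algebra_act_zero free_algebra_act_zero_right)
  next
    case (single w b)
    then show ?case using \<open>u \<in> lists (carrier L)\<close> assms(3)
      by (simp add: single_word_mult free_algebra_act_single word_act_closed word_act_smult
          smult_mult)
  next
    case (add p q)
    then show ?case using single assms(3)
      by (simp add: distrib_left free_algebra_act_plus keys_word_mult free_algebra_act_closed
          free_algebra_act_right(1))
  qed
next
  case (add p q)
  then show ?case using assms
    by (simp add: distrib_right free_algebra_act_plus keys_word_mult free_algebra_act_closed)
qed (simp add: free_algebra_act_zero)

lemma free_algebra_act_uminus:
  assumes "L.ncpoly p" "v \<in> carrier V"
  shows "free_algebra_act V (- p) v = \<ominus>\<^bsub>V\<^esub> free_algebra_act V p v"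
proof -
  have "free_algebra_act V (- p) v \<oplus>\<^bsub>V\<^esub> free_algebra_act V p v = \<zero>\<^bsub>V\<^esub>"
    using free_algebra_act_plus[of "- p" p v] assms by (simp add: free_algebra_act_zero)
  then show ?thesis using assms by (intro V.minus_equality[symmetric])
      (simp_all add: free_algebra_act_closed)
qed

text \<open>
  The elements of the free algebra that annihilate \<open>V\<close>
      form a two-sided ideal containing the relators.
\<close>
lemma uea_ideal_acts_zero:
  assumes "p \<in> uea_ideal L" "v \<in> carrier V"
  shows "free_algebra_act V p v = \<zero>\<^bsub>V\<^esub>"
proof -
  let ?I = "{p. L.ncpoly p \<and> (\<forall>v\<in>carrier V. free_algebra_act V p v = \<zero>\<^bsub>V\<^esub>)}"
  have "ideal ?I (free_algebra (carrier L))"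
  proof (rule idealI[OF ring_free_algebra])
    interpret F: ring "free_algebra (carrier L)" by (rule ring_free_algebra)
    show "subgroup ?I (add_monoid (free_algebra (carrier L)))"
    proof (rule F.add.subgroupI)
      show "\<ominus>\<^bsub>free_algebra (carrier L)\<^esub> a \<in> ?I" if "a \<in> ?I" for a
      proof -
        have "\<ominus>\<^bsub>free_algebra (carrier L)\<^esub> a = - a"
          using that by (intro F.minus_equality) auto
        then show ?thesis using that by (simp add: free_algebra_act_uminus)
      qed
    qed (auto simp: free_algebra_act_plus keys_word_add free_algebra_act_zero intro!: exI[of _ 0])
    show "x \<otimes>\<^bsub>free_algebra (carrier L)\<^esub> a \<in> ?I" "a \<otimes>\<^bsub>free_algebra (carrier L)\<^esub> x \<in> ?I"
      if "a \<in> ?I" "x \<in> carrier (free_algebra (carrier L))" for a x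
      using that by (auto simp: keys_word_mult free_algebra_act_mult free_algebra_act_closed
          free_algebra_act_zero_right)
  qed
  moreover have "uea_relators L \<subseteq> ?I"
  proof
    fix r assume r: "r \<in> uea_relators L"
    have keys: "L.ncpoly r" using subsetD[OF L.uea_relators_carrier r]
        by (simp only: free_algebra_simps)
    have minus: "free_algebra_act V (p - q) v = free_algebra_act V p v \<ominus>\<^bsub>V\<^esub> free_algebra_act V q v"
      if "L.ncpoly p" "L.ncpoly q" "v \<in> carrier V" for p q v
      using free_algebra_act_plus[of p "- q" v] that
          by (simp add: free_algebra_act_uminus V.minus_eq)
    have "free_algebra_act V r v = \<zero>\<^bsub>V\<^esub>" if v: "v \<in> carrier V" for v
      using r unfolding uea_relators_def
    proof (elim UnE CollectE exE conjE)
      fix x y assume "r = Poly_Mapping.single [x \<oplus>\<^bsub>L\<^esub> y] 1 - Poly_Mapping.single [x] 1 -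
          Poly_Mapping.single [y] 1"
        "x \<in> carrier L" "y \<in> carrier L"
      then show ?thesis using v
        by (simp add: minus keys_word_diff free_algebra_act_single act_closed act_add_left
            smult_one)
           (simp add: V.minus_eq act_closed V.a_assoc flip: V.minus_add, simp add: act_closed
               V.r_neg flip: V.a_assoc)
    next
      fix c x assume "r = Poly_Mapping.single [c \<odot>\<^bsub>L\<^esub> x] 1 - Poly_Mapping.single [x] c"
          "x \<in> carrier L"
      then show ?thesis using v L.smult_closed[of c x]
        by (simp add: minus free_algebra_act_single act_closed act_smult_left V.smult_closed
            V.r_neg V.minus_eq smult_one)
    next
      fix x y assume "r = Poly_Mapping.single [x, y] 1 - Poly_Mapping.single [y, x] 1 -
          Poly_Mapping.single [lie_bracket L x y] 1"
        "x \<in> carrier L" "y \<in> carrier L"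
      then show ?thesis using v
        by (simp add: minus keys_word_diff free_algebra_act_single act_closed act_lie_bracket
            L.lie_bracket_closed
            V.r_neg V.minus_eq smult_one)
    qed
    then show "r \<in> ?I" using keys by simp
  qed
  ultimately have "uea_ideal L \<subseteq> ?I" by (rule L.uea_ideal_minimal)
  then show ?thesis using assms by blast
qed

text \<open>
  Hence the representative chosen in the definition of the action is irrelevant.
\<close>
lemma uea_act_class:
  assumes "L.ncpoly p" "v \<in> carrier V"
  shows "uea_act V (uea_class L p) v = free_algebra_act V p v"
proof -
  define q where "q = (SOME q. q \<in> uea_class L p)"
  have "p \<in> uea_class L p" by (simp add: L.mem_uea_class L.uea_ideal_closed(1))
  then have "q \<in> uea_class L p" unfolding q_def by (rule someI)
  then have I: "q - p \<in> uea_ideal L" by (simp add: L.mem_uea_class)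
  then have "free_algebra_act V ((q - p) + p) v = \<zero>\<^bsub>V\<^esub> \<oplus>\<^bsub>V\<^esub> free_algebra_act V p v"
    using assms L.uea_ideal_closed(7) by (subst free_algebra_act_plus)
        (auto simp: uea_ideal_acts_zero)
  then show ?thesis using assms by (simp add: uea_act_def free_algebra_act_closed flip: q_def)
qed

end

section \<open>The induced module\<close>

locale lie_induction = G: lie_algebra G + lie_module H V
  for G H :: "'g lie_algebra" and V :: "('g, 'v) lie_module" +
  assumes sub: "carrier H \<subseteq> carrier G"
    and ops: "ring.add H = ring.add G" "module.smult H = module.smult G" "lie_bracket H
        = lie_bracket G"
begin

abbreviation "GW \<equiv> lists (carrier G)"
abbreviation "HW \<equiv> lists (carrier H)"

lemma HW_GW: "L.ncpoly p \<Longrightarrow> G.ncpoly p"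
  using lists_mono[OF sub] by blast

text \<open>
  This makes \<open>U(H) \<rightarrow> U(G)\<close> well defined on classes.
\<close>
lemma uea_ideal_mono: "uea_ideal H \<subseteq> uea_ideal G"
proof -
  let ?I = "uea_ideal G \<inter> carrier (free_algebra (carrier H))"
  interpret F: ring "free_algebra (carrier H)" by (rule ring_free_algebra)
  have "ideal ?I (free_algebra (carrier H))"
  proof (rule idealI[OF ring_free_algebra])
    show "subgroup ?I (add_monoid (free_algebra (carrier H)))"
    proof (rule F.add.subgroupI)
      show "\<ominus>\<^bsub>free_algebra (carrier H)\<^esub> a \<in> ?I" if "a \<in> ?I" for a
      proof -
        have "\<ominus>\<^bsub>free_algebra (carrier H)\<^esub> a = - a"
          using that by (intro F.minus_equality) auto
        then show ?thesis using that G.uea_ideal_closed(3) by simp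
      qed
    qed (auto simp: keys_word_add intro!: exI[of _ 0] G.uea_ideal_closed(1,2))
  next
    fix a x assume "a \<in> ?I" "x \<in> carrier (free_algebra (carrier H))"
    then have a: "a \<in> uea_ideal G" "L.ncpoly a" and x: "L.ncpoly x"
      by (simp_all only: Int_iff free_algebra_simps)
    show "x \<otimes>\<^bsub>free_algebra (carrier H)\<^esub> a \<in> ?I" "a \<otimes>\<^bsub>free_algebra (carrier H)\<^esub> x \<in> ?I"
      using G.uea_ideal_closed(5,6)[OF a(1) HW_GW[OF x]] keys_word_mult[OF a(2) x]
          keys_word_mult[OF x a(2)]
      by (simp_all only: Int_iff free_algebra_simps)
  qed
  moreover have "uea_relators H \<subseteq> ?I"
  proof (rule Int_greatest)
    show "uea_relators H \<subseteq> carrier (free_algebra (carrier H))" by (rule L.uea_relators_carrier)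
    have "uea_relators H \<subseteq> uea_relators G"
      unfolding uea_relators_def ops using sub by blast
    then show "uea_relators H \<subseteq> uea_ideal G" using G.uea_relators_ideal by blast
  qed
  ultimately show ?thesis using L.uea_ideal_minimal by blast
qed

lemma uea_incl_class: "uea_incl G (uea_class H p) = uea_class G p"
proof -
  have "uea_class G q = uea_class G p" if "q \<in> uea_class H p" for q
    using that uea_ideal_mono by (auto simp: L.mem_uea_class G.uea_class_eq)
  moreover have "p \<in> uea_class H p" by (simp add: L.mem_uea_class L.uea_ideal_closed(1))
  ultimately show ?thesis unfolding uea_incl_def by blast
qed

definition right_mult :: "'g uea \<Rightarrow> 'g uea \<Rightarrow> 'g uea"
  where "right_mult a s = a \<otimes>\<^bsub>uea G\<^esub> uea_incl G s"

definition FA where "FA = free_Abelian_group (carrier (uea G) \<times> carrier V)"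

definition relators where "relators = tensor_relators (uea H) (uea G) right_mult V (uea_act V)"

definition tensor_ker where "tensor_ker = tensor_kernel (uea H) (uea G) right_mult V (uea_act V)"

definition coset where "coset x = tensor_ker #>\<^bsub>FA\<^esub> x"

lemma tensor_ker_eq: "tensor_ker = generate FA relators"
  by (simp add: tensor_ker_def tensor_kernel_def FA_def relators_def)

lemma class_closed: "G.ncpoly p \<Longrightarrow> uea_class G p \<in> carrier (uea G)"
  unfolding G.carrier_uea by blast

lemma right_mult_class: "G.ncpoly p \<Longrightarrow> L.ncpoly q \<Longrightarrow>
  right_mult (uea_class G p) (uea_class H q) = uea_class G (p * q)"
  by (simp add: right_mult_def uea_incl_class G.uea_class_mult HW_GW)

lemma uea_add_closed: "a \<in> carrier (uea G) \<Longrightarrow> b \<in> carrier (uea G) \<Longrightarrow> a \<oplus>\<^bsub>uea G\<^esub> b \<in> carrier (uea G)"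
  unfolding G.carrier_uea by (metis G.uea_class_add keys_word_add)

lemma relators_carrier: "relators \<subseteq> carrier FA"
proof
  fix x assume "x \<in> relators"
  then show "x \<in> carrier FA"
    unfolding relators_def tensor_relators_def
  proof (elim UnE CollectE exE conjE)
    fix a b v
    assume "x = frag_of (a \<oplus>\<^bsub>uea G\<^esub> b, v) - frag_of (a, v) - frag_of (b, v)"
      "a \<in> carrier (uea G)" "b \<in> carrier (uea G)" "v \<in> carrier V"
    then show ?thesis by (auto simp: FA_def uea_add_closed dest!: subsetD[OF keys_diff])
  next
    fix a v w
    assume "x = frag_of (a, v \<oplus>\<^bsub>V\<^esub> w) - frag_of (a, v) - frag_of (a, w)"
      "a \<in> carrier (uea G)" "v \<in> carrier V" "w \<in> carrier V"
    then show ?thesis by (auto simp: FA_def dest!: subsetD[OF keys_diff])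
  next
    fix a r v
    assume x: "x = frag_of (right_mult a r, v) - frag_of (a, uea_act V r v)"
      and a: "a \<in> carrier (uea G)" and r: "r \<in> carrier (uea H)" and v: "v \<in> carrier V"
    obtain p q where "G.ncpoly p" "a = uea_class G p" "L.ncpoly q" "r = uea_class H q"
      using a r unfolding G.carrier_uea L.carrier_uea by blast
    then have "right_mult a r \<in> carrier (uea G)" "uea_act V r v \<in> carrier V"
      using v by (simp_all add: right_mult_class uea_act_class free_algebra_act_closed
          class_closed keys_word_mult HW_GW)
    then show ?thesis using x a v by (auto simp: FA_def dest!: subsetD[OF keys_diff])
  qed
qed

lemma relators_intros:
  "a \<in> carrier (uea G) \<Longrightarrow> b \<in> carrier (uea G) \<Longrightarrow> v \<in> carrier V \<Longrightarrow>
    frag_of (a \<oplus>\<^bsub>uea G\<^esub> b, v) - frag_of (a, v) - frag_of (b, v) \<in> relators"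
  "a \<in> carrier (uea G) \<Longrightarrow> v \<in> carrier V \<Longrightarrow> w \<in> carrier V \<Longrightarrow>
    frag_of (a, v \<oplus>\<^bsub>V\<^esub> w) - frag_of (a, v) - frag_of (a, w) \<in> relators"
  "a \<in> carrier (uea G) \<Longrightarrow> r \<in> carrier (uea H) \<Longrightarrow> v \<in> carrier V \<Longrightarrow>
    frag_of (right_mult a r, v) - frag_of (a, uea_act V r v) \<in> relators"
  unfolding relators_def tensor_relators_def by blast+

lemma FA_comm_group: "comm_group FA" "group FA"
  unfolding FA_def by (rule abelian_free_Abelian_group, rule group_free_Abelian_group)

lemma FA_simps [simp]:
  "x \<otimes>\<^bsub>FA\<^esub> y = x + y" "\<one>\<^bsub>FA\<^esub> = 0"
  "x \<in> carrier FA \<longleftrightarrow> Poly_Mapping.keys x \<subseteq> carrier (uea G) \<times> carrier V"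
  by (simp_all add: FA_def)

lemma tensor_ker_subgroup: "subgroup tensor_ker FA"
  unfolding tensor_ker_eq by (rule group.generate_is_subgroup[OF FA_comm_group(2) relators_carrier])

lemma tensor_ker_closed:
  "0 \<in> tensor_ker" "x \<in> tensor_ker \<Longrightarrow> y \<in> tensor_ker \<Longrightarrow> x + y \<in> tensor_ker" "x \<in> tensor_ker
      \<Longrightarrow> - x \<in> tensor_ker"
  "x \<in> tensor_ker \<Longrightarrow> y \<in> tensor_ker \<Longrightarrow> x - y \<in> tensor_ker" "x \<in> tensor_ker \<Longrightarrow> x \<in> carrier FA"
proof -
  show "0 \<in> tensor_ker" using subgroup.one_closed[OF tensor_ker_subgroup] by simp
  show add: "x \<in> tensor_ker \<Longrightarrow> y \<in> tensor_ker \<Longrightarrow> x + y \<in> tensor_ker" for x y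
    using subgroup.m_closed[OF tensor_ker_subgroup, of x y] by simp
  show carr: "x \<in> tensor_ker \<Longrightarrow> x \<in> carrier FA" for x
    using subgroup.mem_carrier[OF tensor_ker_subgroup] .
  show neg: "x \<in> tensor_ker \<Longrightarrow> - x \<in> tensor_ker" for x
    using subgroup.m_inv_closed[OF tensor_ker_subgroup, of x] carr[of x] by (simp add: FA_def)
  show "x \<in> tensor_ker \<Longrightarrow> y \<in> tensor_ker \<Longrightarrow> x - y \<in> tensor_ker" for x y
    using add[of x "- y"] neg[of y] by simp
qed

lemma mem_coset: "y \<in> coset x \<longleftrightarrow> y - x \<in> tensor_ker"
  by (auto simp: coset_def r_coset_def intro: bexI[of _ "y - x"])

lemma coset_eq: "coset x = coset y \<longleftrightarrow> x - y \<in> tensor_ker"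
proof
  assume "coset x = coset y"
  then show "x - y \<in> tensor_ker" using mem_coset[of x x] mem_coset[of x y] tensor_ker_closed(1)
      by simp
next
  assume xy: "x - y \<in> tensor_ker"
  have "z - x \<in> tensor_ker \<longleftrightarrow> z - y \<in> tensor_ker" for z
    using tensor_ker_closed(2)[OF _ xy, of "z - x"] tensor_ker_closed(4)[OF _ xy, of "z - y"]
        by auto
  then show "coset x = coset y" by (auto simp: mem_coset)
qed

lemma coset_add: "coset x <#>\<^bsub>FA\<^esub> coset y = coset (x + y)"
proof (rule Set.set_eqI)
  fix z
  have "z \<in> coset x <#>\<^bsub>FA\<^esub> coset y \<longleftrightarrow> (\<exists>a b. a - x \<in> tensor_ker \<and> b - y \<in> tensor_ker \<and> z = a + b)"
    by (simp add: set_mult_def Bex_def mem_coset)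
  also have "\<dots> \<longleftrightarrow> z - (x + y) \<in> tensor_ker"
  proof
    assume "\<exists>a b. a - x \<in> tensor_ker \<and> b - y \<in> tensor_ker \<and> z = a + b"
    then obtain a b where "a - x \<in> tensor_ker" "b - y \<in> tensor_ker" "z = a + b" by blast
    then show "z - (x + y) \<in> tensor_ker" using tensor_ker_closed(2)[of "a - x" "b - y"]
        by (simp add: algebra_simps)
  next
    assume "z - (x + y) \<in> tensor_ker"
    then show "\<exists>a b. a - x \<in> tensor_ker \<and> b - y \<in> tensor_ker \<and> z = a + b"
      using tensor_ker_closed(1) by (intro exI[of _ "z - y"] exI[of _ y]) (simp add: algebra_simps)
  qed
  finally show "z \<in> coset x <#>\<^bsub>FA\<^esub> coset y \<longleftrightarrow> z \<in> coset (x + y)" by (simp add: mem_coset)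
qed

text \<open>
  The effect of left multiplication by the class of \<open>r\<close> on
      formal combinations of pairs, before passing
  to cosets.
\<close>
definition left_extend :: "('g list \<Rightarrow>\<^sub>0 complex) \<Rightarrow> ('g uea \<times> 'v \<Rightarrow>\<^sub>0 int) \<Rightarrow> ('g uea \<times> 'v \<Rightarrow>\<^sub>0 int)"
  where "left_extend r x = frag_extend (\<lambda>(a, v). frag_of (uea_class G r \<otimes>\<^bsub>uea G\<^esub> a, v)) x"

lemma left_extend_closed:
  assumes "G.ncpoly r" "x \<in> carrier FA"
  shows "left_extend r x \<in> carrier FA"
proof -
  have "uea_class G r \<otimes>\<^bsub>uea G\<^esub> a \<in> carrier (uea G)" if a: "a \<in> carrier (uea G)" for a
  proof -
    obtain p where "G.ncpoly p" "a = uea_class G p" using a unfolding G.carrier_uea by blast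
    then show ?thesis using assms(1) by (simp add: G.uea_class_mult class_closed keys_word_mult)
  qed
  moreover have "Poly_Mapping.keys (left_extend r x)
      \<subseteq> (\<Union>y\<in>Poly_Mapping.keys x. Poly_Mapping.keys (case y of (a, v) \<Rightarrow> frag_of (uea_class G r
          \<otimes>\<^bsub>uea G\<^esub> a, v)))"
    unfolding left_extend_def by (rule keys_frag_extend)
  moreover have "Poly_Mapping.keys x \<subseteq> carrier (uea G) \<times> carrier V" using assms(2) by simp
  ultimately show ?thesis by fastforce
qed

lemma left_extend_relators:
  assumes r: "G.ncpoly r" and x: "x \<in> relators"
  shows "left_extend r x \<in> relators"
proof -
  have mult: "\<exists>p. G.ncpoly p \<and> a = uea_class G p \<and> uea_class G r \<otimes>\<^bsub>uea G\<^esub> a = uea_class G (r * p)"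
    if a: "a \<in> carrier (uea G)" for a
    using a r G.uea_class_mult unfolding G.carrier_uea by blast
  from x[unfolded relators_def tensor_relators_def] show ?thesis
  proof (elim UnE CollectE exE conjE)
    fix a b v
    assume *: "x = frag_of (a \<oplus>\<^bsub>uea G\<^esub> b, v) - frag_of (a, v) - frag_of (b, v)"
      "a \<in> carrier (uea G)" "b \<in> carrier (uea G)" "v \<in> carrier V"
    obtain p q where p: "G.ncpoly p" "a = uea_class G p" "G.ncpoly q" "b = uea_class G q"
      using mult[OF *(2)] mult[OF *(3)] by blast
    then have "left_extend r x = frag_of (uea_class G (r * p) \<oplus>\<^bsub>uea G\<^esub> uea_class G (r * q), v)
        - frag_of (uea_class G (r * p), v) - frag_of (uea_class G (r * q), v)"
      using r by (simp add: *(1) left_extend_def frag_extend_diff G.uea_class_mult G.uea_class_add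
          keys_word_add keys_word_mult distrib_left)
    then show ?thesis
      by (simp only:) (intro relators_intros class_closed keys_word_mult r p *(4))
  next
    fix a v w
    assume *: "x = frag_of (a, v \<oplus>\<^bsub>V\<^esub> w) - frag_of (a, v) - frag_of (a, w)"
      "a \<in> carrier (uea G)" "v \<in> carrier V" "w \<in> carrier V"
    obtain p where p: "G.ncpoly p" "uea_class G r \<otimes>\<^bsub>uea G\<^esub> a = uea_class G (r * p)"
      using mult[OF *(2)] by blast
    then have "left_extend r x = frag_of (uea_class G (r * p), v \<oplus>\<^bsub>V\<^esub> w)
        - frag_of (uea_class G (r * p), v) - frag_of (uea_class G (r * p), w)"
      by (simp add: *(1) left_extend_def frag_extend_diff)
    then show ?thesis
      by (simp only:) (intro relators_intros class_closed keys_word_mult r p *(3,4))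
  next
    fix a s v
    assume *: "x = frag_of (right_mult a s, v) - frag_of (a, uea_act V s v)"
      "a \<in> carrier (uea G)" "s \<in> carrier (uea H)" "v \<in> carrier V"
    obtain p q where p: "G.ncpoly p" "a = uea_class G p" "L.ncpoly q" "s = uea_class H q"
      using mult[OF *(2)] *(3) unfolding L.carrier_uea by blast
    then have "left_extend r x = frag_of (right_mult (uea_class G (r * p)) s, v)
        - frag_of (uea_class G (r * p), uea_act V s v)"
      using r by (simp add: *(1) left_extend_def frag_extend_diff right_mult_class G.uea_class_mult
          keys_word_mult HW_GW mult.assoc)
    then show ?thesis
      by (simp only:) (intro relators_intros class_closed keys_word_mult r p *(3,4))
  qed
qed

lemma left_extend_kernel:
  assumes r: "G.ncpoly r" and x: "x \<in> tensor_ker"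
  shows "left_extend r x \<in> tensor_ker"
  using x unfolding tensor_ker_eq
proof (induction rule: generate.induct)
  case one
  show ?case using generate.one[of FA relators] by (simp add: left_extend_def)
next
  case (incl h)
  then show ?case by (intro generate.incl left_extend_relators r)
next
  case (inv h)
  then have "h \<in> tensor_ker" unfolding tensor_ker_eq by (rule generate.incl)
  then have "inv\<^bsub>FA\<^esub> h = - h" using tensor_ker_closed(5) by (simp add: FA_def)
  moreover have "left_extend r h \<in> tensor_ker" unfolding tensor_ker_eq using inv
      by (intro generate.incl left_extend_relators r)
  ultimately show ?case
    using tensor_ker_closed(3) by (simp add: left_extend_def frag_extend_minus flip: tensor_ker_eq)
next
  case (eng h1 h2)
  then show ?case using generate.eng[of _ FA relators]
    by (simp add: left_extend_def frag_extend_add)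
qed

abbreviation "Ind \<equiv> induced_module G H V"

text \<open>
  Both the scalars and the elements of \<open>G\<close> act on the induced module as some \<open>left_mult r\<close>. This
      is additive
  and multiplicative in \<open>r\<close> and depends only on the class of \<open>r\<close>, so the module axioms reduce to
  congruences in the free algebra.
\<close>
definition left_mult where "left_mult r = tensor_map_left (uea H) (uea G) right_mult V (uea_act V)
    (\<lambda>a. uea_class G r \<otimes>\<^bsub>uea G\<^esub> a)"

lemma left_mult_coset:
  assumes r: "G.ncpoly r"
  shows "left_mult r (coset x) = coset (left_extend r x)"
proof -
  have "left_mult r (coset x) = (\<Union>y\<in>coset x. coset (left_extend r y))"
    by (simp add: left_mult_def tensor_map_left_def coset_def tensor_ker_def FA_def left_extend_def)
  moreover have "coset (left_extend r y) = coset (left_extend r x)" if "y \<in> coset x" for y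
    using left_extend_kernel[OF r, of "y - x"] that
    by (simp add: mem_coset coset_eq left_extend_def frag_extend_diff)
  moreover have "x \<in> coset x" by (simp add: mem_coset tensor_ker_closed(1))
  ultimately show ?thesis by blast
qed

lemma Ind_simps:
  "carrier Ind = coset ` carrier FA" "ring.add Ind = (\<lambda>S T. S <#>\<^bsub>FA\<^esub> T)" "\<zero>\<^bsub>Ind\<^esub> = coset 0"
  "module.smult Ind c = left_mult (Poly_Mapping.single [] c)" "act Ind x
      = left_mult (Poly_Mapping.single [x] 1)"
proof -
  have [simp]: "(\<lambda>a s. a \<otimes>\<^bsub>uea G\<^esub> uea_incl G s) = right_mult"
      by (simp add: right_mult_def fun_eq_iff)
  have "coset 0 = tensor_ker" by (auto simp: mem_coset)
  then show "\<zero>\<^bsub>Ind\<^esub> = coset 0"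
    by (simp add: induced_module_def Let_def tensor_product_def tensor_ker_def)
  show "carrier Ind = coset ` carrier FA" "ring.add Ind = (\<lambda>S T. S <#>\<^bsub>FA\<^esub> T)"
    by (simp_all add: induced_module_def Let_def tensor_product_def carrier_FactGroup
        coset_def[abs_def] tensor_ker_def FA_def)
  show "module.smult Ind c = left_mult (Poly_Mapping.single [] c)" "act Ind x
      = left_mult (Poly_Mapping.single [x] 1)"
    by (simp_all add: induced_module_def Let_def left_mult_def[abs_def] uea_scalar_def uea_gen_def)
qed

lemma Ind_add_coset: "coset x \<oplus>\<^bsub>Ind\<^esub> coset y = coset (x + y)"
  by (simp add: Ind_simps coset_add)

lemma Ind_abelian_group: "abelian_group Ind"
proof (rule abelian_groupI)
  have closed: "x + y \<in> carrier FA" "- x \<in> carrier FA" "0 \<in> carrier FA"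
    if "x \<in> carrier FA" "y \<in> carrier FA" for x y
    using that keys_add[of x y] by auto
  show "\<zero>\<^bsub>Ind\<^esub> \<in> carrier Ind" unfolding Ind_simps(1,3) by (rule imageI) simp
  fix S assume S: "S \<in> carrier Ind"
  then obtain x where x: "x \<in> carrier FA" "S = coset x" unfolding Ind_simps by blast
  show "\<zero>\<^bsub>Ind\<^esub> \<oplus>\<^bsub>Ind\<^esub> S = S" by (simp add: x Ind_simps coset_add)
  show "\<exists>T\<in>carrier Ind. T \<oplus>\<^bsub>Ind\<^esub> S = \<zero>\<^bsub>Ind\<^esub>"
    unfolding Ind_simps x(2) using closed(2)[OF x(1) x(1)] by (intro bexI[of _ "coset (- x)"])
        (auto simp: coset_add)
  fix T assume "T \<in> carrier Ind"
  then obtain y where y: "y \<in> carrier FA" "T = coset y" unfolding Ind_simps by blast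
  show "S \<oplus>\<^bsub>Ind\<^esub> T \<in> carrier Ind" unfolding Ind_simps x(2) y(2) coset_add
      using closed(1)[OF x(1) y(1)] by blast
  show "S \<oplus>\<^bsub>Ind\<^esub> T = T \<oplus>\<^bsub>Ind\<^esub> S" by (simp add: x y Ind_simps coset_add add.commute)
  fix U assume "U \<in> carrier Ind"
  then obtain z where z: "z \<in> carrier FA" "U = coset z" unfolding Ind_simps by blast
  show "S \<oplus>\<^bsub>Ind\<^esub> T \<oplus>\<^bsub>Ind\<^esub> U = S \<oplus>\<^bsub>Ind\<^esub> (T \<oplus>\<^bsub>Ind\<^esub> U)"
    by (simp add: x y z Ind_simps coset_add add.assoc)
qed

definition tens :: "('g list \<Rightarrow>\<^sub>0 complex) \<Rightarrow> 'v \<Rightarrow> ('g uea \<times> 'v \<Rightarrow>\<^sub>0 int) set"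
  where "tens p v = coset (frag_of (uea_class G p, v))"

lemma tens_closed: "G.ncpoly p \<Longrightarrow> v \<in> carrier V \<Longrightarrow> tens p v \<in> carrier Ind"
  unfolding tens_def Ind_simps by (rule imageI) (simp add: class_closed)

lemma relators_kernel: "x \<in> relators \<Longrightarrow> x \<in> tensor_ker"
  unfolding tensor_ker_eq by (rule generate.incl)

lemma tens_add_left:
  assumes "G.ncpoly p" "G.ncpoly q" "v \<in> carrier V"
  shows "tens (p + q) v = tens p v \<oplus>\<^bsub>Ind\<^esub> tens q v"
proof -
  have "frag_of (uea_class G p \<oplus>\<^bsub>uea G\<^esub> uea_class G q, v) - frag_of (uea_class G p, v) - frag_of
      (uea_class G q, v) \<in> relators"
    using class_closed assms by (intro relators_intros)
  then show ?thesis using relators_kernel assms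
    by (simp add: tens_def Ind_add_coset coset_eq G.uea_class_add diff_diff_eq)
qed

lemma tens_add_right:
  assumes "G.ncpoly p" "v \<in> carrier V" "w \<in> carrier V"
  shows "tens p (v \<oplus>\<^bsub>V\<^esub> w) = tens p v \<oplus>\<^bsub>Ind\<^esub> tens p w"
proof -
  have "frag_of (uea_class G p, v \<oplus>\<^bsub>V\<^esub> w) - frag_of (uea_class G p, v) - frag_of (uea_class G p,
      w) \<in> relators"
    using class_closed assms by (intro relators_intros)
  then show ?thesis using relators_kernel
    by (simp add: tens_def Ind_add_coset coset_eq diff_diff_eq)
qed

lemma tens_balanced:
  assumes "G.ncpoly p" "L.ncpoly q" "v \<in> carrier V"
  shows "tens (p * q) v = tens p (free_algebra_act V q v)"
proof -
  have "uea_class H q \<in> carrier (uea H)" unfolding L.carrier_uea using assms by blast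
  then have "frag_of (right_mult (uea_class G p) (uea_class H q), v) - frag_of (uea_class G p,
      uea_act V (uea_class H q) v) \<in> relators"
    using class_closed assms by (intro relators_intros)
  then show ?thesis using relators_kernel assms
    by (simp add: tens_def coset_eq right_mult_class uea_act_class)
qed

lemma tens_cong: "p - q \<in> uea_ideal G \<Longrightarrow> tens p v = tens q v"
  unfolding tens_def by (subst G.uea_class_eq[of p q, THEN iffD2]) simp_all

lemma left_mult_tens: "G.ncpoly r \<Longrightarrow> G.ncpoly p \<Longrightarrow> left_mult r (tens p v) = tens (r * p) v"
  by (simp add: tens_def left_mult_coset left_extend_def G.uea_class_mult)

lemma left_mult_closed: "G.ncpoly r \<Longrightarrow> S \<in> carrier Ind \<Longrightarrow> left_mult r S \<in> carrier Ind"
  using left_extend_closed unfolding Ind_simps(1) by (auto simp: left_mult_coset simp del: FA_simps)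

lemma left_mult_add: "G.ncpoly r \<Longrightarrow> S \<in> carrier Ind \<Longrightarrow> T \<in> carrier Ind \<Longrightarrow>
  left_mult r (S \<oplus>\<^bsub>Ind\<^esub> T) = left_mult r S \<oplus>\<^bsub>Ind\<^esub> left_mult r T"
  unfolding Ind_simps(1) by (auto simp: Ind_add_coset left_mult_coset left_extend_def
      frag_extend_add)

lemma tens_zero:
  assumes "v \<in> carrier V"
  shows "tens 0 v = \<zero>\<^bsub>Ind\<^esub>"
proof -
  let ?f = "frag_of (uea_class G 0, v)"
  have "?f - (?f + ?f) \<in> tensor_ker"
    using tens_add_left[of 0 0 v] assms by (simp add: tens_def Ind_add_coset coset_eq)
  then have "?f \<in> tensor_ker" using tensor_ker_closed(3)[of "?f - (?f + ?f)"] by simp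
  then show ?thesis by (simp add: tens_def Ind_simps coset_eq)
qed

lemma tens_minus:
  assumes "G.ncpoly p" "v \<in> carrier V"
  shows "coset (- frag_of (uea_class G p, v)) = tens (- p) v"
proof -
  let ?f = "frag_of (uea_class G p, v)" and ?g = "frag_of (uea_class G (- p), v)"
  have "coset (?g + ?f) = coset 0"
    using tens_add_left[of "- p" p v] tens_zero[OF assms(2)] assms
    by (simp add: tens_def Ind_add_coset Ind_simps(3))
  then have "?g + ?f \<in> tensor_ker" by (simp add: coset_eq)
  then have "- (?g + ?f) \<in> tensor_ker" by (rule tensor_ker_closed(3))
  moreover have "- ?f - ?g = - (?g + ?f)" by simp
  ultimately show ?thesis by (simp only: tens_def coset_eq)
qed

text \<open>
  An inverse of a pure tensor is a pure tensor, so sums of pure tensors suffice.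
\<close>
lemma Ind_induct [consumes 1, case_names zero tens add]:
  assumes "S \<in> carrier Ind"
    and "P \<zero>\<^bsub>Ind\<^esub>" "\<And>p v. G.ncpoly p \<Longrightarrow> v \<in> carrier V \<Longrightarrow> P (tens p v)"
    and "\<And>S T. S \<in> carrier Ind \<Longrightarrow> T \<in> carrier Ind \<Longrightarrow> P S \<Longrightarrow> P T \<Longrightarrow> P (S \<oplus>\<^bsub>Ind\<^esub> T)"
  shows "P S"
proof -
  obtain x where x: "x \<in> carrier FA" "S = coset x" using assms(1) unfolding Ind_simps by blast
  have "P (coset x) \<and> P (coset (- x))"
  proof (rule free_Abelian_group_induct[of x "carrier (uea G) \<times> carrier V" "\<lambda>x. P (coset x)
      \<and> P (coset (- x))"])
    show "P (coset 0) \<and> P (coset (- 0))" using assms(2) by (simp add: Ind_simps)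
  next
    fix x y
    assume xy: "Poly_Mapping.keys x \<subseteq> carrier (uea G) \<times> carrier V"
        "Poly_Mapping.keys y \<subseteq> carrier (uea G) \<times> carrier V"
      and P: "P (coset x) \<and> P (coset (- x))" "P (coset y) \<and> P (coset (- y))"
    have "coset z \<in> carrier Ind" if "z \<in> {x, - x, y, - y}" for z
      using that xy unfolding Ind_simps by (intro imageI) auto
    then show "P (coset (x - y)) \<and> P (coset (- (x - y)))"
      using P assms(4)[of "coset x" "coset (- y)"] assms(4)[of "coset y" "coset (- x)"]
      by (simp add: Ind_add_coset)
  next
    fix a assume "a \<in> carrier (uea G) \<times> carrier V"
    then obtain b v where b: "b \<in> carrier (uea G)" "v \<in> carrier V" "a = (b, v)" by blast
    then obtain p where "G.ncpoly p" "v \<in> carrier V" "a = (uea_class G p, v)"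
      using G.carrier_uea[of b] by blast
    then show "P (coset (frag_of a)) \<and> P (coset (- frag_of a))"
      using assms(3)[of p v] assms(3)[of "- p" v] tens_minus[of p v] by (simp add: tens_def)
  qed (use x(1) in simp)
  then show ?thesis using x by simp
qed

sublocale Ind: abelian_group Ind
  by (rule Ind_abelian_group)

lemma left_mult_zero: "G.ncpoly r \<Longrightarrow> left_mult r \<zero>\<^bsub>Ind\<^esub> = \<zero>\<^bsub>Ind\<^esub>"
  by (simp add: Ind_simps left_mult_coset left_extend_def)

lemma left_mult_cong:
  assumes "G.ncpoly r" "G.ncpoly s" "r - s \<in> uea_ideal G" "S \<in> carrier Ind"
  shows "left_mult r S = left_mult s S"
  using assms(4)
proof (induction rule: Ind_induct)
  case (tens p v)
  have "r * p - s * p \<in> uea_ideal G"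
    using G.uea_ideal_closed(5)[OF assms(3) tens(1)] by (simp add: left_diff_distrib)
  then show ?case using tens assms by (simp add: left_mult_tens tens_cong)
qed (use assms in \<open>simp_all add: left_mult_zero left_mult_add\<close>)

lemma left_mult_plus:
  assumes "G.ncpoly r" "G.ncpoly s" "S \<in> carrier Ind"
  shows "left_mult (r + s) S = left_mult r S \<oplus>\<^bsub>Ind\<^esub> left_mult s S"
  using assms(3)
proof (induction rule: Ind_induct)
  case (tens p v)
  then show ?case using assms by (simp add: left_mult_tens keys_word_add keys_word_mult
      distrib_right tens_add_left)
next
  case (add S T)
  then show ?case using assms
    by (simp add: left_mult_add left_mult_closed keys_word_add Ind.add.m_ac)
qed (use assms in \<open>simp add: left_mult_zero keys_word_add\<close>)

lemma left_mult_mult: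
  assumes "G.ncpoly r" "G.ncpoly s" "S \<in> carrier Ind"
  shows "left_mult (r * s) S = left_mult r (left_mult s S)"
  using assms(3)
proof (induction rule: Ind_induct)
  case (tens p v)
  then show ?case using assms by (simp add: left_mult_tens keys_word_mult mult.assoc)
qed (use assms in \<open>simp_all add: left_mult_zero left_mult_add left_mult_closed keys_word_mult\<close>)

lemma left_mult_one: "S \<in> carrier Ind \<Longrightarrow> left_mult 1 S = S"
proof (induction rule: Ind_induct)
  case (tens p v)
  then show ?case by (subst left_mult_tens) (auto simp: zero_list_def)
next
  case zero
  show ?case by (rule left_mult_zero) (simp add: zero_list_def)
next
  case (add S T)
  then show ?case by (subst left_mult_add) (auto simp: zero_list_def)
qed

lemma single_one_word: "Poly_Mapping.single [] (1::complex) = (1 :: 'x list \<Rightarrow>\<^sub>0 complex)"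
  by (metis single_one zero_list_def)

theorem Ind_lie_module: "lie_module G Ind"
proof -
  have c: "G.ncpoly (Poly_Mapping.single [] c)" for c :: complex
    by simp
  have s: "G.ncpoly (Poly_Mapping.single [x] c)" if "x \<in> carrier G" for x and c :: complex
    using that by simp
  note lm = left_mult_closed left_mult_add
  have module: "Module.module complex_field Ind"
  proof (rule moduleI)
    show "cring complex_field" by (rule cring_from_type_algebra)
    show "abelian_group Ind" by (rule Ind_abelian_group)
    fix a b S assume S: "S \<in> carrier Ind"
    show "a \<odot>\<^bsub>Ind\<^esub> S \<in> carrier Ind" unfolding Ind_simps(4) by (rule left_mult_closed[OF c S])
    show "(a \<oplus>\<^bsub>complex_field\<^esub> b) \<odot>\<^bsub>Ind\<^esub> S = a \<odot>\<^bsub>Ind\<^esub> S \<oplus>\<^bsub>Ind\<^esub> b \<odot>\<^bsub>Ind\<^esub> S"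
      unfolding Ind_simps(4) using left_mult_plus[OF c c S, of a b] by (simp add: single_add)
    show "(a \<otimes>\<^bsub>complex_field\<^esub> b) \<odot>\<^bsub>Ind\<^esub> S = a \<odot>\<^bsub>Ind\<^esub> (b \<odot>\<^bsub>Ind\<^esub> S)"
      unfolding Ind_simps(4) using left_mult_mult[OF c c S, of a b] by (simp add: single_word_mult)
    show "\<one>\<^bsub>complex_field\<^esub> \<odot>\<^bsub>Ind\<^esub> S = S"
      unfolding Ind_simps(4) using left_mult_one[OF S] by (simp add: single_one_word)
    fix T assume T: "T \<in> carrier Ind"
    show "a \<odot>\<^bsub>Ind\<^esub> (S \<oplus>\<^bsub>Ind\<^esub> T) = a \<odot>\<^bsub>Ind\<^esub> S \<oplus>\<^bsub>Ind\<^esub> a \<odot>\<^bsub>Ind\<^esub> T"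
      unfolding Ind_simps(4) by (rule left_mult_add[OF c S T])
  qed
  show ?thesis
  proof (intro lie_module.intro lie_module_axioms.intro module G.lie_algebra_axioms)
    fix x S assume x: "x \<in> carrier G" and S: "S \<in> carrier Ind"
    show "act Ind x S \<in> carrier Ind" unfolding Ind_simps(5) by (rule left_mult_closed[OF s[OF x] S])
    show "act Ind (k \<odot>\<^bsub>G\<^esub> x) S = k \<odot>\<^bsub>Ind\<^esub> act Ind x S" for k
    proof -
      have kx: "k \<odot>\<^bsub>G\<^esub> x \<in> carrier G" using G.smult_closed[of k x] x
          by (simp add: ring_of_type_algebra_def)
      have "Poly_Mapping.single [k \<odot>\<^bsub>G\<^esub> x] 1 - Poly_Mapping.single [x] k \<in> uea_ideal G"
        using x by (intro subsetD[OF G.uea_relators_ideal]) (auto simp: uea_relators_def)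
      from left_mult_cong[OF s[OF kx] s[OF x] this S]
      show ?thesis
        unfolding Ind_simps(4,5) using left_mult_mult[OF c s[OF x] S, of k 1]
            by (simp add: single_word_mult)
    qed
    show "act Ind x (k \<odot>\<^bsub>Ind\<^esub> S) = k \<odot>\<^bsub>Ind\<^esub> act Ind x S" for k
      unfolding Ind_simps(4,5)
      using left_mult_mult[OF c s[OF x] S, of k 1] left_mult_mult[OF s[OF x] c S, of 1 k]
      by (simp add: single_word_mult)
    show "act Ind x (S \<oplus>\<^bsub>Ind\<^esub> T) = act Ind x S \<oplus>\<^bsub>Ind\<^esub> act Ind x T" if "T \<in> carrier Ind" for T
      unfolding Ind_simps(5) by (rule left_mult_add[OF s[OF x] S that])
    fix y assume y: "y \<in> carrier G"
    show "act Ind (x \<oplus>\<^bsub>G\<^esub> y) S = act Ind x S \<oplus>\<^bsub>Ind\<^esub> act Ind y S"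
    proof -
      have xy: "x \<oplus>\<^bsub>G\<^esub> y \<in> carrier G" using x y by simp
      have "Poly_Mapping.single [x \<oplus>\<^bsub>G\<^esub> y] 1 - Poly_Mapping.single [x] 1 - Poly_Mapping.single [y]
          1 \<in> uea_ideal G"
        using x y by (intro subsetD[OF G.uea_relators_ideal]) (auto simp: uea_relators_def)
      then have "Poly_Mapping.single [x \<oplus>\<^bsub>G\<^esub> y] 1 - (Poly_Mapping.single [x] 1 +
          Poly_Mapping.single [y] 1) \<in> uea_ideal G"
        by (simp add: diff_diff_eq)
      from left_mult_cong[OF s[OF xy] keys_word_add[OF s[OF x] s[OF y]] this S]
      show ?thesis unfolding Ind_simps(5) by (simp add: left_mult_plus[OF s[OF x] s[OF y] S])
    qed
    show "act Ind (lie_bracket G x y) S = act Ind x (act Ind y S) \<ominus>\<^bsub>Ind\<^esub> act Ind y (act Ind x S)"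
    proof -
      let ?xy = "lie_bracket G x y"
      have xy: "?xy \<in> carrier G" using x y by (rule G.lie_bracket_closed)
      let ?a = "Poly_Mapping.single [x, y] (1::complex)" and ?b
          = "Poly_Mapping.single [y, x] (1::complex)"
        and ?c = "Poly_Mapping.single [?xy] (1::complex)"
      have "?a - ?b - ?c \<in> uea_ideal G"
        using x y by (intro subsetD[OF G.uea_relators_ideal]) (auto simp: uea_relators_def)
      then have "?a - (?c + ?b) \<in> uea_ideal G" by (simp add: diff_diff_eq add.commute)
      moreover have keys: "G.ncpoly ?a" "G.ncpoly ?b" using x y by auto
      ultimately have "left_mult ?a S = left_mult ?c S \<oplus>\<^bsub>Ind\<^esub> left_mult ?b S"
        using left_mult_cong[OF keys(1) keys_word_add[OF s[OF xy] keys(2)] _ S]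
          left_mult_plus[OF s[OF xy] keys(2) S] by simp
      moreover have "left_mult ?a S = act Ind x (act Ind y S)" "left_mult ?b S
          = act Ind y (act Ind x S)"
        unfolding Ind_simps(5) using left_mult_mult[OF s[OF x] s[OF y] S, of 1 1]
            left_mult_mult[OF s[OF y] s[OF x] S, of 1 1]
        by (simp_all add: single_word_mult)
      moreover have "left_mult ?b S \<in> carrier Ind" "left_mult ?c S \<in> carrier Ind"
        using left_mult_closed[OF keys(2) S] left_mult_closed[OF s[OF xy] S] by auto
      ultimately show ?thesis
        unfolding Ind_simps(5)[of ?xy] by (simp add: Ind.minus_eq Ind.a_assoc Ind.r_neg)
    qed
  qed
qed

definition embed :: "'v \<Rightarrow> ('g uea \<times> 'v \<Rightarrow>\<^sub>0 int) set"
  where "embed v = tens 1 v"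

lemma one_word: "Poly_Mapping.keys (1 :: 'g list \<Rightarrow>\<^sub>0 complex) \<subseteq> lists A"
  by (simp add: zero_list_def)

lemma embed_closed: "v \<in> carrier V \<Longrightarrow> embed v \<in> carrier Ind"
  unfolding embed_def by (rule tens_closed[OF one_word])

lemma embed_add: "v \<in> carrier V \<Longrightarrow> w \<in> carrier V \<Longrightarrow> embed (v \<oplus>\<^bsub>V\<^esub> w) = embed v \<oplus>\<^bsub>Ind\<^esub> embed w"
  unfolding embed_def by (rule tens_add_right[OF one_word])

lemma embed_smult: 
  assumes "v \<in> carrier V"
  shows "embed (c \<odot>\<^bsub>V\<^esub> v) = c \<odot>\<^bsub>Ind\<^esub> embed v"
proof -
  have s: "Poly_Mapping.keys (Poly_Mapping.single [] c) \<subseteq> lists A" for A :: "'g set" by simp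
  have "tens 1 (free_algebra_act V (Poly_Mapping.single [] c) v)
      = tens (1 * Poly_Mapping.single [] c) v"
    using tens_balanced[OF one_word s assms] by simp
  then show ?thesis
    using left_mult_tens[OF s one_word] assms
        by (simp add: embed_def Ind_simps free_algebra_act_single)
qed

lemma embed_act:
  assumes "x \<in> carrier H" "v \<in> carrier V"
  shows "embed (act V x v) = act Ind x (embed v)"
proof -
  have s: "L.ncpoly (Poly_Mapping.single [x] (1::complex))" using assms by simp
  have "tens 1 (free_algebra_act V (Poly_Mapping.single [x] 1) v)
      = tens (1 * Poly_Mapping.single [x] 1) v"
    using tens_balanced[OF one_word s assms(2)] by simp
  then show ?thesis
    using left_mult_tens[OF HW_GW[OF s] one_word] assms
    by (simp add: embed_def Ind_simps free_algebra_act_single smult_one act_closed)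
qed

lemma Ind_generated:
  assumes unit: "\<And>v. v \<in> carrier V \<Longrightarrow> embed v \<in> W"
    and add: "\<And>S T. S \<in> carrier Ind \<Longrightarrow> T \<in> carrier Ind \<Longrightarrow> S \<in> W \<Longrightarrow> T \<in> W \<Longrightarrow> S \<oplus>\<^bsub>Ind\<^esub> T \<in> W"
    and smult: "\<And>c S. S \<in> carrier Ind \<Longrightarrow> S \<in> W \<Longrightarrow> c \<odot>\<^bsub>Ind\<^esub> S \<in> W"
    and act: "\<And>x S. x \<in> carrier G \<Longrightarrow> S \<in> carrier Ind \<Longrightarrow> S \<in> W \<Longrightarrow> act Ind x S \<in> W"
    and nonempty: "carrier V \<noteq> {}"
  shows "carrier Ind \<subseteq> W"
proof
  have word: "tens (Poly_Mapping.single w 1) v \<in> W" if "w \<in> GW" "v \<in> carrier V" for w v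
    using that(1)
  proof (induction w)
    case Nil
    then show ?case using unit[OF that(2)] by (simp add: single_one_word embed_def)
  next
    case (Cons x w)
    have "act Ind x (tens (Poly_Mapping.single w 1) v) = tens (Poly_Mapping.single (x # w) 1) v"
      using Cons.hyps by (simp add: Ind_simps left_mult_tens single_word_mult)
    moreover have "tens (Poly_Mapping.single w 1) v \<in> carrier Ind"
      using Cons.hyps that(2) by (intro tens_closed) auto
    ultimately show ?case using act[OF Cons.hyps(1) _ Cons.IH] by simp
  qed
  obtain v0 where v0: "v0 \<in> carrier V" using nonempty by blast
  have single: "tens (Poly_Mapping.single w c) v \<in> W" if "w \<in> GW" "v \<in> carrier V" for w c v
  proof -
    have "c \<odot>\<^bsub>Ind\<^esub> tens (Poly_Mapping.single w 1) v = tens (Poly_Mapping.single w c) v"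
      using that by (simp add: Ind_simps left_mult_tens single_word_mult)
    moreover have "tens (Poly_Mapping.single w 1) v \<in> carrier Ind" using that
        by (intro tens_closed) auto
    ultimately show ?thesis using smult[OF _ word[OF that]] by metis
  qed
  have zero: "tens 0 v \<in> W" if "v \<in> carrier V" for v
    using single[of "[]" v 0] that by simp
  have tens: "tens p v \<in> W" if "G.ncpoly p" "v \<in> carrier V" for p v
    using that(1)
  proof (induction rule: combination_induct)
    case (add p q)
    then show ?case using that(2) assms(2)[of "tens p v" "tens q v"]
        by (simp add: tens_add_left tens_closed)
  qed (use zero single that(2) in auto)
  fix S assume "S \<in> carrier Ind"
  then show "S \<in> W"
  proof (induction rule: Ind_induct)
    case zero
    show ?case
      using tens_zero[OF v0] tens[of 0 v0] v0 by simp
  qed (use tens add in auto)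
qed

end

section \<open>Straightening words in the basis\<close>

definition lincomb :: "('k \<Rightarrow> complex) \<Rightarrow> ('k \<Rightarrow>\<^sub>0 complex) \<Rightarrow> complex"
  where "lincomb g p = (\<Sum>k\<in>Poly_Mapping.keys p. Poly_Mapping.lookup p k * g k)"

lemma lincomb_superset:
  assumes "finite A" "Poly_Mapping.keys p \<subseteq> A"
  shows "lincomb g p = (\<Sum>k\<in>A. Poly_Mapping.lookup p k * g k)"
  unfolding lincomb_def by (rule sum.mono_neutral_left) (use assms in \<open>auto simp: in_keys_iff\<close>)

lemma lincomb_add: "lincomb g (p + q) = lincomb g p + lincomb g q"
proof -
  let ?A = "Poly_Mapping.keys p \<union> Poly_Mapping.keys q"
  have "Poly_Mapping.keys (p + q) \<subseteq> ?A" by (rule Poly_Mapping.keys_add)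
  then show ?thesis
    by (subst (1 2 3) lincomb_superset[of ?A]) (auto simp: lookup_add ring_distribs sum.distrib)
qed

lemma lincomb_scale: "lincomb g (sv_scale c x) = c * lincomb g x"
  using keys_sv_scale[of c x]
  by (subst (1 2) lincomb_superset[of "Poly_Mapping.keys x"])
      (auto simp: sum_distrib_left mult.assoc)

lemma lincomb_simps [simp]:
  "lincomb g (Poly_Mapping.single k c) = c * g k" "lincomb g 0 = 0"
  by (simp_all add: lincomb_def)

lemma lincomb_minus: "lincomb g (- p) = - lincomb g p" "lincomb g (p - q)
    = lincomb g p - lincomb g q"
proof -
  show minus: "lincomb g (- p) = - lincomb g p" for p
    using lincomb_add[of g p "- p"] by (simp add: add_eq_0_iff)
  show "lincomb g (p - q) = lincomb g p - lincomb g q"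
    using lincomb_add[of g p "- q"] by (simp add: minus)
qed

lemma lincomb_fun:
  "lincomb (\<lambda>k. f k + g k) T = lincomb f T + lincomb g T"
  "lincomb (\<lambda>k. f k - g k) T = lincomb f T - lincomb g T"
  "lincomb (\<lambda>k. c * g k) T = c * lincomb g T"
  by (simp_all add: lincomb_def ring_distribs sum.distrib sum_subtractf sum_distrib_left mult_ac)

lemma lincomb_swap: "lincomb (\<lambda>k. lincomb (\<lambda>l. f k l) q) p = lincomb (\<lambda>l. lincomb (\<lambda>k. f k l) p) q"
  unfolding lincomb_def sum_distrib_left by (subst sum.swap) (simp add: mult_ac)

lemmas lincomb_lin = lincomb_add lincomb_scale lincomb_minus

text \<open>
  The relation \<open>x y - y x = [x, y]\<close> of the enveloping algebra, between fixed words \<open>a\<close> and \<open>c\<close>, as a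
  condition on a functional on words.
\<close>
abbreviation straightens :: "(sv_index list \<Rightarrow> complex) \<Rightarrow> sv_index list \<Rightarrow> sv_index \<Rightarrow> sv_index \<Rightarrow>
    sv_index list \<Rightarrow> bool"
  where "straightens \<Phi> a x y c \<equiv>
    \<Phi> (a @ x # y # c) - \<Phi> (a @ y # x # c) = lincomb (\<lambda>k. \<Phi> (a @ k # c)) (sv_basis_bracket x y)"

locale basis_order =
  fixes key :: "sv_index \<Rightarrow> int"
  assumes inj_key: "inj key"
begin

fun inversions :: "sv_index list \<Rightarrow> nat" where
  "inversions [] = 0"
| "inversions (x # xs) = length (filter (\<lambda>y. key y < key x) xs) + inversions xs"

lemma inversions_swap:
  "key y < key x \<Longrightarrow> inversions (a @ x # y # c) = Suc (inversions (a @ y # x # c))"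
  by (induction a) auto

definition ordered :: "sv_index list \<Rightarrow> bool"
  where "ordered w \<longleftrightarrow> sorted_wrt (\<lambda>x y. key x \<le> key y) w"

lemma ordered_descent: "ordered w \<longleftrightarrow> \<not> (\<exists>a x y c. w = a @ x # y # c \<and> key y < key x)"
proof (induction w)
  case (Cons z w)
  show ?case
  proof
    assume "ordered (z # w)"
    then show "\<not> (\<exists>a x y c. z # w = a @ x # y # c \<and> key y < key x)"
      by (force simp: ordered_def sorted_wrt_append)
  next
    assume none: "\<not> (\<exists>a x y c. z # w = a @ x # y # c \<and> key y < key x)"
    then have "\<not> (\<exists>a x y c. w = a @ x # y # c \<and> key y < key x)"
      by (metis append_Cons)
    then have w: "ordered w" using Cons by simp
    moreover have "key z \<le> key u" if "u \<in> set w" for u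
    proof (cases w)
      case (Cons v w')
      have "key z \<le> key v" using none Cons by (metis append_Nil not_less)
      moreover have "key v \<le> key u" using w that Cons by (auto simp: ordered_def)
      ultimately show ?thesis by simp
    qed (use that in simp)
    ultimately show "ordered (z # w)" by (simp add: ordered_def)
  qed
qed (simp add: ordered_def)

definition descent :: "sv_index list \<Rightarrow> sv_index list \<times> sv_index \<times> sv_index \<times> sv_index list"
  where "descent w = (SOME (a, x, y, c). w = a @ x # y # c \<and> key y < key x)"

lemma descentE:
  assumes "\<not> ordered w"
  obtains a x y c where "descent w = (a, x, y, c)" "w = a @ x # y # c" "key y < key x"
proof -
  have "\<exists>p. (\<lambda>(a, x, y, c). w = a @ x # y # c \<and> key y < key x) p"
    using assms unfolding ordered_descent by auto
  from someI_ex[OF this] show ?thesis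
    using that unfolding descent_def[symmetric] by (auto split: prod.splits)
qed

text \<open>
  Words are rewritten at an arbitrarily chosen descent. Swapping it removes one inversion, and the
  bracket shortens the word.
\<close>
function straighten :: "(sv_index list \<Rightarrow> complex) \<Rightarrow> sv_index list \<Rightarrow> complex" where
  "straighten \<sigma> w = (if ordered w then \<sigma> w else
     (case descent w of (a, x, y, c) \<Rightarrow> straighten \<sigma> (a @ y # x # c)
        + (\<Sum>k\<in>Poly_Mapping.keys (sv_basis_bracket x y).
            Poly_Mapping.lookup (sv_basis_bracket x y) k * straighten \<sigma> (a @ k # c))))"
  by pat_completeness auto
termination
  by (relation "measures [\<lambda>(\<sigma>, w). length w, \<lambda>(\<sigma>, w). inversions w]")
     (simp, (erule descentE, fastforce simp: inversions_swap)+)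

declare straighten.simps [simp del]

lemma word_induct:
  assumes "\<And>w. (\<And>w'. length w' < length w \<or> length w' = length w \<and> inversions w' < inversions w
      \<Longrightarrow> P w') \<Longrightarrow> P w"
  shows "P w"
proof (induction w rule: wf_induct_rule[OF wf_measures[of "[length, inversions]"]])
  case (1 w)
  show ?case by (rule assms) (use 1 in auto)
qed

text \<open>
  The result does not depend on the descent that is rewritten. Two disjoint descents can be
      rewritten
  in either order. If two descents overlap in \<open>x y z\<close>, both ways lead to \<open>z y x\<close>
      and to shorter words whose
  contributions differ by the Jacobi sum of \<open>x\<close>, \<open>y\<close>, \<open>z\<close>.
\<close>
lemma straighten_descent:
  "w = a @ x # y # c \<Longrightarrow> key y < key x \<Longrightarrow> straightens (straighten \<sigma>) a x y c"
proof (induction w arbitrary: a x y c rule: word_induct)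
  case (1 w)
  let ?P = "straighten \<sigma>" and ?b = sv_basis_bracket
  have swap: "straightens ?P a x y c"
    if "length (a @ x # y # c) < length w \<or>
      length (a @ x # y # c) = length w \<and> inversions (a @ x # y # c) < inversions w
          \<and> key y < key x" for a x y c
  proof -
    consider "key y < key x" | "x = y" | "key x < key y" using inj_key by (metis injD less_linear)
    then show ?thesis
    proof cases
      case 1
      then show ?thesis using that "1.IH" by blast
    next
      case 2
      then show ?thesis using sv_bracket_self[of "Poly_Mapping.single y 1"]
          by (simp add: sv_bracket_single)
    next
      case 3
      then have "straightens ?P a y x c" using that by (intro "1.IH"[OF _ refl]) auto
      then show ?thesis using sv_basis_bracket_antisym[of x y]
          by (simp add: lincomb_minus algebra_simps)
    qed
  qed
  define red where "red a x y c = ?P (a @ y # x # c) + lincomb (\<lambda>k. ?P (a @ k # c)) (?b x y)"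
      for a x y c
  have disjoint: "red a x y (m @ x' # y' # c) = red (a @ x # y # m) x' y' c"
    if w: "w = a @ x # y # m @ x' # y' # c" "key y < key x" "key y' < key x'" for a x y m x' y' c
  proof -
    have l: "length w = length a + length m + length c + 4"
      and i: "inversions (a @ y # x # m @ x' # y' # c) < inversions w"
        "inversions (a @ x # y # m @ y' # x' # c) < inversions w"
      using inversions_swap[OF w(2), of a "m @ x' # y' # c"]
          inversions_swap[OF w(3), of "a @ x # y # m" c]
      by (simp_all add: w(1))
    have 1: "straightens ?P (a @ y # x # m) x' y' c" "straightens ?P a x y (m @ y' # x' # c)"
      using i w(2,3) l by (intro swap; simp)+
    have 2: "straightens ?P (a @ k # m) x' y' c" "straightens ?P a x y (m @ k # c)" for k
      using l by (intro swap; simp)+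
    have "lincomb (\<lambda>k. ?P (a @ k # m @ x' # y' # c)) (?b x y)
      = lincomb (\<lambda>k. ?P (a @ k # m @ y' # x' # c)) (?b x y)
       + lincomb (\<lambda>k. lincomb (\<lambda>l. ?P (a @ k # m @ l # c)) (?b x' y')) (?b x y)"
      using 2(1) by (subst lincomb_fun(1)[symmetric]) (simp add: algebra_simps)
    moreover have "lincomb (\<lambda>l. ?P (a @ x # y # m @ l # c)) (?b x' y')
      = lincomb (\<lambda>l. ?P (a @ y # x # m @ l # c)) (?b x' y')
       + lincomb (\<lambda>l. lincomb (\<lambda>k. ?P (a @ k # m @ l # c)) (?b x y)) (?b x' y')"
      using 2(2) by (subst lincomb_fun(1)[symmetric]) (simp add: algebra_simps)
    ultimately show ?thesis
      using 1 lincomb_swap[of "\<lambda>k l. ?P (a @ k # m @ l # c)" "?b x' y'" "?b x y"]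
      by (simp add: red_def algebra_simps)
  qed
  have overlap: "red a x y (z # c) = red (a @ [x]) y z c"
    if w: "w = a @ x # y # z # c" "key y < key x" "key z < key y" for a x y z c
  proof -
    have l: "length w = length a + length c + 3" by (simp add: w(1))
    have i: "inversions w = Suc (inversions (a @ y # x # z # c))" "inversions w
        = Suc (inversions (a @ x # z # y # c))"
      "inversions (a @ y # x # z # c) = Suc (inversions (a @ y # z # x # c))"
      "inversions (a @ x # z # y # c) = Suc (inversions (a @ z # x # y # c))"
      using w(2,3) inversions_swap[of y x a "z # c"] inversions_swap[of z y "a @ [x]" c]
        inversions_swap[of z x "a @ [y]" c] inversions_swap[of z x a "y # c"]
      by (simp_all add: w(1))
    have "straightens ?P (a @ [y]) x z c" "straightens ?P a y z (x # c)"
      "straightens ?P a x z (y # c)" "straightens ?P (a @ [z]) x y c"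
      using i w(2,3) l by (intro swap; simp)+
    then have s: "?P (a @ y # x # z # c) - ?P (a @ y # z # x # c)
        = lincomb (\<lambda>k. ?P (a @ y # k # c)) (?b x z)"
      "?P (a @ y # z # x # c) - ?P (a @ z # y # x # c) = lincomb (\<lambda>k. ?P (a @ k # x # c)) (?b y z)"
      "?P (a @ x # z # y # c) - ?P (a @ z # x # y # c) = lincomb (\<lambda>k. ?P (a @ k # y # c)) (?b x z)"
      "?P (a @ z # x # y # c) - ?P (a @ z # y # x # c) = lincomb (\<lambda>k. ?P (a @ z # k # c)) (?b x y)"
      by simp_all
    have move: "lincomb (\<lambda>k. ?P (a @ k # u # c)) T - lincomb (\<lambda>k. ?P (a @ u # k # c)) T
      = lincomb (\<lambda>k. ?P (a @ k # c)) (sv_bracket T (Poly_Mapping.single u 1))" for T u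
    proof (rule sv_span_induct[of T UNIV])
      show "lincomb (\<lambda>k. ?P (a @ k # u # c)) (Poly_Mapping.single i 1)
          - lincomb (\<lambda>k. ?P (a @ u # k # c)) (Poly_Mapping.single i 1)
        = lincomb (\<lambda>k. ?P (a @ k # c)) (sv_bracket (Poly_Mapping.single i 1) (Poly_Mapping.single
            u 1))" for i
        using swap[of a i u c] l by (simp add: sv_bracket_single)
    qed (simp_all add: lincomb_lin sv_bracket_linear algebra_simps)
    let ?e = "\<lambda>i. Poly_Mapping.single i (1::complex)"
    have "sv_bracket (?b y z) (?e x) + sv_bracket (?b x y) (?e z) - sv_bracket (?b x z) (?e y)
      = - sv_jac (?e x) (?e y) (?e z)"
      unfolding sv_jac_def sv_bracket_single[symmetric]
      using sv_bracket_antisym[of "?e z" "?e x"]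
          sv_bracket_antisym[of "sv_bracket (?e y) (?e z)" "?e x"]
        sv_bracket_antisym[of "sv_bracket (?e x) (?e y)" "?e z"]
            sv_bracket_antisym[of "sv_bracket (?e x) (?e z)" "?e y"]
      by (simp add: sv_bracket_minus)
    then have "lincomb (\<lambda>k. ?P (a @ k # c)) (sv_bracket (?b y z) (?e x))
       + lincomb (\<lambda>k. ?P (a @ k # c)) (sv_bracket (?b x y) (?e z))
       - lincomb (\<lambda>k. ?P (a @ k # c)) (sv_bracket (?b x z) (?e y)) = 0"
      by (simp add: sv_jacobi flip: lincomb_add lincomb_minus)
    then show ?thesis
      using s unfolding move[symmetric] red_def by (simp add: algebra_simps) 
  qed
  have red_eq: "red a x y c = red a' x' y' c'"
    if w: "w = a @ x # y # c" "key y < key x" "w = a' @ x' # y' # c'" "key y' < key x'"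
        "length a \<le> length a'"
    for a x y c a' x' y' c'
  proof -
    have "a @ x # y # c = a' @ x' # y' # c'" using w by simp
    then obtain m where m: "a' = a @ m" "x # y # c = m @ x' # y' # c'"
      using w(5) by (auto simp: append_eq_append_conv2)
    consider "m = []" | "m = [x]" | m' where "m = x # y # m'"
      using m(2) by (cases m; cases "tl m") auto
    then show ?thesis
    proof cases
      case 1
      then show ?thesis using m by simp
    next
      case 2
      then show ?thesis using m w overlap[of a x y y' c'] by simp
    next
      case 3
      then show ?thesis using m w disjoint[of a x y m' x' y' c'] by simp
    qed
  qed
  have "\<not> ordered w" using "1.prems" unfolding ordered_descent by blast
  then obtain a' x' y' c' where d: "descent w = (a', x', y', c')" "w = a' @ x' # y' # c'"
      "key y' < key x'"
    by (rule descentE)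
  have "?P w = red a' x' y' c'"
    using \<open>\<not> ordered w\<close> by (subst straighten.simps) (simp add: d(1) red_def lincomb_def)
  also have "\<dots> = red a x y c"
    using red_eq[OF "1.prems" d(2,3)] red_eq[OF d(2,3) "1.prems"]
        by (cases "length a \<le> length a'") auto
  finally show ?case by (simp add: "1.prems" red_def)
qed

text \<open>
  A form of the Poincare-Birkhoff-Witt theorem: since the values on ordered words are arbitrary, the
  ordered monomials are linearly independent in the enveloping algebra.
\<close>
theorem straightening_exists:
  "\<exists>\<Phi>. (\<forall>w. ordered w \<longrightarrow> \<Phi> w = \<sigma> w) \<and> (\<forall>a x y c. straightens \<Phi> a x y c)"
proof (intro exI[of _ "straighten \<sigma>"] conjI allI impI)
  show "straighten \<sigma> w = \<sigma> w" if "ordered w" for w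
    using that by (subst straighten.simps) simp
  show "straightens (straighten \<sigma>) a x y c" for a x y c
  proof -
    consider "key y < key x" | "x = y" | "key x < key y" using inj_key by (metis injD less_linear)
    then show ?thesis
    proof cases
      case 1
      then show ?thesis using straighten_descent by blast
    next
      case 2
      then show ?thesis using sv_bracket_self[of "Poly_Mapping.single y 1"]
          by (simp add: sv_bracket_single)
    next
      case 3
      then have "straightens (straighten \<sigma>) a y x c" using straighten_descent by blast
      then show ?thesis using sv_basis_bracket_antisym[of x y]
          by (simp add: lincomb_minus algebra_simps)
    qed
  qed
qed

text \<open>
  Ordered words span. The set \<open>S\<close> allows the statement to be used inside a subalgebra.
\<close>
theorem straightening_unique:
  assumes closed: "\<And>x y. x \<in> S \<Longrightarrow> y \<in> S \<Longrightarrow> Poly_Mapping.keys (sv_basis_bracket x y) \<subseteq> S"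
    and f: "\<And>a x y c. set a \<subseteq> S \<Longrightarrow> x \<in> S \<Longrightarrow> y \<in> S \<Longrightarrow> set c \<subseteq> S \<Longrightarrow> straightens f a x y c"
    and g: "\<And>a x y c. set a \<subseteq> S \<Longrightarrow> x \<in> S \<Longrightarrow> y \<in> S \<Longrightarrow> set c \<subseteq> S \<Longrightarrow> straightens g a x y c"
    and eq: "\<And>w. set w \<subseteq> S \<Longrightarrow> ordered w \<Longrightarrow> f w = g w"
  shows "set w \<subseteq> S \<Longrightarrow> f w = g w"
proof (induction w rule: word_induct)
  case (1 w)
  show ?case
  proof (cases "ordered w")
    case False
    then obtain a x y c where w: "w = a @ x # y # c" "key y < key x" unfolding ordered_descent
        by blast
    have S: "set a \<subseteq> S" "x \<in> S" "y \<in> S" "set c \<subseteq> S" using "1.prems" w by auto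
    have "f (a @ y # x # c) = g (a @ y # x # c)"
      using S w by (intro "1.IH") (auto simp: inversions_swap)
    moreover have "f (a @ k # c) = g (a @ k # c)"
        if "k \<in> Poly_Mapping.keys (sv_basis_bracket x y)" for k
      using S w that closed[OF S(2,3)] by (intro "1.IH") auto
    then have "lincomb (\<lambda>k. f (a @ k # c)) (sv_basis_bracket x y)
        = lincomb (\<lambda>k. g (a @ k # c)) (sv_basis_bracket x y)"
      by (simp add: lincomb_def)
    ultimately show ?thesis using f[OF S] g[OF S] unfolding w by (simp add: algebra_simps)
  qed (use eq 1 in auto)
qed

end

section \<open>A functional on the induced module\<close>

text \<open>
  The multilinear extension of a functional from words in the basis to words in arbitrary elements.
\<close>
primrec multilin :: "sv list \<Rightarrow> (sv_index list \<Rightarrow> complex) \<Rightarrow> complex" where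
  "multilin [] = (\<lambda>\<Phi>. \<Phi> [])"
| "multilin (x # xs) = (\<lambda>\<Phi>. lincomb (\<lambda>k. multilin xs (\<lambda>w. \<Phi> (k # w))) x)"

lemma multilin_slot:
  "multilin (xs @ (x + y) # ys) \<Phi> = multilin (xs @ x # ys) \<Phi> + multilin (xs @ y # ys) \<Phi>"
  "multilin (xs @ sv_scale c x # ys) \<Phi> = c * multilin (xs @ x # ys) \<Phi>"
  by (induction xs arbitrary: \<Phi>) (simp_all add: lincomb_lin lincomb_fun)

lemma multilin_fun:
  "multilin xs (\<lambda>w. f w + g w) = multilin xs f + multilin xs g"
  "multilin xs (\<lambda>w. f w - g w) = multilin xs f - multilin xs g"
  "multilin xs (\<lambda>w. c * g w) = c * multilin xs g"
  by (induction xs arbitrary: f g) (simp_all add: lincomb_fun)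

lemma multilin_lincomb: "multilin xs (\<lambda>w. lincomb (\<lambda>m. f m w) b)
    = lincomb (\<lambda>m. multilin xs (f m)) b"
proof (induction xs arbitrary: f)
  case (Cons x xs)
  show ?case by (simp add: Cons.IH[of "\<lambda>m w. f m (k # w)" for k] lincomb_swap[of _ x b])
qed simp

lemma multilin_snoc: "multilin (xs @ [h]) \<Phi> = lincomb (\<lambda>k. multilin xs (\<lambda>w. \<Phi> (w @ [k]))) h"
proof (induction xs arbitrary: \<Phi>)
  case (Cons x xs)
  show ?case by (simp add: Cons.IH lincomb_swap[of _ x h])
qed simp

lemma multilin_swap:
  assumes "\<And>a x y c. straightens \<Phi> a x y c"
  shows "multilin (xs @ x # y # ys) \<Phi> - multilin (xs @ y # x # ys) \<Phi>
      = multilin (xs @ sv_bracket x y # ys) \<Phi>"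
  using assms
proof (induction xs arbitrary: \<Phi>)
  case (Cons z xs)
  have "straightens (\<lambda>w. \<Phi> (k # w)) a x y c" for k a x y c
    using Cons.prems[of "k # a"] by simp
  from Cons.IH[where \<Phi> = "\<lambda>w. \<Phi> (k # w)" for k, OF this]
  show ?case by (simp flip: lincomb_fun(2))
next
  case Nil
  define f where "f k l = multilin ys (\<lambda>w. \<Phi> (k # l # w))" for k l
  define g where "g m = multilin ys (\<lambda>w. \<Phi> (m # w))" for m
  have basis: "f k l - f l k = lincomb g (sv_basis_bracket k l)" for k l
    unfolding f_def g_def multilin_fun(2)[symmetric] multilin_lincomb[symmetric]
    using Nil[of "[]" k l] by simp
  have 1: "lincomb (\<lambda>k. f k l) x - lincomb (\<lambda>k. f l k) x
      = lincomb g (sv_bracket x (Poly_Mapping.single l 1))" for l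
  proof (rule sv_span_induct[of x UNIV])
    show "lincomb (\<lambda>k. f k l) (Poly_Mapping.single i 1) - lincomb (\<lambda>k. f l k) (Poly_Mapping.single
        i 1)
      = lincomb g (sv_bracket (Poly_Mapping.single i 1) (Poly_Mapping.single l 1))" for i
      by (simp add: basis sv_bracket_single)
  qed (simp_all add: lincomb_lin sv_bracket_linear algebra_simps)
  have "lincomb (\<lambda>l. lincomb (\<lambda>k. f k l) x) y - lincomb (\<lambda>l. lincomb (\<lambda>k. f l k) x) y
      = lincomb g (sv_bracket x y)"
  proof (rule sv_span_induct[of y UNIV])
    show "lincomb (\<lambda>l. lincomb (\<lambda>k. f k l) x) (Poly_Mapping.single i 1)
       - lincomb (\<lambda>l. lincomb (\<lambda>k. f l k) x) (Poly_Mapping.single i 1)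
      = lincomb g (sv_bracket x (Poly_Mapping.single i 1))" for i
      by (simp add: 1)
  qed (simp_all add: lincomb_lin sv_bracket_linear algebra_simps)
  then show ?case
    by (simp add: lincomb_swap[of _ y x] flip: f_def g_def) 
qed

instance sv_index :: countable by countable_datatype

lemma SV_sub_simps [simp]:
  "ring.zero (SV_sub d1 d2) = 0" "ring.add (SV_sub d1 d2) = (+)" "module.smult (SV_sub d1 d2)
      = sv_scale"
  "lie_bracket (SV_sub d1 d2) = sv_bracket"
  by (simp_all add: SV_sub_def SV_def)

text \<open>
  A module over the subalgebra with a linear functional \<open>\<phi>\<close>, to be extended to the induced module.
\<close>
locale sv_sub_functional = lie_module "SV_sub d1 d2" V
  for d1 d2 :: nat and V :: "(sv, 'v) lie_module" (structure) +
  fixes \<phi> :: "'v \<Rightarrow> complex"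
  assumes d: "2 * int d2 - 1 \<le> int d1"
    and \<phi>_add: "v \<in> carrier V \<Longrightarrow> w \<in> carrier V \<Longrightarrow> \<phi> (v \<oplus> w) = \<phi> v + \<phi> w"
    and \<phi>_smult: "v \<in> carrier V \<Longrightarrow> \<phi> (c \<odot> v) = c * \<phi> v"
begin

abbreviation "S \<equiv> sv_sub_index d1 d2"
abbreviation "e i \<equiv> Poly_Mapping.single i (1::complex)"

text \<open>
  The generators outside the subalgebra come first, so that an ordered word is a word outside the
  subalgebra followed by a word inside it.
\<close>
definition key :: "sv_index \<Rightarrow> int"
  where "key i = (if i \<in> S then int (to_nat i) else - 1 - int (to_nat i))"

lemma inj_key: "inj key"
  by (rule injI) (auto simp: key_def split: if_splits)

sublocale basis_order key
  by unfold_locales (rule inj_key)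

lemma e_carrier: "i \<in> S \<Longrightarrow> e i \<in> carrier (SV_sub d1 d2)"
  by (simp add: carrier_SV_sub)

abbreviation "acts w v \<equiv> foldr (\<lambda>i. act V (e i)) w v"

lemma acts_closed: "set w \<subseteq> S \<Longrightarrow> v \<in> carrier V \<Longrightarrow> acts w v \<in> carrier V"
  by (induction w) (auto intro: act_closed e_carrier)

lemma acts_add: "set w \<subseteq> S \<Longrightarrow> u \<in> carrier V \<Longrightarrow> v \<in> carrier V \<Longrightarrow> acts w (u \<oplus> v) = acts w u \<oplus> acts w v"
  by (induction w) (auto simp: act_add_right e_carrier acts_closed)

lemma acts_smult: "set w \<subseteq> S \<Longrightarrow> v \<in> carrier V \<Longrightarrow> acts w (c \<odot> v) = c \<odot> acts w v"
  by (induction w) (auto simp: act_smult_right e_carrier acts_closed)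

lemma functional_act:
  assumes add: "\<And>u w. u \<in> carrier V \<Longrightarrow> w \<in> carrier V \<Longrightarrow> f (u \<oplus> w) = f u + f w"
    and smult: "\<And>c u. u \<in> carrier V \<Longrightarrow> f (c \<odot> u) = c * f u"
    and v: "v \<in> carrier V" and x: "x \<in> carrier (SV_sub d1 d2)"
  shows "f (act V x v) = lincomb (\<lambda>k. f (act V (e k) v)) x"
proof -
  let ?P = "\<lambda>x. x \<in> carrier (SV_sub d1 d2) \<and> f (act V x v) = lincomb (\<lambda>k. f (act V (e k) v)) x"
  have "?P x"
  proof (rule sv_span_induct[of x S])
    show "Poly_Mapping.keys x \<subseteq> S" using x by (simp add: carrier_SV_sub)
    have 0: "0 \<in> carrier (SV_sub d1 d2)" by (simp add: carrier_SV_sub)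
    have "f (act V (0 \<odot>\<^bsub>SV_sub d1 d2\<^esub> 0) v) = f (0 \<odot> act V 0 v)"
      by (rule arg_cong[of _ _ f]) (rule act_smult_left[OF 0 v])
    then show "?P 0" using 0 v by (simp add: sv_scale_simps smult act_closed del: smult_zero)
  next
    fix x y assume x: "?P x" and y: "?P y"
    then have "x + y \<in> carrier (SV_sub d1 d2)" using L.add.m_closed[of x y] by simp
    then show "?P (x + y)" using x y act_add_left[of x y v] v
        by (simp add: add act_closed lincomb_add)
  next
    fix c x assume x: "?P x"
    then have "sv_scale c x \<in> carrier (SV_sub d1 d2)"
      using keys_sv_scale[of c x] by (auto simp: carrier_SV_sub)
    then show "?P (sv_scale c x)" using x act_smult_left[of x v c] v
        by (simp add: smult act_closed lincomb_scale)
  qed (simp add: carrier_SV_sub)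
  then show ?thesis by blast
qed

lemma acts_act:
  assumes "set w \<subseteq> S" "v \<in> carrier V" "x \<in> carrier (SV_sub d1 d2)"
  shows "\<phi> (acts w (act V x v)) = lincomb (\<lambda>k. \<phi> (acts (w @ [k]) v)) x"
  using functional_act[of "\<lambda>u. \<phi> (acts w u)", OF _ _ assms(2,3)] assms(1)
  by (simp add: acts_add acts_smult acts_closed \<phi>_add \<phi>_smult)

lemma S_closed: "x \<in> S \<Longrightarrow> y \<in> S \<Longrightarrow> Poly_Mapping.keys (sv_basis_bracket x y) \<subseteq> S"
  using sv_sub_basis_bracket[OF d] by (auto simp: carrier_SV_sub)

lemma acts_straightens:
  assumes "v \<in> carrier V" "set a \<subseteq> S" "x \<in> S" "y \<in> S" "set c \<subseteq> S"
  shows "straightens (\<lambda>w. \<phi> (acts w v)) a x y c"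
proof -
  let ?v = "acts c v"
  have v: "?v \<in> carrier V" using assms by (intro acts_closed)
  have xy: "act V (e x) (act V (e y) ?v) \<in> carrier V" "act V (e y) (act V (e x) ?v) \<in> carrier V"
    using assms v by (auto intro!: act_closed e_carrier)
  have b: "sv_basis_bracket x y \<in> carrier (SV_sub d1 d2)"
    using S_closed assms by (simp add: carrier_SV_sub)
  have bv: "act V (sv_basis_bracket x y) ?v \<in> carrier V" using b v by (rule act_closed)
  have "act V (sv_basis_bracket x y) ?v = act V (e x) (act V (e y) ?v) \<ominus> act V (e y) (act V (e x)
      ?v)"
    using act_lie_bracket[OF e_carrier[OF assms(3)] e_carrier[OF assms(4)] v]
        by (simp add: sv_bracket_single)
  then have "act V (e x) (act V (e y) ?v)
      = act V (e y) (act V (e x) ?v) \<oplus> act V (sv_basis_bracket x y) ?v"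
    using xy by (metis V.a_comm V.add.inv_solve_right' V.minus_eq bv)
  then have "\<phi> (acts a (act V (e x) (act V (e y) ?v)))
    = \<phi> (acts a (act V (e y) (act V (e x) ?v))) + \<phi> (acts a (act V (sv_basis_bracket x y) ?v))"
    using xy bv assms by (simp add: acts_add acts_closed \<phi>_add)
  then show ?thesis using acts_act[OF assms(2) v b] by simp
qed

text \<open>
  Decompose \<open>U(G)\<close> as \<open>U(H)\<close> plus the span of the ordered words with a letter outside \<open>H\<close>. Then
      \<open>pairing v w\<close>
  is \<open>\<phi> (u v)\<close> for the component \<open>u\<close> of \<open>w\<close> in \<open>U(H)\<close>.
\<close>
definition pairing :: "'v \<Rightarrow> sv_index list \<Rightarrow> complex"
  where "pairing v = (SOME \<Phi>. (\<forall>w. ordered w \<longrightarrow> \<Phi> w = (if set w \<subseteq> S then \<phi> (acts w v) else 0)) \<and>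
    (\<forall>a x y c. straightens \<Phi> a x y c))"

lemma pairing_ordered: "ordered w \<Longrightarrow> pairing v w = (if set w \<subseteq> S then \<phi> (acts w v) else 0)"
  and pairing_straightens: "straightens (pairing v) a x y c"
  using someI_ex[OF straightening_exists[of "\<lambda>w. if set w \<subseteq> S then \<phi> (acts w v) else 0"]]
  unfolding pairing_def[symmetric] by blast+

lemma pairing_sub: "v \<in> carrier V \<Longrightarrow> set w \<subseteq> S \<Longrightarrow> pairing v w = \<phi> (acts w v)"
  by (rule straightening_unique[of S "pairing v" "\<lambda>w. \<phi> (acts w v)"])
     (rule S_closed pairing_straightens acts_straightens | assumption | simp add: pairing_ordered)+

text \<open>
  Straightening a word in \<open>S\<close> stays inside \<open>S\<close> and leaves the prefix \<open>p\<close> in place.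
\<close>
lemma pairing_outside:
  assumes "ordered p" "p \<noteq> []" "set p \<inter> S = {}" "set w \<subseteq> S"
  shows "pairing v (p @ w) = 0"
proof (rule straightening_unique[of S "\<lambda>w. pairing v (p @ w)" "\<lambda>_. 0"])
  show "straightens (\<lambda>w. pairing v (p @ w)) a x y c" for a x y c
    using pairing_straightens[of v "p @ a" x y c] by simp
  fix w assume w: "set w \<subseteq> S" "ordered w"
  have "key x \<le> key y" if "x \<in> set p" "y \<in> set w" for x y
    using that assms(3) w(1) by (auto simp: key_def)
  then have "ordered (p @ w)"
    using assms(1) w(2) by (auto simp: ordered_def sorted_wrt_append)
  moreover have "\<not> set (p @ w) \<subseteq> S" using assms(2,3) by (cases p) auto
  ultimately show "pairing v (p @ w) = 0" using pairing_ordered[of "p @ w" v] by (simp only: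
      if_False)
qed (use S_closed assms(4) in \<open>auto simp: lincomb_def\<close>)

text \<open>
  This is what lets the pairing factor over the tensor product: a last letter in the subalgebra
      may be
  moved to the vector. By uniqueness it suffices to look at ordered \<open>w\<close>, although \<open>w @ [h]\<close> need
      not be
  ordered.
\<close>
lemma pairing_snoc:
  assumes "v \<in> carrier V" "h \<in> S"
  shows "pairing v (w @ [h]) = pairing (act V (e h) v) w"
proof (rule straightening_unique[of UNIV "\<lambda>w. pairing v (w @ [h])"])
  show "straightens (\<lambda>w. pairing v (w @ [h])) a x y c" for a x y c
    using pairing_straightens[of v a x y "c @ [h]"] by simp
  show "straightens (pairing (act V (e h) v)) a x y c" for a x y c
    by (rule pairing_straightens)
  fix w assume w: "ordered w"
  have hv: "act V (e h) v \<in> carrier V" using assms by (intro act_closed e_carrier)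
  show "pairing v (w @ [h]) = pairing (act V (e h) v) w"
  proof (cases "set w \<subseteq> S")
    case True
    then show ?thesis using assms hv by (simp add: pairing_sub)
  next
    case False
    let ?p = "takeWhile (\<lambda>i. i \<notin> S) w" and ?q = "dropWhile (\<lambda>i. i \<notin> S) w"
    have "ordered (?p @ ?q)" using w by simp
    then have p: "ordered ?p" and q: "ordered ?q" unfolding ordered_def sorted_wrt_append by blast+
    have qS: "set ?q \<subseteq> S"
    proof (cases ?q)
      case (Cons i r)
      then have "i \<in> S" using hd_dropWhile[of "\<lambda>i. i \<notin> S" w] by simp
      moreover have "key i \<le> key j" if "j \<in> set r" for j using q that unfolding Cons
          by (simp add: ordered_def)
      ultimately show ?thesis unfolding Cons by (force simp: key_def split: if_splits)
    next
      case Nil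
      show ?thesis unfolding Nil by simp
    qed
    then have "?p \<noteq> []" using False by (metis append_Nil takeWhile_dropWhile_id)
    moreover have "set ?p \<inter> S = {}" by (auto dest: set_takeWhileD)
    ultimately have "pairing v (?p @ (?q @ [h])) = 0" using p qS assms(2)
        by (intro pairing_outside) auto
    then have "pairing v (w @ [h]) = 0" by (metis append.assoc takeWhile_dropWhile_id)
    then show ?thesis using False w by (simp add: pairing_ordered)
  qed
qed auto

lemma pairing_add:
  assumes "u \<in> carrier V" "v \<in> carrier V"
  shows "pairing (u \<oplus> v) w = pairing u w + pairing v w"
proof (rule straightening_unique[of UNIV])
  show "straightens (\<lambda>w. pairing u w + pairing v w) a x y c" for a x y c
    using pairing_straightens[of u a x y c] pairing_straightens[of v a x y c]
    by (simp add: lincomb_fun algebra_simps)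
qed (use assms in \<open>auto intro: pairing_straightens
    simp: pairing_ordered acts_add acts_closed \<phi>_add\<close>)

lemma pairing_smult:
  assumes "v \<in> carrier V"
  shows "pairing (c \<odot> v) w = c * pairing v w"
proof (rule straightening_unique[of UNIV])
  show "straightens (\<lambda>w. c * pairing v w) a x y c'" for a x y c'
    using pairing_straightens[of v a x y c']
    by (simp add: lincomb_fun flip: right_diff_distrib)
qed (use assms in \<open>auto intro: pairing_straightens
    simp: pairing_ordered acts_smult acts_closed \<phi>_smult\<close>)

lemma pairing_act:
  assumes "v \<in> carrier V" "x \<in> carrier (SV_sub d1 d2)"
  shows "pairing (act V x v) w = lincomb (\<lambda>k. pairing (act V (e k) v) w) x"
  by (rule functional_act[OF _ _ assms]) (simp_all add: pairing_add pairing_smult)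

definition word_pairing :: "'v \<Rightarrow> sv list \<Rightarrow> complex"
  where "word_pairing v xs = multilin xs (pairing v)"

lemma word_pairing_snoc:
  assumes "v \<in> carrier V" "h \<in> carrier (SV_sub d1 d2)"
  shows "word_pairing v (xs @ [h]) = word_pairing (act V h v) xs"
proof -
  have "word_pairing v (xs @ [h]) = lincomb (\<lambda>k. multilin xs (\<lambda>w. pairing v (w @ [k]))) h"
    by (simp add: word_pairing_def multilin_snoc)
  also have "\<dots> = lincomb (\<lambda>k. multilin xs (pairing (act V (e k) v))) h"
    using assms by (auto simp: lincomb_def pairing_snoc carrier_SV_sub intro!: sum.cong)
  also have "\<dots> = multilin xs (\<lambda>w. lincomb (\<lambda>k. pairing (act V (e k) v) w) h)"
    by (rule multilin_lincomb[symmetric])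
  also have "(\<lambda>w. lincomb (\<lambda>k. pairing (act V (e k) v) w) h) = pairing (act V h v)"
    using pairing_act[OF assms] by auto
  finally show ?thesis by (simp add: word_pairing_def)
qed

lemma word_pairing_slot:
  "word_pairing v (xs @ (x + y) # ys) = word_pairing v (xs @ x # ys) + word_pairing v (xs @ y # ys)"
  "word_pairing v (xs @ sv_scale c x # ys) = c * word_pairing v (xs @ x # ys)"
  "word_pairing v (xs @ x # y # ys) - word_pairing v (xs @ y # x # ys)
      = word_pairing v (xs @ sv_bracket x y # ys)"
  using multilin_swap[of "pairing v" xs x y ys] pairing_straightens
  by (simp_all add: word_pairing_def multilin_slot)

lemma word_pairing_vector:
  "u \<in> carrier V \<Longrightarrow> v \<in> carrier V \<Longrightarrow> word_pairing (u \<oplus> v) xs = word_pairing u xs + word_pairing v xs"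
  "v \<in> carrier V \<Longrightarrow> word_pairing (c \<odot> v) xs = c * word_pairing v xs"
proof -
  show "word_pairing (u \<oplus> v) xs = word_pairing u xs + word_pairing v xs"
      if "u \<in> carrier V" "v \<in> carrier V"
  proof -
    have "pairing (u \<oplus> v) = (\<lambda>w. pairing u w + pairing v w)" using pairing_add[OF that] by auto
    then show ?thesis by (simp add: word_pairing_def multilin_fun)
  qed
  show "word_pairing (c \<odot> v) xs = c * word_pairing v xs" if "v \<in> carrier V"
  proof -
    have "pairing (c \<odot> v) = (\<lambda>w. c * pairing v w)" using pairing_smult[OF that] by auto
    then show ?thesis by (simp add: word_pairing_def multilin_fun)
  qed
qed

lemma word_pairing_Nil: "word_pairing v [] = \<phi> v"
  using pairing_ordered[of "[]" v] by (simp add: word_pairing_def ordered_def)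

end

section \<open>Coordinates on complex vector spaces\<close>

definition fscale :: "complex \<Rightarrow> ('k \<Rightarrow>\<^sub>0 complex) \<Rightarrow> ('k \<Rightarrow>\<^sub>0 complex)"
  where "fscale c p = Poly_Mapping.map ((*) c) p"

lemma lookup_fscale [simp]: "Poly_Mapping.lookup (fscale c p) k = c * Poly_Mapping.lookup p k"
  by (simp add: fscale_def Poly_Mapping.map.rep_eq when_def)

lemma fscale_zero: "fscale c 0 = 0"
  by (rule poly_mapping_eqI) simp

lemma fscale_vector_space: "vector_space fscale"
  by unfold_locales (rule poly_mapping_eqI; simp add: lookup_add algebra_simps)+

text \<open>
  \<open>\<iota>\<close> embeds a vector space given by a carrier into one that fills a type,
      and \<open>ev\<close> is a retraction onto the
  carrier. With \<open>ev\<close>, operators on the carrier extend to the whole type.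
\<close>
locale coordinates =
  fixes V :: "(complex, 'v, 'm) module_scheme" (structure)
    and \<iota> :: "'v \<Rightarrow> ('v \<Rightarrow>\<^sub>0 complex)" and ev :: "('v \<Rightarrow>\<^sub>0 complex) \<Rightarrow> 'v"
  assumes \<iota>_add: "v \<in> carrier V \<Longrightarrow> w \<in> carrier V \<Longrightarrow> \<iota> (v \<oplus> w) = \<iota> v + \<iota> w"
    and \<iota>_smult: "v \<in> carrier V \<Longrightarrow> \<iota> (c \<odot> v) = fscale c (\<iota> v)"
    and ev_closed: "ev p \<in> carrier V"
    and ev_add: "ev (p + q) = ev p \<oplus> ev q"
    and ev_scale: "ev (fscale c p) = c \<odot> ev p"
    and ev_\<iota>: "v \<in> carrier V \<Longrightarrow> ev (\<iota> v) = v"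

text \<open>
  Evaluating formal linear combinations maps the free vector space on the type of \<open>V\<close> onto \<open>V\<close>. The
  projection \<open>\<pi>\<close> along its kernel, obtained by extending a basis of the kernel, sends the formal
  combination of a single vector to its coordinates.
\<close>
lemma complex_module_coordinates:
  fixes V :: "(complex, 'v, 'm) module_scheme"
  assumes "Module.module complex_field V"
  shows "\<exists>\<iota> ev. coordinates V \<iota> ev"
proof -
  interpret V: Module.module complex_field V by fact
  interpret F: vector_space "fscale :: complex \<Rightarrow> ('v \<Rightarrow>\<^sub>0 complex) \<Rightarrow> _" by (rule fscale_vector_space)
  interpret FF: vector_space_pair "fscale :: complex \<Rightarrow> ('v \<Rightarrow>\<^sub>0 complex) \<Rightarrow> _"
      "fscale :: complex \<Rightarrow> ('v \<Rightarrow>\<^sub>0 complex) \<Rightarrow> _" ..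
  have [simp]: "c \<in> carrier complex_field" "a \<oplus>\<^bsub>complex_field\<^esub> b = a + b" "a \<otimes>\<^bsub>complex_field\<^esub> b
      = a * b"
    "\<zero>\<^bsub>complex_field\<^esub> = 0" "\<one>\<^bsub>complex_field\<^esub> = 1" for a b c :: complex
    by (simp_all add: ring_of_type_algebra_def)
  have null: "0 \<odot>\<^bsub>V\<^esub> v = \<zero>\<^bsub>V\<^esub>" if "v \<in> carrier V" for v
    using V.smult_l_null[OF that] by simp
  have l_distr: "(a + b) \<odot>\<^bsub>V\<^esub> v = a \<odot>\<^bsub>V\<^esub> v \<oplus>\<^bsub>V\<^esub> b \<odot>\<^bsub>V\<^esub> v" if "v \<in> carrier V" for a b v
    using V.smult_l_distr[OF _ _ that, of a b] by simp
  define ev where "ev p = finsum V (\<lambda>v. Poly_Mapping.lookup p v \<odot>\<^bsub>V\<^esub> v) (Poly_Mapping.keys p \<inter>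
      carrier V)" for p
  have superset: "ev p = finsum V (\<lambda>v. Poly_Mapping.lookup p v \<odot>\<^bsub>V\<^esub> v) A"
    if "finite A" "A \<subseteq> carrier V" "Poly_Mapping.keys p \<inter> carrier V \<subseteq> A" for A p
    unfolding ev_def
  proof (rule V.add.finprod_mono_neutral_cong_left)
    show "Poly_Mapping.lookup p v \<odot>\<^bsub>V\<^esub> v = \<zero>\<^bsub>V\<^esub>" if "v \<in> A - Poly_Mapping.keys p \<inter> carrier V" for v
    proof -
      have "Poly_Mapping.lookup p v = 0" "v \<in> carrier V" using that \<open>A \<subseteq> carrier V\<close>
          by (auto simp: in_keys_iff)
      then show ?thesis by (simp add: null)
    qed
  qed (use that in \<open>auto intro!: V.smult_closed\<close>)
  have ev_closed: "ev p \<in> carrier V" for p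
    unfolding ev_def by (intro V.finsum_closed) (auto intro!: V.smult_closed)
  have ev_add: "ev (p + q) = ev p \<oplus>\<^bsub>V\<^esub> ev q" for p q
  proof -
    let ?A = "(Poly_Mapping.keys p \<union> Poly_Mapping.keys q) \<inter> carrier V"
    have A: "finite ?A" "?A \<subseteq> carrier V" by auto
    have "ev (p + q) = finsum V (\<lambda>v. Poly_Mapping.lookup (p + q) v \<odot>\<^bsub>V\<^esub> v) ?A"
      using Poly_Mapping.keys_add[of p q] by (intro superset[OF A]) blast
    also have "\<dots> = finsum V (\<lambda>v. Poly_Mapping.lookup p v \<odot>\<^bsub>V\<^esub> v \<oplus>\<^bsub>V\<^esub> Poly_Mapping.lookup q v \<odot>\<^bsub>V\<^esub>
        v) ?A"
      using l_distr by (intro V.finsum_cong') (auto simp: lookup_add intro!: V.smult_closed)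
    also have "\<dots> = finsum V (\<lambda>v. Poly_Mapping.lookup p v \<odot>\<^bsub>V\<^esub> v) ?A \<oplus>\<^bsub>V\<^esub> finsum V (\<lambda>v.
        Poly_Mapping.lookup q v \<odot>\<^bsub>V\<^esub> v) ?A"
      by (intro V.finsum_addf) (auto intro!: V.smult_closed)
    also have "\<dots> = ev p \<oplus>\<^bsub>V\<^esub> ev q"
      using superset[OF A Int_mono[OF Un_upper1 order_refl]]
          superset[OF A Int_mono[OF Un_upper2 order_refl]] by simp
    finally show ?thesis .
  qed
  have ev_single: "ev (Poly_Mapping.single v c) = c \<odot>\<^bsub>V\<^esub> v" if "v \<in> carrier V" for v c
    using that by (subst superset[of "{v}"]) (auto simp: V.smult_closed)
  have ev_zero: "ev 0 = \<zero>\<^bsub>V\<^esub>" by (simp add: ev_def)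
  have ev_scale: "ev (fscale c p) = c \<odot>\<^bsub>V\<^esub> ev p" for c p
  proof -
    have fscale_single: "fscale c (Poly_Mapping.single v a) = Poly_Mapping.single v (c * a)" for v a
      by (rule poly_mapping_eqI) (simp add: lookup_single when_def)
    have out: "ev (Poly_Mapping.single v a) = \<zero>\<^bsub>V\<^esub>" if "v \<notin> carrier V" for v a
      using that by (simp add: ev_def)
    have "Poly_Mapping.keys p \<subseteq> UNIV" by simp
    then show ?thesis
    proof (induction rule: combination_induct)
      case zero
      show ?case by (simp add: ev_zero F.scale_zero_right)
    next
      case (single v a)
      then show ?case using V.smult_assoc1[of c a v] ev_single out
        by (cases "v \<in> carrier V") (simp_all add: fscale_single)
    next
      case (add p q)
      then show ?case by (simp add: F.scale_right_distrib ev_add V.smult_r_distr ev_closed)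
    qed
  qed
  let ?K = "{p. ev p = \<zero>\<^bsub>V\<^esub>}"
  have "F.subspace ?K"
    by (rule F.subspaceI) (simp_all add: ev_zero ev_add ev_scale)
  obtain B where B: "B \<subseteq> ?K" "F.independent B" "?K \<subseteq> F.span B"
    using F.maximal_independent_subset[of ?K] by blast
  define B' where "B' = F.extend_basis B"
  have B': "B \<subseteq> B'" "F.independent B'" "F.span B' = UNIV"
    unfolding B'_def using B(2) by (simp_all add: F.extend_basis_superset
        F.independent_extend_basis)
  obtain \<pi> where \<pi>: "Vector_Spaces.linear fscale fscale \<pi>" "\<forall>b\<in>B'. \<pi> b = (if b \<in> B then 0 else b)"
    using FF.linear_independent_extend[OF B'(2), of "\<lambda>b. if b \<in> B then 0 else b"] by blast
  interpret \<pi>: Vector_Spaces.linear fscale fscale \<pi> by fact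
  have \<pi>_K: "\<pi> p = 0" if "ev p = \<zero>\<^bsub>V\<^esub>" for p
  proof -
    have "F.span B \<subseteq> {p. \<pi> p = 0}"
      by (rule F.span_minimal) (use \<pi>(2) B'(1) in \<open>auto intro!: F.subspaceI
          simp: \<pi>.add \<pi>.scale \<pi>.zero\<close>)
    then show ?thesis using that B(3) by blast
  qed
  have ev_\<pi>: "ev (\<pi> p) = ev p" for p
  proof -
    have "F.span B' \<subseteq> {p. ev (\<pi> p) = ev p}"
    proof (rule F.span_minimal)
      show "B' \<subseteq> {p. ev (\<pi> p) = ev p}" using \<pi>(2) B(1) ev_zero by auto
    qed (auto intro!: F.subspaceI simp: \<pi>.add \<pi>.scale \<pi>.zero ev_add ev_scale)
    then show ?thesis using B'(3) by blast
  qed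
  have \<pi>_cong: "\<pi> p = \<pi> q" if "ev p = ev q" for p q
  proof -
    have "ev (p + fscale (-1) q) = 1 \<odot>\<^bsub>V\<^esub> ev q \<oplus>\<^bsub>V\<^esub> (-1) \<odot>\<^bsub>V\<^esub> ev q"
      unfolding ev_add ev_scale that using V.smult_one[OF ev_closed[of q]] by simp
    also have "\<dots> = (1 + - 1) \<odot>\<^bsub>V\<^esub> ev q" by (rule l_distr[OF ev_closed, symmetric])
    also have "\<dots> = \<zero>\<^bsub>V\<^esub>" using null[OF ev_closed[of q]] by simp
    finally show ?thesis using \<pi>_K[of "p + fscale (-1) q"]
      by (simp add: \<pi>.diff)
  qed
  define \<iota> where "\<iota> v = \<pi> (Poly_Mapping.single v 1)" for v
  have one: "ev (Poly_Mapping.single v 1) = v" if "v \<in> carrier V" for v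
  proof -
    have "ev (Poly_Mapping.single v 1) = 1 \<odot>\<^bsub>V\<^esub> v" by (rule ev_single[OF that])
    also have "\<dots> = v" using V.smult_one[OF that] by (simp add: ring_of_type_algebra_def)
    finally show ?thesis .
  qed
  have "coordinates V \<iota> ev"
  proof
    show "\<iota> (v \<oplus>\<^bsub>V\<^esub> w) = \<iota> v + \<iota> w" if "v \<in> carrier V" "w \<in> carrier V" for v w
      unfolding \<iota>_def \<pi>.add[symmetric] using that by (intro \<pi>_cong) (simp add: ev_add one)
    show "\<iota> (c \<odot>\<^bsub>V\<^esub> v) = fscale c (\<iota> v)" if "v \<in> carrier V" for c v
      unfolding \<iota>_def \<pi>.scale[symmetric] using that by (intro \<pi>_cong)
          (simp add: ev_scale one V.smult_closed)
    show "ev (\<iota> v) = v" if "v \<in> carrier V" for v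
      unfolding \<iota>_def using that by (simp add: ev_\<pi> one)
  qed (use ev_closed ev_add ev_scale in auto)
  then show ?thesis by blast
qed

section \<open>The induced module is nonzero\<close>

lemma (in lie_module) uminus_smult:
  assumes "v \<in> carrier V"
  shows "\<ominus>\<^bsub>V\<^esub> v = (- 1) \<odot>\<^bsub>V\<^esub> v"
proof (rule V.minus_equality)
  have "(- 1 + 1) \<odot>\<^bsub>V\<^esub> v = (- 1) \<odot>\<^bsub>V\<^esub> v \<oplus>\<^bsub>V\<^esub> 1 \<odot>\<^bsub>V\<^esub> v"
    using V.smult_l_distr[of "- 1" 1 v] assms by simp
  then show "(- 1) \<odot>\<^bsub>V\<^esub> v \<oplus>\<^bsub>V\<^esub> v = \<zero>\<^bsub>V\<^esub>" using assms by (simp add: smult_one)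
qed (use assms in \<open>simp_all add: V.smult_closed\<close>)

lemma SV_simps [simp]:
  "carrier SV = UNIV" "ring.add SV = (+)" "ring.zero SV = 0" "module.smult SV = sv_scale"
      "lie_bracket SV = sv_bracket"
  by (simp_all add: SV_def)

locale sv_induction = sv_sub_functional d1 d2 V \<phi> + lie_induction SV "SV_sub d1 d2" V
  for d1 d2 :: nat and V :: "(sv, 'v) lie_module" (structure) and \<phi> :: "'v \<Rightarrow> complex"
begin

definition tensor_pairing :: "(sv list \<Rightarrow>\<^sub>0 complex) \<Rightarrow> 'v \<Rightarrow> complex"
  where "tensor_pairing p v = lincomb (word_pairing v) p"

text \<open>
  The ideal is two-sided, so the inductive statement is about all products \<open>q p r\<close>.
\<close>
lemma tensor_pairing_ideal:
  assumes "p \<in> uea_ideal SV"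
  shows "tensor_pairing p v = 0"
proof -
  let ?f = "lincomb (word_pairing v)"
  let ?I = "{p. \<forall>q r. ?f (q * p * r) = 0}"
  have "ideal ?I (free_algebra (carrier SV))"
  proof (rule idealI[OF ring_free_algebra])
    interpret F: ring "free_algebra (carrier SV)" by (rule ring_free_algebra)
    show "subgroup ?I (add_monoid (free_algebra (carrier SV)))"
    proof (rule F.add.subgroupI)
      show "\<ominus>\<^bsub>free_algebra (carrier SV)\<^esub> a \<in> ?I" if "a \<in> ?I" for a
      proof -
        have "\<ominus>\<^bsub>free_algebra (carrier SV)\<^esub> a = - a" by (intro F.minus_equality) auto
        then show ?thesis using that by (simp add: lincomb_minus)
      qed
    qed (auto simp: distrib_left distrib_right lincomb_add intro!: exI[of _ 0])
    show "x \<otimes>\<^bsub>free_algebra (carrier SV)\<^esub> a \<in> ?I" if "a \<in> ?I" for a x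
    proof -
      have "?f (q * (x * a) * r) = ?f ((q * x) * a * r)" for q r by (simp add: mult.assoc)
      then show ?thesis using that by simp
    qed
    show "a \<otimes>\<^bsub>free_algebra (carrier SV)\<^esub> x \<in> ?I" if "a \<in> ?I" for a x
    proof -
      have "?f (q * (a * x) * r) = ?f (q * a * (x * r))" for q r by (simp add: mult.assoc)
      then show ?thesis using that by simp
    qed
  qed
  moreover have "uea_relators SV \<subseteq> ?I"
  proof
    fix s assume s: "s \<in> uea_relators SV"
    have word: "?f (Poly_Mapping.single a \<alpha> * s * Poly_Mapping.single b \<beta>) = 0" for a b \<alpha> \<beta>
      using s unfolding uea_relators_def
      by (elim UnE CollectE exE conjE)
         (simp_all add: left_diff_distrib right_diff_distrib single_word_mult lincomb_minus
             word_pairing_slot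
           flip: word_pairing_slot(3), simp_all add: algebra_simps)
    have "?f (q * s * r) = 0" for q r
    proof -
      have "Poly_Mapping.keys q \<subseteq> UNIV" by simp
      then show ?thesis
      proof (induction rule: combination_induct)
        case (single a \<alpha>)
        have "Poly_Mapping.keys r \<subseteq> UNIV" by simp
        then show ?case
          by (induction rule: combination_induct) (simp_all add: word distrib_left lincomb_add)
      qed (simp_all add: distrib_right lincomb_add)
    qed
    then show "s \<in> ?I" by simp
  qed
  ultimately have "uea_ideal SV \<subseteq> ?I" by (rule G.uea_ideal_minimal)
  then have "\<forall>q r. ?f (q * p * r) = 0" using assms by blast
  from this[rule_format, of 1 1] show ?thesis by (simp add: tensor_pairing_def)
qed

lemma word_pairing_append: "w \<in> HW \<Longrightarrow> v \<in> carrier V \<Longrightarrow> word_pairing v (u @ w)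
    = word_pairing (foldr (act V) w v) u"
proof (induction w arbitrary: u)
  case (Cons h w)
  have w: "w \<in> HW" and h: "h \<in> carrier (SV_sub d1 d2)" using Cons.prems(1) by simp_all
  have "word_pairing v ((u @ [h]) @ w) = word_pairing (foldr (act V) w v) (u @ [h])"
    by (rule Cons.IH[OF w Cons.prems(2)])
  then show ?case using word_pairing_snoc[OF word_act_closed[OF w Cons.prems(2)] h] by simp
qed simp

lemma tensor_pairing_vector:
  "u \<in> carrier V \<Longrightarrow> v \<in> carrier V \<Longrightarrow> tensor_pairing p (u \<oplus> v)
      = tensor_pairing p u + tensor_pairing p v"
  "v \<in> carrier V \<Longrightarrow> tensor_pairing p (c \<odot> v) = c * tensor_pairing p v"
  by (simp_all add: tensor_pairing_def lincomb_def word_pairing_vector ring_distribs sum.distrib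
      sum_distrib_left mult_ac)

text \<open>
  The balancing relation of the tensor product over \<open>U(H)\<close>.
\<close>
lemma tensor_pairing_balanced:
  assumes "L.ncpoly q" "v \<in> carrier V"
  shows "tensor_pairing (p * q) v = tensor_pairing p (free_algebra_act V q v)"
  using assms(1)
proof (induction rule: combination_induct)
  case zero
  show ?case using tensor_pairing_vector(2)[of \<zero> p 0]
      by (simp add: free_algebra_act_zero tensor_pairing_def)
next
  case (single w c)
  have "Poly_Mapping.keys p \<subseteq> UNIV" by simp
  then show ?case
  proof (induction rule: combination_induct)
    case (single u a)
    then show ?case using \<open>w \<in> HW\<close> assms(2)
      by (simp add: tensor_pairing_def single_word_mult free_algebra_act_single word_pairing_append
          word_pairing_vector word_act_closed)
  next
    case (add p q)
    then show ?case by (simp add: tensor_pairing_def distrib_right lincomb_add)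
  qed (simp add: tensor_pairing_def)
next
  case (add q r)
  then show ?case using assms(2)
    by (simp add: distrib_left free_algebra_act_plus tensor_pairing_vector free_algebra_act_closed)
       (simp add: tensor_pairing_def lincomb_add)
qed

definition pair_value :: "sv uea \<times> 'v \<Rightarrow> complex"
  where "pair_value y = tensor_pairing (SOME p. p \<in> fst y) (snd y)"

lemma pair_value_class: "pair_value (uea_class SV p, v) = tensor_pairing p v"
proof -
  define q where "q = (SOME q. q \<in> uea_class SV p)"
  have "p \<in> uea_class SV p" by (simp add: G.mem_uea_class G.uea_ideal_closed(1))
  then have "q \<in> uea_class SV p" unfolding q_def by (rule someI)
  then have "tensor_pairing (q - p) v = 0" by (intro tensor_pairing_ideal)
      (simp add: G.mem_uea_class)
  then show ?thesis by (simp add: pair_value_def tensor_pairing_def lincomb_minus flip: q_def)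
qed

definition frag_value :: "(sv uea \<times> 'v \<Rightarrow>\<^sub>0 int) \<Rightarrow> complex"
  where "frag_value x = (\<Sum>y\<in>Poly_Mapping.keys x. of_int (Poly_Mapping.lookup x y) * pair_value y)"

lemma frag_value_simps:
  "frag_value 0 = 0" "frag_value (frag_of y) = pair_value y" "frag_value (x + z)
      = frag_value x + frag_value z"
  "frag_value (- x) = - frag_value x" "frag_value (x - z) = frag_value x - frag_value z"
proof -
  have superset: "frag_value x = (\<Sum>y\<in>A. of_int (Poly_Mapping.lookup x y) * pair_value y)"
    if "finite A" "Poly_Mapping.keys x \<subseteq> A" for A x
    unfolding frag_value_def by (rule sum.mono_neutral_left) (use that in \<open>auto simp: in_keys_iff\<close>)
  show add: "frag_value (x + z) = frag_value x + frag_value z" for x z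
  proof -
    let ?A = "Poly_Mapping.keys x \<union> Poly_Mapping.keys z"
    have "Poly_Mapping.keys (x + z) \<subseteq> ?A" by (rule Poly_Mapping.keys_add)
    then show ?thesis
      by (subst (1 2 3) superset[of ?A]) (auto simp: lookup_add ring_distribs sum.distrib)
  qed
  show minus: "frag_value (- x) = - frag_value x" for x
    by (simp add: frag_value_def sum_negf)
  show "frag_value (x - z) = frag_value x - frag_value z" using add[of x "- z"] minus[of z] by simp
  show "frag_value 0 = 0" "frag_value (frag_of y) = pair_value y"
      by (simp_all add: frag_value_def keys_frag_of)
qed

lemma frag_value_relators: "x \<in> relators \<Longrightarrow> frag_value x = 0"
  unfolding relators_def tensor_relators_def
proof (elim UnE CollectE exE conjE)
  fix a b v
  assume *: "x = frag_of (a \<oplus>\<^bsub>uea SV\<^esub> b, v) - frag_of (a, v) - frag_of (b, v)"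
    "a \<in> carrier (uea SV)" "b \<in> carrier (uea SV)" "v \<in> carrier V"
  then obtain p q where "a = uea_class SV p" "b = uea_class SV q" unfolding G.carrier_uea by blast
  then show ?thesis
    by (simp add: * frag_value_simps G.uea_class_add pair_value_class)
        (simp add: tensor_pairing_def lincomb_add)
next
  fix a v w
  assume *: "x = frag_of (a, v \<oplus> w) - frag_of (a, v) - frag_of (a, w)"
    "a \<in> carrier (uea SV)" "v \<in> carrier V" "w \<in> carrier V"
  then obtain p where "a = uea_class SV p" unfolding G.carrier_uea by blast
  then show ?thesis by (simp add: * frag_value_simps pair_value_class tensor_pairing_vector)
next
  fix a s v
  assume *: "x = frag_of (right_mult a s, v) - frag_of (a, uea_act V s v)"
    "a \<in> carrier (uea SV)" "s \<in> carrier (uea (SV_sub d1 d2))" "v \<in> carrier V"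
  then obtain p q where "a = uea_class SV p" "s = uea_class (SV_sub d1 d2) q" "L.ncpoly q"
    unfolding G.carrier_uea L.carrier_uea by blast
  then show ?thesis using *(4)
    by (simp add: *(1) frag_value_simps right_mult_class uea_act_class pair_value_class
        tensor_pairing_balanced)
qed

lemma frag_value_tensor_ker: "x \<in> tensor_ker \<Longrightarrow> frag_value x = 0"
proof -
  assume x: "x \<in> tensor_ker"
  from x[unfolded tensor_ker_eq] show ?thesis
  proof (induction rule: generate.induct)
    case (inv h)
    then have "inv\<^bsub>FA\<^esub> h = - h" using relators_carrier by (auto simp: FA_def)
    then show ?case using inv by (simp add: frag_value_simps frag_value_relators)
  qed (simp_all add: frag_value_simps frag_value_relators)
qed

text \<open>
  The pairing defines an additive functional on the tensor product which restricts to \<open>\<phi>\<close> on \<open>1 \<otimes>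
      V\<close>.
\<close>
lemma embed_nonzero: "\<phi> v \<noteq> 0 \<Longrightarrow> embed v \<noteq> \<zero>\<^bsub>Ind\<^esub>"
proof
  assume "\<phi> v \<noteq> 0" "embed v = \<zero>\<^bsub>Ind\<^esub>"
  then have "frag_of (uea_class SV 1, v) \<in> tensor_ker"
      by (simp add: embed_def tens_def Ind_simps coset_eq)
  then have "tensor_pairing 1 v = 0" using frag_value_tensor_ker
      by (metis frag_value_simps(2) pair_value_class)
  then show False using \<open>\<phi> v \<noteq> 0\<close>
    by (simp add: tensor_pairing_def word_pairing_Nil flip: single_one_word)
qed

end

section \<open>Simplicity and local nilpotency\<close>

theorem theorem3p1:
  fixes d1 d2 t :: nat
    and V :: "(sv, 'v) lie_module"
    and \<nu>0 c :: complex
  assumes "int d1 \<ge> 2 * int d2 - 1"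
    and "simple_lie_module (SV_sub d1 d2) V"
    and "\<forall>v \<in> carrier V. act V (sv_M 0) v = \<nu>0 \<odot>\<^bsub>V\<^esub> v"
    and "\<forall>v \<in> carrier V. act V sv_C v = c \<odot>\<^bsub>V\<^esub> v"
    and "inj_on (act V (sv_M (int t))) (carrier V)"
    and "\<forall>i > int t. \<forall>v \<in> carrier V. act V (sv_M i) v = \<zero>\<^bsub>V\<^esub>"
    and "\<forall>j > int t + int d2. \<forall>v \<in> carrier V. act V (sv_Y (j - 1)) v = \<zero>\<^bsub>V\<^esub>"
    and "\<forall>k > int t + int d1. \<forall>v \<in> carrier V. act V (sv_L k) v = \<zero>\<^bsub>V\<^esub>"
  shows "simple_lie_module SV (induced_module SV (SV_sub d1 d2) V)
    \<and> (\<forall>i > int t. locally_nilpotent (induced_module SV (SV_sub d1 d2) V) (sv_M i))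
    \<and> (\<forall>j > int t + int d2. locally_nilpotent (induced_module SV (SV_sub d1 d2) V) (sv_Y (j - 1)))
    \<and> (\<forall>k > int t + int d1. locally_nilpotent (induced_module SV (SV_sub d1 d2) V) (sv_L k))"
proof -
  let ?H = "SV_sub d1 d2"
  have V: "lie_module ?H V" "carrier V \<noteq> {\<zero>\<^bsub>V\<^esub>}"
    and V_simple: "\<And>W. lie_submodule ?H V W \<Longrightarrow> W = {\<zero>\<^bsub>V\<^esub>} \<or> W = carrier V"
    using assms(2) by (auto simp: simple_lie_module_def)
  have "lie_induction_axioms SV ?H"
    by (rule lie_induction_axioms.intro) simp_all
  then interpret lie_induction SV ?H V
    by (rule lie_induction.intro[OF lie_algebra_SV V(1)])
  \<comment> \<open>A coordinate functional of \<open>V\<close> that does not vanish at some \<open>v0\<close> shows that \<open>1 \<otimes> v0 \<noteq> 0\<close>.\<close>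
  obtain \<iota>V evV where "coordinates V \<iota>V evV"
    using complex_module_coordinates[OF V.module_axioms] by blast
  then interpret CV: coordinates V \<iota>V evV .
  obtain v0 where v0: "v0 \<in> carrier V" "v0 \<noteq> \<zero>\<^bsub>V\<^esub>" using V(2) V.zero_closed by blast
  have "\<iota>V v0 \<noteq> 0"
  proof
    assume "\<iota>V v0 = 0"
    then have "v0 = evV (fscale 0 0)"
      using CV.ev_\<iota>[OF v0(1)] fscale_zero[of 0] by metis
    then show False using CV.ev_scale[of 0 0] CV.ev_closed[of 0] v0(2) by simp
  qed
  then obtain k where k: "Poly_Mapping.lookup (\<iota>V v0) k \<noteq> 0"
    by (metis poly_mapping_eqI lookup_zero)
  have "sv_sub_functional_axioms d1 d2 V (\<lambda>v. Poly_Mapping.lookup (\<iota>V v) k)"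
    by (rule sv_sub_functional_axioms.intro)
        (use assms(1) CV.\<iota>_add CV.\<iota>_smult in \<open>simp_all add: lookup_add\<close>)
  then interpret sv_induction d1 d2 V "\<lambda>v. Poly_Mapping.lookup (\<iota>V v) k"
    by (intro sv_induction.intro sv_sub_functional.intro[OF V(1)] lie_induction_axioms)
  interpret I: lie_module SV Ind by (rule Ind_lie_module)
  have embed_v0: "embed v0 \<noteq> \<zero>\<^bsub>Ind\<^esub>" using k by (rule embed_nonzero)
  have pullback: "lie_submodule ?H V {v \<in> carrier V. embed v \<in> W}"
      if W: "lie_submodule SV Ind W" for W
  proof -
    have sub: "submodule W complex_field Ind" and actW: "\<And>x w. w \<in> W \<Longrightarrow> act Ind x w \<in> W"
      using W by (auto simp: lie_submodule_def)
    note W' = I.V.submoduleE[OF sub]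
    have zeroW: "\<zero>\<^bsub>Ind\<^esub> \<in> W" using sub subgroup.one_closed submodule.axioms(1) by fastforce
    show ?thesis
      unfolding lie_submodule_def
    proof (intro conjI V.submoduleI ballI)
      have "embed \<zero>\<^bsub>V\<^esub> = \<zero>\<^bsub>Ind\<^esub>"
        using embed_smult[of "\<zero>\<^bsub>V\<^esub>" 0] I.smult_zero[OF embed_closed] by simp
      then show "\<zero>\<^bsub>V\<^esub> \<in> {v \<in> carrier V. embed v \<in> W}" using zeroW by simp
      show smult: "a \<odot>\<^bsub>V\<^esub> v \<in> {v \<in> carrier V. embed v \<in> W}"
          if "v \<in> {v \<in> carrier V. embed v \<in> W}" for a v
        using that W'(4) V.smult_closed by (simp add: embed_smult)
      show "\<ominus>\<^bsub>V\<^esub> v \<in> {v \<in> carrier V. embed v \<in> W}" if "v \<in> {v \<in> carrier V. embed v \<in> W}" for v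
        using smult[OF that, of "- 1"] that by (simp add: uminus_smult)
    qed (use W'(5) actW act_closed in \<open>auto simp: embed_add embed_act\<close>)
  qed
  \<comment> \<open>By simplicity of \<open>V\<close>, a submodule meeting \<open>1 \<otimes> V\<close> nontrivially contains it.\<close>
  have absorb: "W = carrier Ind" if W: "lie_submodule SV Ind W"
      and v: "v \<in> carrier V" "v \<noteq> \<zero>\<^bsub>V\<^esub>" "embed v \<in> W" for W v
  proof
    have sub: "submodule W complex_field Ind" and actW: "\<And>x w. w \<in> W \<Longrightarrow> act Ind x w \<in> W"
      using W by (auto simp: lie_submodule_def)
    note W' = I.V.submoduleE[OF sub]
    show "W \<subseteq> carrier Ind" by (rule W'(1))
    have "{v \<in> carrier V. embed v \<in> W} = carrier V" using V_simple[OF pullback[OF W]] v by auto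
    then show "carrier Ind \<subseteq> W"
      using W'(4,5) actW v(1) by (intro Ind_generated) auto
  qed
  have zero_submodule: "lie_submodule SV Ind {\<zero>\<^bsub>Ind\<^esub>}"
    unfolding lie_submodule_def
    by (intro conjI I.V.submoduleI) (simp_all add: I.act_zero_right I.V.smult_r_null)
  have Ind_nonzero: "carrier Ind \<noteq> {\<zero>\<^bsub>Ind\<^esub>}" using embed_v0 embed_closed[OF v0(1)] by blast
  \<comment> \<open>Otherwise \<open>absorb\<close> would make the zero submodule everything.\<close>
  have embed_inj: "v = \<zero>\<^bsub>V\<^esub>" if "v \<in> carrier V" "embed v = \<zero>\<^bsub>Ind\<^esub>" for v
    using absorb[OF zero_submodule that(1)] that(2) Ind_nonzero by auto
  obtain \<iota> ev where "coordinates Ind \<iota> ev"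
    using complex_module_coordinates[OF I.V.module_axioms] by blast
  then interpret coordinates Ind \<iota> ev .
  \<comment> \<open>The action in coordinates, extended by the retraction \<open>ev\<close> to all formal combinations.\<close>
  define R where "R x p = \<iota> (act Ind x (ev p))" for x p
  have R_\<iota>: "R x (\<iota> S) = \<iota> (act Ind x S)" if "S \<in> carrier Ind" for x S
    using that by (simp add: R_def ev_\<iota>)
  have \<iota>_minus: "\<iota> (S \<ominus>\<^bsub>Ind\<^esub> T) = \<iota> S - \<iota> T" if "S \<in> carrier Ind" "T \<in> carrier Ind" for S T
    using \<iota>_add[of "S \<ominus>\<^bsub>Ind\<^esub> T" T] that by (simp add: Ind.minus_eq Ind.a_assoc Ind.l_neg)
  have \<iota>_zero: "\<iota> \<zero>\<^bsub>Ind\<^esub> = 0" using \<iota>_add[of "\<zero>\<^bsub>Ind\<^esub>" "\<zero>\<^bsub>Ind\<^esub>"] by simp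
  have \<iota>_inj: "S = \<zero>\<^bsub>Ind\<^esub>" if "S \<in> carrier Ind" "\<iota> S = 0" for S
    using that ev_\<iota> \<iota>_zero Ind.zero_closed by metis
  interpret F: sv_rep fscale R
  proof (intro sv_rep.intro complex_space.intro fscale_vector_space sv_rep_axioms.intro)
    fix x y p q a
    show "R (x + y) p = R x p + R y p"
      using I.act_add_left[of x y "ev p"] by (simp add: R_def ev_closed \<iota>_add I.act_closed)
    show "R (sv_scale a x) p = fscale a (R x p)"
      using I.act_smult_left[of x "ev p" a] by (simp add: R_def ev_closed \<iota>_smult I.act_closed)
    show "R x (p + q) = R x p + R x q"
      by (simp add: R_def ev_closed ev_add \<iota>_add I.act_closed I.act_add_right)
    show "R x (fscale a p) = fscale a (R x p)"
      by (simp add: R_def ev_closed ev_scale \<iota>_smult I.act_closed I.act_smult_right)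
    show "R (sv_bracket x y) p = R x (R y p) - R y (R x p)"
      using I.act_lie_bracket[of x y "ev p"]
          by (simp add: R_def ev_closed ev_\<iota> \<iota>_minus I.act_closed)
  qed
  define J where "J = \<iota> ` embed ` carrier V"
  have H_gens: "i \<ge> - int d1 \<Longrightarrow> sv_M i \<in> carrier ?H" "i \<ge> - int d2 \<Longrightarrow> sv_Y i \<in> carrier ?H"
    "i \<ge> 0 \<Longrightarrow> sv_L i \<in> carrier ?H" "sv_C \<in> carrier ?H" for i
    by (simp_all add: carrier_SV_sub sv_sub_index_def sv_M_def sv_Y_def sv_L_def sv_C_def)
  have R_J: "R x (\<iota> (embed v)) = \<iota> (embed (act V x v))" if "x \<in> carrier ?H" "v \<in> carrier V" for x v
    using that by (simp add: R_\<iota> embed_closed embed_act)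
  have J_closed: "R x p \<in> J" if "x \<in> carrier ?H" "p \<in> J" for x p
    using that R_J act_closed unfolding J_def by blast
  have embed_zero: "\<iota> (embed \<zero>\<^bsub>V\<^esub>) = 0"
    using embed_smult[of "\<zero>\<^bsub>V\<^esub>" 0] I.smult_zero[OF embed_closed] \<iota>_zero by simp
  have J_kill: "R x p = 0" if "x \<in> carrier ?H" "\<And>v. v \<in> carrier V \<Longrightarrow> act V x v = \<zero>\<^bsub>V\<^esub>" "p \<in> J"
      for x p
    using that R_J embed_zero unfolding J_def by auto
  interpret lowering: sv_lowering fscale R J d1 d2 t
  proof
    show "F.subspace J"
    proof (rule F.subspaceI)
      show "0 \<in> J" unfolding J_def using embed_zero V.zero_closed by (metis imageI)
      fix p q a assume "p \<in> J" "q \<in> J"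
      then obtain v w where v: "v \<in> carrier V" "p = \<iota> (embed v)"
          and w: "w \<in> carrier V" "q = \<iota> (embed w)"
        unfolding J_def by blast
      have "p + q = \<iota> (embed (v \<oplus>\<^bsub>V\<^esub> w))" using v w by (simp add: embed_add embed_closed \<iota>_add)
      then show "p + q \<in> J" unfolding J_def using V.a_closed[OF v(1) w(1)] by blast
    next
      fix a p assume "p \<in> J"
      then obtain v where v: "v \<in> carrier V" "p = \<iota> (embed v)" unfolding J_def by blast
      have "fscale a p = \<iota> (embed (a \<odot>\<^bsub>V\<^esub> v))" using v
          by (simp add: embed_smult embed_closed \<iota>_smult)
      then show "fscale a p \<in> J" unfolding J_def using V.smult_closed[of a v] v(1) by simp
    qed
    fix i :: int and p assume p: "p \<in> J"
    show "R (sv_M i) p \<in> J" if "i \<ge> - int d1" using J_closed H_gens(1)[OF that] p by blast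
    show "R (sv_Y i) p \<in> J" if "i \<ge> - int d2" using J_closed H_gens(2)[OF that] p by blast
    show "R (sv_L i) p \<in> J" if "i \<ge> 0" using J_closed H_gens(3)[OF that] p by blast
    show "R sv_C p \<in> J" using J_closed H_gens(4) p by blast
    show "R (sv_M i) p = 0" if "i > int t" using that assms(6) p by (intro J_kill H_gens(1)) auto
    \<comment> \<open>Shift by one: the generator with subscript \<open>j - 1/2\<close> is \<open>sv_Y (j - 1)\<close>.\<close>
    show "R (sv_Y i) p = 0" if "i \<ge> int t + int d2"
      using that assms(7)[rule_format, of "i + 1"] p by (intro J_kill H_gens(2)) auto
    show "R (sv_L i) p = 0" if "i > int t + int d1" using that assms(8) p
        by (intro J_kill H_gens(3)) auto
    show "p = 0" if "R (sv_M (int t)) p = 0"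
    proof -
      obtain v where v: "v \<in> carrier V" "p = \<iota> (embed v)" using p unfolding J_def by blast
      have M: "sv_M (int t) \<in> carrier ?H" by (rule H_gens) simp
      have Mv: "act V (sv_M (int t)) v \<in> carrier V" by (rule act_closed[OF M v(1)])
      have "\<iota> (embed (act V (sv_M (int t)) v)) = 0" using that R_J[OF M v(1)] v(2) by simp
      then have "act V (sv_M (int t)) v = \<zero>\<^bsub>V\<^esub>"
          by (rule embed_inj[OF Mv \<iota>_inj[OF embed_closed[OF Mv]]])
      then have "act V (sv_M (int t)) v = act V (sv_M (int t)) \<zero>\<^bsub>V\<^esub>" using act_zero_right[OF M]
          by simp
      then have "v = \<zero>\<^bsub>V\<^esub>" using assms(5) v(1) V.zero_closed by (auto dest: inj_onD)
      then show "p = 0" using v(2) embed_zero by simp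
    qed
  qed
  have generated: "\<iota> S \<in> F.opspan (range R) J" if "S \<in> carrier Ind" for S
  proof -
    have "carrier Ind \<subseteq> {S. \<iota> S \<in> F.opspan (range R) J}"
    proof (rule Ind_generated; (unfold mem_Collect_eq)?)
      show "\<iota> (embed v) \<in> F.opspan (range R) J" if "v \<in> carrier V" for v
        using that by (intro F.opspan_base) (auto simp: J_def)
      show "\<iota> (S \<oplus>\<^bsub>Ind\<^esub> T) \<in> F.opspan (range R) J"
        if "S \<in> carrier Ind" "T \<in> carrier Ind" "\<iota> S \<in> F.opspan (range R) J"
            "\<iota> T \<in> F.opspan (range R) J" for S T
        using that by (simp add: \<iota>_add F.opspan_add)
      show "\<iota> (a \<odot>\<^bsub>Ind\<^esub> S) \<in> F.opspan (range R) J"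
        if "S \<in> carrier Ind" "\<iota> S \<in> F.opspan (range R) J" for a S
        using that by (simp add: \<iota>_smult F.opspan_scale)
      show "\<iota> (act Ind x S) \<in> F.opspan (range R) J"
        if "S \<in> carrier Ind" "\<iota> S \<in> F.opspan (range R) J" for x S
        using that F.opspan_op[of "R x" "range R" "\<iota> S" J] by (simp add: R_\<iota>)
      show "carrier V \<noteq> {}" using v0 by blast
    qed
    then show ?thesis using that by blast
  qed
  have "simple_lie_module SV Ind"
    unfolding simple_lie_module_def
  proof (intro conjI allI impI I.lie_module_axioms Ind_nonzero)
    fix W assume W: "lie_submodule SV Ind W"
    have sub: "submodule W complex_field Ind" and actW: "\<And>x w. w \<in> W \<Longrightarrow> act Ind x w \<in> W"
      using W by (auto simp: lie_submodule_def)
    note W' = I.V.submoduleE[OF sub]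
    have zeroW: "\<zero>\<^bsub>Ind\<^esub> \<in> W" using sub subgroup.one_closed submodule.axioms(1) by fastforce
    show "W = {\<zero>\<^bsub>Ind\<^esub>} \<or> W = carrier Ind"
    proof (cases "W = {\<zero>\<^bsub>Ind\<^esub>}")
      case False
      then obtain S where S: "S \<in> W" "S \<noteq> \<zero>\<^bsub>Ind\<^esub>" using zeroW by blast
      have SI: "S \<in> carrier Ind" using S(1) W'(1) by blast
      have "R x w \<in> \<iota> ` W" if "w \<in> \<iota> ` W" for x w
        using that W'(1) actW R_\<iota> by (auto simp: subset_iff)
      moreover have "\<iota> S \<in> \<iota> ` W" "\<iota> S \<noteq> 0" using S(1) \<iota>_inj[OF SI] S(2) by auto
      ultimately obtain w where w: "w \<in> \<iota> ` W" "w \<in> J" "w \<noteq> 0"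
        using lowering.descend[of "\<iota> ` W" "\<iota> S"] generated[OF SI] by blast
      then obtain T v where T: "T \<in> W" "w = \<iota> T" and v: "v \<in> carrier V" "w = \<iota> (embed v)"
        unfolding J_def by blast
      have "T = embed v"
        using ev_\<iota>[of T] ev_\<iota>[OF embed_closed[OF v(1)]] T v(2) W'(1) by auto
      moreover have "v \<noteq> \<zero>\<^bsub>V\<^esub>" using w(3) v(2) embed_zero by auto
      ultimately show ?thesis using absorb[OF W v(1)] T(1) by blast
    qed simp
  qed
  moreover have nilpotent: "locally_nilpotent Ind x"
      if nil: "\<And>p. p \<in> F.opspan (range R) J \<Longrightarrow> p \<in> F.nil x" for x
    unfolding locally_nilpotent_def
  proof
    fix S assume S: "S \<in> carrier Ind"
    have pow: "(act Ind x ^^ n) S \<in> carrier Ind \<and> (R x ^^ n) (\<iota> S) = \<iota> ((act Ind x ^^ n) S)" for n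
      by (induction n) (simp_all add: S R_\<iota> I.act_closed)
    obtain n where "(R x ^^ n) (\<iota> S) = 0" using nil[OF generated[OF S]] by (auto simp: F.nil_def)
    then have "(act Ind x ^^ n) S = \<zero>\<^bsub>Ind\<^esub>" using pow[of n] \<iota>_inj by metis
    then have "(act Ind x ^^ Suc n) S = \<zero>\<^bsub>Ind\<^esub>" by (simp add: I.act_zero_right)
    then show "\<exists>n>0. (act Ind x ^^ n) S = \<zero>\<^bsub>Ind\<^esub>" by blast
  qed
  moreover have "locally_nilpotent Ind (sv_M i)" if "i > int t" for i
    using that by (intro nilpotent lowering.locally_nilpotent_lowering(1))
  moreover have "locally_nilpotent Ind (sv_Y (j - 1))" if "j > int t + int d2" for j
    using that by (intro nilpotent lowering.locally_nilpotent_lowering(2)) auto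
  moreover have "locally_nilpotent Ind (sv_L k)" if "k > int t + int d1" for k
    using that by (intro nilpotent lowering.locally_nilpotent_lowering(3))
  ultimately show ?thesis by blast
qed

end
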